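(* Let $f$ be a strictly postcritically finite rational map of degree $d\ge 2$ of the Riemann sphere $\hat{\mathbb C}$. Then the set of invariant probability measures of $f$ which are supported on the orbit of a (single) periodic point is dense, for the weak-$*$ topology, in the set $\mathcal M_1(f)$ of all $f$-invariant Borel probability measures.
   Context: A rational map is strictly postcritically finite if each of its critical points is eventually mapped to a repelling periodic orbit. *)

theory Defs
  imports "HOL-Probability.Probability" "HOL-Computational_Algebra.Computational_Algebra"
    "HOL-Complex_Analysis.Complex_Analysis"
begin

text \<open>The Riemann sphere is the one-point compactification of the complex plane;
  the point at infinity is \<open>None\<close>.\<close>

type_synonym sphere = "complex option"

definition sphere_topology :: "sphere topology" where
  "sphere_topology = Alexandroff_compactification euclidean"

definition sphere_borel :: "sphere measure" where
  "sphere_borel = sigma (topspace sphere_topology) {U. openin sphere_topology U}"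

text \<open>For coprime \<open>p\<close> and \<open>q\<close>, this is the continuous extension of \<open>p / q\<close> to the sphere.\<close>

fun ratio_map :: "complex poly \<Rightarrow> complex poly \<Rightarrow> sphere \<Rightarrow> sphere" where
  "ratio_map p q (Some z) = (if poly q z = 0 then None else Some (poly p z / poly q z))"
| "ratio_map p q None =
    (if degree p > degree q then None else Some (coeff p (degree q) / lead_coeff q))"

definition rational_map :: "(sphere \<Rightarrow> sphere) \<Rightarrow> nat \<Rightarrow> bool" where
  "rational_map f d \<longleftrightarrow>
    (\<exists>p q. q \<noteq> 0 \<and> coprime p q \<and> d = max (degree p) (degree q) \<and> f = ratio_map p q)"

text \<open>\<open>chart x\<close> is the standard coordinate around \<open>x\<close>: \<open>z\<close> if \<open>x\<close> is finite and \<open>1/z\<close> if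
  \<open>x\<close> is infinity, with inverse \<open>chart_inv x\<close>. The value of \<open>chart x\<close> at the one point not
  covered by that coordinate is irrelevant, since charts are only used for germs at \<open>x\<close>.\<close>

definition chart :: "sphere \<Rightarrow> sphere \<Rightarrow> complex" where
  "chart x y = (case y of None \<Rightarrow> 0 | Some z \<Rightarrow> if x = None then inverse z else z)"

definition chart_inv :: "sphere \<Rightarrow> complex \<Rightarrow> sphere" where
  "chart_inv x w =
    (if x = None then (if w = 0 then None else Some (inverse w)) else Some w)"

text \<open>The derivative in the standard coordinates around \<open>x\<close> and \<open>f x\<close>. Its vanishing does not
  depend on the coordinates, and its value does not either when \<open>f x = x\<close>.\<close>

definition sphere_deriv :: "(sphere \<Rightarrow> sphere) \<Rightarrow> sphere \<Rightarrow> complex" where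
  "sphere_deriv f x = deriv (\<lambda>w. chart (f x) (f (chart_inv x w))) (chart x x)"

definition critical_point :: "(sphere \<Rightarrow> sphere) \<Rightarrow> sphere \<Rightarrow> bool" where
  "critical_point f x \<longleftrightarrow> sphere_deriv f x = 0"

definition periodic_point :: "('a \<Rightarrow> 'a) \<Rightarrow> 'a \<Rightarrow> bool" where
  "periodic_point f x \<longleftrightarrow> (\<exists>n>0. (f ^^ n) x = x)"

definition period :: "('a \<Rightarrow> 'a) \<Rightarrow> 'a \<Rightarrow> nat" where
  "period f x = (LEAST n. n > 0 \<and> (f ^^ n) x = x)"

definition forward_orbit :: "('a \<Rightarrow> 'a) \<Rightarrow> 'a \<Rightarrow> 'a set" where
  "forward_orbit f x = range (\<lambda>n. (f ^^ n) x)"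

definition multiplier :: "(sphere \<Rightarrow> sphere) \<Rightarrow> sphere \<Rightarrow> complex" where
  "multiplier f x = sphere_deriv (f ^^ period f x) x"

definition repelling_periodic_point :: "(sphere \<Rightarrow> sphere) \<Rightarrow> sphere \<Rightarrow> bool" where
  "repelling_periodic_point f x \<longleftrightarrow> periodic_point f x \<and> norm (multiplier f x) > 1"

definition strictly_postcritically_finite :: "(sphere \<Rightarrow> sphere) \<Rightarrow> bool" where
  "strictly_postcritically_finite f \<longleftrightarrow>
    (\<forall>c. critical_point f c \<longrightarrow> (\<exists>n. repelling_periodic_point f ((f ^^ n) c)))"

definition sphere_prob_measures :: "sphere measure set" where
  "sphere_prob_measures = {\<mu>. prob_space \<mu> \<and> sets \<mu> = sets sphere_borel}"

definition invariant_measures :: "(sphere \<Rightarrow> sphere) \<Rightarrow> sphere measure set" where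
  "invariant_measures f = {\<mu> \<in> sphere_prob_measures. distr \<mu> sphere_borel f = \<mu>}"

definition periodic_orbit_measures :: "(sphere \<Rightarrow> sphere) \<Rightarrow> sphere measure set" where
  "periodic_orbit_measures f =
    {\<mu> \<in> invariant_measures f. \<exists>x. periodic_point f x \<and> emeasure \<mu> (forward_orbit f x) = 1}"

text \<open>The coarsest topology making \<open>\<mu> \<mapsto> \<integral>g d\<mu>\<close> continuous for every continuous \<open>g\<close>.\<close>

definition weak_star_topology :: "sphere measure topology" where
  "weak_star_topology = topology_generated_by
    {{\<mu> \<in> sphere_prob_measures. integral\<^sup>L \<mu> g \<in> U} | g U.
      continuous_map sphere_topology euclideanreal g \<and> open U}"

end

theory Submission
  imports Defs
begin

text \<open>
  Let \<open>Z\<close> be the preimage of the postcritical set under a high iterate of \<open>f\<close>. It is finite, its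
  cycles are repelling, and after conjugation with a Moebius map it contains \<open>0\<close>, \<open>1\<close> and infinity.
  Off \<open>Z\<close> the map is a covering, so all iterates have inverse branches on discs that avoid \<open>Z\<close>.
  These branches omit \<open>0\<close> and \<open>1\<close>, hence form a normal family, and every limit of branches of
  increasing order is constant: inverse branches contract. Orbit segments that start and end in a
  compact set disjoint from \<open>Z\<close> can therefore be joined by bridges of bounded length and
  closed up, by Brouwer's theorem, to periodic orbits that shadow them.

  Given an invariant measure and a length \<open>n\<close>, all points outside a set of small measure either start a
  segment of length \<open>n\<close> of this kind or lie on a cycle in \<open>Z\<close>. A cycle in \<open>Z\<close> has
  preimages outside \<open>Z\<close> and is repelling, so it is imitated by segments that start outside \<open>Z\<close>, spend
  almost all of their time near the cycle and leave again. Concatenating segments with suitable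
  multiplicities gives periodic orbits whose averages approximate any given invariant measure.
\<close>

section \<open>The topology of the Riemann sphere\<close>

text \<open>No expanding metric is built. Contraction is only qualitative: it comes from limits of
  sequences of branches, and compactness makes it uniform over a compact subset of \<open>Y\<close>.
  What it does not control, the bridges and a bounded number of steps at the end of each segment,
  enters as an additive constant \<open>D\<close> per segment that does not depend on the length;
  segments are taken so long that \<open>D\<close> becomes negligible. That limits are constant
  rests on a self-comparison: with a nonconstant limit, two late branches take a common value near
  the same point, and an iterate of one of them is then a branch close to the identity, of large
  order. Points of \<open>Y\<close> whose orbit meets \<open>Z\<close> rule this out. An invariant
  measure need not be ergodic, so one does not look for a generic orbit. Birkhoff averages over a
  finite time have the same integrals as the test functions, and these integrals are replaced by
  finite weighted sums over orbit segments. The mass on \<open>Z\<close> needs separate care,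
  because no inverse branches are available there.\<close>

lemma topspace_sphere [simp]: "topspace sphere_topology = UNIV"
  by (auto simp: sphere_topology_def) (metis not_None_eq rangeI)

lemma compact_space_sphere: "compact_space sphere_topology"
  by (simp add: sphere_topology_def)

lemma Hausdorff_space_sphere: "Hausdorff_space sphere_topology"
  by (simp add: sphere_topology_def Hausdorff_space_Alexandroff_compactification
      locally_compact_space_euclidean)

lemma openin_sphere_Some_image [simp]: "openin sphere_topology (Some ` U) \<longleftrightarrow> open U"
  by (simp add: sphere_topology_def)

lemma closedin_sphere_Some_image [simp]: "closedin sphere_topology (Some ` K) \<longleftrightarrow> compact K"
  by (auto simp: sphere_topology_def compact_imp_closed)

lemma continuous_map_sphere_Some: "continuous_map euclidean sphere_topology Some"
  by (simp add: sphere_topology_def continuous_map_Some)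

lemma open_Some_preimage: "openin sphere_topology U \<Longrightarrow> open {u. Some u \<in> U}"
  using openin_continuous_map_preimage[OF continuous_map_sphere_Some] by fastforce

lemma closedin_sphere_Compl: "closedin sphere_topology A \<longleftrightarrow> openin sphere_topology (- A)"
  by (simp add: closedin_def Compl_eq_Diff_UNIV)

lemma closedin_sphere_finite: "finite Z \<Longrightarrow> closedin sphere_topology Z"
  using Hausdorff_imp_t1_space[OF Hausdorff_space_sphere] by (simp add: t1_space_closedin_finite)

lemma compact_Some_preimage:
  assumes "closedin sphere_topology K" "None \<notin> K"
  shows "compact {u. Some u \<in> K}"
proof -
  have "K = Some ` {u. Some u \<in> K}"
    using assms(2) by auto (metis (mono_tags) image_eqI mem_Collect_eq not_None_eq)
  then show ?thesis using assms(1) closedin_sphere_Some_image by metis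
qed

lemma continuous_on_Some_comp:
  assumes "continuous_map sphere_topology euclideanreal g"
  shows "continuous_on UNIV (\<lambda>u. g (Some u))"
  using continuous_map_compose[OF continuous_map_sphere_Some assms] by (simp add: o_def)

lemma continuous_map_sphere_bounded:
  assumes "continuous_map sphere_topology euclideanreal g"
  obtains C where "C > 0" "\<And>x. \<bar>g x\<bar> \<le> C"
proof -
  have "compactin euclideanreal (g ` UNIV)"
    using image_compactin[OF _ assms] compact_space_sphere
    by (metis compact_space_def topspace_sphere)
  then have "bounded (range g)" by (simp add: compact_imp_bounded)
  then obtain C where "C > 0" "\<And>x. \<bar>g x\<bar> \<le> C"
    by (auto simp: bounded_pos)
  then show ?thesis using that by blast
qed

section \<open>Expanding maps and their inverse branches\<close>

text \<open>The dynamical properties of \<open>f\<close> off \<open>Z\<close> in normalised position. The assumption \<open>repelling_Z\<close> says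
  topologically that the cycles in \<open>Z\<close> are repelling.\<close>

locale expanding_map =
  fixes F :: "sphere \<Rightarrow> sphere" and Z :: "sphere set"
  assumes finite_Z: "finite Z"
    and Z_points: "None \<in> Z" "Some 0 \<in> Z" "Some 1 \<in> Z"
    and F_Z: "F ` Z \<subseteq> Z"
    and cont_F: "continuous_map sphere_topology sphere_topology F"
    and surj_F: "surj F"
    and finite_fibre: "finite {x. F x = y}"
    and hol_F: "(\<lambda>u. the (F (Some u))) holomorphic_on {u. F (Some u) \<notin> Z}"
    and locally_inj: "F (Some u) \<notin> Z \<Longrightarrow> \<exists>U. open U \<and> u \<in> U \<and> inj_on (\<lambda>u. F (Some u)) U"
    and repelling_Z: "\<lbrakk>p \<in> Z; n > 0; (F ^^ n) p = p\<rbrakk> \<Longrightarrow>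
      \<exists>U. openin sphere_topology U \<and> p \<in> U \<and> (\<forall>z. (\<forall>k. (F ^^ (n * k)) z \<in> U) \<longrightarrow> z = p)"
    and backward_Z: "p \<in> Z \<Longrightarrow> \<exists>m q. q \<notin> Z \<and> (F ^^ m) q = p"
begin

definition Y :: "complex set" where "Y = {u. Some u \<notin> Z}"
definition X :: "complex set" where "X = {u. F (Some u) \<notin> Z}"
definition Fc :: "complex \<Rightarrow> complex" where "Fc u = the (F (Some u))"

lemma closedin_Z: "closedin sphere_topology Z"
  by (simp add: closedin_sphere_finite finite_Z)

lemma finite_compl_Y: "finite (- Y)"
proof -
  have "- Y \<subseteq> the ` Z" unfolding Y_def by (auto simp: image_iff) (metis option.sel)
  then show ?thesis using finite_Z finite_surj by blast
qed

lemma open_Y: "open Y"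
  using finite_imp_closed[OF finite_compl_Y] by (simp add: closed_def)

lemma connected_Y: "connected Y"
  using connected_open_delete_finite[of UNIV "-Y"] finite_compl_Y
  by (simp add: Diff_eq connected_UNIV)

lemma cont_funpow: "continuous_map sphere_topology sphere_topology (F ^^ n)"
proof (induction n)
  case 0
  then show ?case by (simp add: id_def)
next
  case (Suc n)
  then show ?case using continuous_map_compose[OF Suc cont_F] by (simp add: o_def)
qed

lemma openin_funpow_vimage:
  "openin sphere_topology U \<Longrightarrow> openin sphere_topology {x. (F ^^ n) x \<in> U}"
  using openin_continuous_map_preimage[OF cont_funpow] by fastforce

lemma closedin_funpow_image:
  assumes "closedin sphere_topology C"
  shows "closedin sphere_topology ((F ^^ n) ` C)"
proof -
  have "compactin sphere_topology C"
    using assms closedin_compact_space compact_space_sphere by blast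
  then show ?thesis
    using image_compactin[OF _ cont_funpow] Hausdorff_space_sphere compactin_imp_closedin by blast
qed

lemma open_X: "open X"
proof -
  have "openin sphere_topology (- Z)" using closedin_Z
    by (simp add: closedin_def Compl_eq_Diff_UNIV)
  from open_Some_preimage[OF openin_funpow_vimage[OF this, of 1]]
  show ?thesis by (simp add: X_def)
qed

lemma funpow_Z: "x \<in> Z \<Longrightarrow> (F ^^ n) x \<in> Z"
  using F_Z by (induction n) auto

lemma funpow_Z_mono: "(F ^^ m) x \<in> Z \<Longrightarrow> m \<le> n \<Longrightarrow> (F ^^ n) x \<in> Z"
  using funpow_Z[of "(F ^^ m) x" "n - m"]
  by (metis comp_apply funpow_add le_add_diff_inverse2)

lemma F_Fc: "u \<in> X \<Longrightarrow> F (Some u) = Some (Fc u)"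
  using Z_points unfolding X_def Fc_def by (metis mem_Collect_eq option.exhaust_sel)

lemma Fc_in_Y: "u \<in> X \<Longrightarrow> Fc u \<in> Y"
  using F_Fc unfolding X_def Y_def by fastforce

lemma hol_Fc: "Fc holomorphic_on X"
  using hol_F unfolding Fc_def[abs_def] X_def .

lemma finite_fibre_funpow: "finite {x. (F ^^ n) x = y}"
proof (induction n arbitrary: y)
  case 0
  then show ?case by simp
next
  case (Suc n)
  have "{x. (F ^^ Suc n) x = y} = (\<Union>y'\<in>{y'. F y' = y}. {x. (F ^^ n) x = y'})" by auto
  then show ?case using finite_fibre Suc by simp
qed

text \<open>Local injectivity makes the map injective on small disjoint discs about the finitely
  many points of a fibre. The rest of the sphere is compact and its image misses \<open>y\<close>,
  so all preimages of points near \<open>y\<close> lie in the discs. Compactness of the sphere thus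
  replaces an argument on the noncompact set \<open>X\<close>.\<close>

lemma covering: "covering_space X Fc Y"
proof
  show cont: "continuous_on X Fc" using hol_Fc holomorphic_on_imp_continuous_on by blast
  show "Fc ` X = Y"
  proof
    show "Fc ` X \<subseteq> Y" using Fc_in_Y by blast
    show "Y \<subseteq> Fc ` X"
    proof
      fix y assume y: "y \<in> Y"
      obtain x where x: "F x = Some y" using surj_F by (metis surjD)
      have "x \<noteq> None"
      proof
        assume "x = None"
        then have "Some y \<in> Z" using x Z_points F_Z by (metis image_subset_iff)
        then show False using y by (simp add: Y_def)
      qed
      then obtain u where "x = Some u" by blast
      then show "y \<in> Fc ` X" using x y unfolding Y_def X_def Fc_def by (auto simp: image_iff intro!: exI[of _ u])
    qed
  qed
  fix y assume y: "y \<in> Y"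
  define S where "S = {u. F (Some u) = Some y}"
  have finS: "finite S"
  proof -
    have "S \<subseteq> the ` {x. F x = Some y}" by (auto simp: S_def image_iff) (metis option.sel)
    then show ?thesis using finite_fibre finite_surj by blast
  qed
  have SX: "S \<subseteq> X" using y by (auto simp: S_def X_def Y_def)
  have "\<forall>x\<in>S. eventually (\<lambda>r. ball x r \<subseteq> X \<and> inj_on Fc (ball x r) \<and>
      (\<forall>x'\<in>S. x' \<noteq> x \<longrightarrow> ball x r \<inter> ball x' r = {})) (at_right 0)"
  proof
    fix x assume x: "x \<in> S"
    then have xX: "x \<in> X" using SX by blast
    then obtain U where U: "open U" "x \<in> U" "inj_on (\<lambda>u. F (Some u)) U"
      using locally_inj unfolding X_def by blast
    have "open (U \<inter> X)" using U open_X by blast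
    then obtain r0 where r0: "r0 > 0" "ball x r0 \<subseteq> U \<inter> X" using U xX open_contains_ball by blast
    have inj: "inj_on Fc (ball x r0)"
    proof (rule inj_onI)
      fix a b assume ab: "a \<in> ball x r0" "b \<in> ball x r0" "Fc a = Fc b"
      then have "F (Some a) = F (Some b)" using F_Fc r0 by (metis IntE subsetD)
      then show "a = b" using U(3) ab r0 unfolding inj_on_def by blast
    qed
    have "eventually (\<lambda>r. r < r0) (at_right (0::real))"
      using eventually_at_rightI[of 0 r0 "\<lambda>r. r < r0"] r0(1) by simp
    moreover have "eventually (\<lambda>r. \<forall>x'\<in>S. x' \<noteq> x \<longrightarrow> ball x r \<inter> ball x' r = {}) (at_right 0)"
    proof (intro eventually_ball_finite[OF finS] ballI)
      fix x' assume "x' \<in> S"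
      show "eventually (\<lambda>r. x' \<noteq> x \<longrightarrow> ball x r \<inter> ball x' r = {}) (at_right 0)"
      proof (cases "x' = x")
        case False
        have "eventually (\<lambda>r. r < dist x x' / 2) (at_right (0::real))"
          using False by (intro eventually_at_rightI[of 0 "dist x x' / 2"]) auto
        then show ?thesis
          by eventually_elim (rule impI, rule disjoint_ballI, simp)
      qed simp
    qed
    ultimately show "eventually (\<lambda>r. ball x r \<subseteq> X \<and> inj_on Fc (ball x r) \<and>
      (\<forall>x'\<in>S. x' \<noteq> x \<longrightarrow> ball x r \<inter> ball x' r = {})) (at_right 0)"
    proof eventually_elim
      case (elim r)
      then have "ball x r \<subseteq> ball x r0" by (simp add: subset_ball)
      then show ?case using elim r0 inj inj_on_subset by blast
    qed
  qed
  then have "eventually (\<lambda>r. \<forall>x\<in>S. ball x r \<subseteq> X \<and> inj_on Fc (ball x r) \<and>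
      (\<forall>x'\<in>S. x' \<noteq> x \<longrightarrow> ball x r \<inter> ball x' r = {})) (at_right 0)"
    by (simp add: eventually_ball_finite finS)
  from eventually_happens'[OF _ eventually_conj[OF this eventually_at_right_less]]
  obtain r where r0: "r > 0" and r: "\<And>x. x \<in> S \<Longrightarrow> ball x r \<subseteq> X" "\<And>x. x \<in> S \<Longrightarrow> inj_on Fc (ball x r)"
      "\<And>x x'. x \<in> S \<Longrightarrow> x' \<in> S \<Longrightarrow> x' \<noteq> x \<Longrightarrow> ball x r \<inter> ball x' r = {}"
    by (auto simp: trivial_limit_at_right_real)
  define W where "W = (\<Union>x\<in>S. ball x r)"
  have "open W" by (auto simp: W_def)
  then have "closedin sphere_topology (- Some ` W)"
    by (simp add: closedin_def Compl_eq_Diff_UNIV Diff_Diff_Int)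
  from closedin_funpow_image[OF this, of 1]
  have "openin sphere_topology (- (F ` (- Some ` W)))"
    by (simp add: closedin_def Compl_eq_Diff_UNIV)
  then have opT0: "open {u. Some u \<in> - (F ` (- Some ` W))}" by (rule open_Some_preimage)
  \<comment> \<open>Infinity is in no fibre over \<open>Y\<close>: it lies in the forward invariant
    set \<open>Z\<close>.\<close>
  have FN: "F x = Some y \<Longrightarrow> x \<in> Some ` S" for x
  proof (cases x)
    case None
    assume "F x = Some y"
    then have "Some y \<in> Z" using None Z_points F_Z by (metis image_subset_iff)
    then show ?thesis using y by (simp add: Y_def)
  next
    case (Some u)
    assume "F x = Some y"
    then show ?thesis using Some by (auto simp: S_def)
  qed
  \<comment> \<open>The second set forces all preimages into the discs, the third makes every disc
    cover \<open>T\<close>; together they give an evenly covered neighbourhood of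
    \<open>y\<close>.\<close>
  define T where "T = Y \<inter> {u. Some u \<in> - (F ` (- Some ` W))} \<inter> (\<Inter>x\<in>S. Fc ` ball x r)"
  have opb: "open (Fc ` ball x r)" if "x \<in> S" for x
    using open_mapping_thm3[of Fc "ball x r"] r[OF that] hol_Fc holomorphic_on_subset by blast
  have "open T" unfolding T_def
    by (intro open_Int open_Y opT0 open_INT finS ballI opb)
  have yFc: "x \<in> S \<Longrightarrow> Fc x = y" for x by (simp add: S_def Fc_def)
  have yT: "y \<in> T"
  proof -
    have "Some y \<notin> F ` (- Some ` W)"
    proof
      assume "Some y \<in> F ` (- Some ` W)"
      then obtain x where x: "F x = Some y" "x \<notin> Some ` W" by auto
      then obtain u where "x = Some u" "u \<in> S" using FN by blast
      moreover from \<open>u \<in> S\<close> have "u \<in> W" unfolding W_def using r0 centre_in_ball by blast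
      ultimately show False using x by blast
    qed
    moreover have "y \<in> Fc ` ball x r" if "x \<in> S" for x
      using yFc[OF that] r0 by (metis centre_in_ball imageI)
    ultimately show ?thesis using y by (auto simp: T_def)
  qed
  define v where "v = (\<lambda>x. ball x r \<inter> Fc -` T) ` S"
  have opv: "open (ball x r \<inter> Fc -` T)" if "x \<in> S" for x
    using continuous_open_preimage[of "ball x r" Fc T] cont r(1)[OF that] \<open>open T\<close> continuous_on_subset
    by blast
  show "\<exists>T. y \<in> T \<and> openin (top_of_set Y) T \<and>
           (\<exists>v. \<Union> v = X \<inter> Fc -` T \<and> (\<forall>u\<in>v. openin (top_of_set X) u) \<and> pairwise disjnt v \<and>
                (\<forall>u\<in>v. \<exists>q. homeomorphism u T Fc q))"
  proof (intro exI[of _ T] conjI exI[of _ v])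
    show "y \<in> T" by (rule yT)
    show "openin (top_of_set Y) T" using \<open>open T\<close> by (simp add: T_def open_Y openin_open_eq Int_assoc)
    show "\<Union> v = X \<inter> Fc -` T"
    proof
      show "\<Union> v \<subseteq> X \<inter> Fc -` T" using r(1) by (auto simp: v_def)
      show "X \<inter> Fc -` T \<subseteq> \<Union> v"
      proof
        fix u assume u: "u \<in> X \<inter> Fc -` T"
        then have "F (Some u) \<notin> F ` (- Some ` W)" using F_Fc by (auto simp: T_def)
        then have "u \<in> W" by blast
        then show "u \<in> \<Union> v" using u by (auto simp: v_def W_def)
      qed
    qed
    show "\<forall>u\<in>v. openin (top_of_set X) u"
      using opv r(1) by (auto simp: v_def open_X openin_open_eq)
    show "pairwise disjnt v"
    proof (rule pairwiseI)
      fix a b assume "a \<in> v" "b \<in> v" "a \<noteq> b"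
      then obtain x x' where "x \<in> S" "a = ball x r \<inter> Fc -` T" "x' \<in> S" "b = ball x' r \<inter> Fc -` T"
        by (auto simp: v_def)
      then show "disjnt a b" using r(3)[of x x'] \<open>a \<noteq> b\<close> by (auto simp: disjnt_def)
    qed
    show "\<forall>u\<in>v. \<exists>q. homeomorphism u T Fc q"
    proof
      fix u assume "u \<in> v"
      then obtain x where x: "x \<in> S" "u = ball x r \<inter> Fc -` T" by (auto simp: v_def)
      have "T \<subseteq> Fc ` ball x r" using x by (auto simp: T_def)
      then have "Fc ` u = T" using x by auto
      moreover obtain q where "homeomorphism u (Fc ` u) Fc q"
      proof (rule invariance_of_domain_homeomorphism[of u Fc])
        show "open u" using opv x by blast
        show "continuous_on u Fc" 
          by (rule continuous_on_subset[OF cont]) (use r(1)[OF x(1)] x(2) in blast)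
        show "inj_on Fc u" by (rule inj_on_subset[OF r(2)[OF x(1)]]) (use x(2) in blast)
      qed auto
      ultimately show "\<exists>q. homeomorphism u T Fc q" by auto
    qed
  qed
qed

end

section \<open>Normal families of functions omitting 0 and 1\<close>

lemma uniform_limit_subseq:
  assumes "uniform_limit K f g sequentially" "strict_mono (\<sigma> :: nat \<Rightarrow> nat)"
  shows "uniform_limit K (\<lambda>k. f (\<sigma> k)) g sequentially"
  using filterlim_compose[OF assms(1) filterlim_subseq[OF assms(2)]] .

text \<open>Schottky's theorem, in the form of \<open>GPicard3\<close>, turns the bound at the
  single point \<open>a\<close> into bounds on all compact subsets, which is what the classical
  theorem of Montel asks for.\<close>

lemma Montel_omitting_bounded:
  fixes s :: "nat \<Rightarrow> complex \<Rightarrow> complex"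
  assumes hol: "\<And>k. s k holomorphic_on S" and S: "open S" "connected S" "a \<in> S"
    and omit: "\<And>k u. u \<in> S \<Longrightarrow> s k u \<noteq> 0 \<and> s k u \<noteq> 1"
    and bdd: "\<And>k. norm (s k a) \<le> 1"
  obtains \<sigma> g where "strict_mono (\<sigma> :: nat \<Rightarrow> nat)" "g holomorphic_on S"
    "\<And>K. compact K \<Longrightarrow> K \<subseteq> S \<Longrightarrow> uniform_limit K (\<lambda>k. s (\<sigma> k)) g sequentially"
proof -
  have 1: "\<exists>B. \<forall>h\<in>range s. \<forall>z\<in>K. norm (h z) \<le> B" if K: "compact K" "K \<subseteq> S" for K
  proof -
    obtain B where "\<And>h z. \<lbrakk>h \<in> range s; z \<in> K\<rbrakk> \<Longrightarrow> norm (h z) \<le> B"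
      by (rule GPicard3[of S a "range s" "range s" K]) (use S K hol omit bdd in auto)
    then show ?thesis by blast
  qed
  obtain g r where gr: "g holomorphic_on S" "strict_mono (r :: nat \<Rightarrow> nat)"
    "\<And>x. x \<in> S \<Longrightarrow> ((\<lambda>n. s (r n) x) \<longlongrightarrow> g x) sequentially"
    "\<And>K. \<lbrakk>compact K; K \<subseteq> S\<rbrakk> \<Longrightarrow> uniform_limit K (s \<circ> r) g sequentially"
    by (rule Montel[of S "range s" s]) (use S 1 hol in auto)
  show ?thesis
    by (rule that[OF gr(2) gr(1)]) (use gr(4) in \<open>simp add: o_def\<close>)
qed

text \<open>Either the functions or their reciprocals are bounded by 1 at \<open>a\<close>
  infinitely often. A limit of reciprocals, which also omit 0, is by Hurwitz either free of zeros,
  and then its reciprocal is a finite limit of the original functions, or identically zero. The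
  latter is convergence to infinity, written with \<open>inverse\<close> in order to stay in the
  plane.\<close>

lemma Montel_omitting:
  fixes s :: "nat \<Rightarrow> complex \<Rightarrow> complex"
  assumes hol: "\<And>k. s k holomorphic_on S" and S: "open S" "connected S" "a \<in> S"
    and omit: "\<And>k u. u \<in> S \<Longrightarrow> s k u \<noteq> 0 \<and> s k u \<noteq> 1"
  obtains \<sigma> g where "strict_mono (\<sigma> :: nat \<Rightarrow> nat)" "g holomorphic_on S"
    "\<And>K. compact K \<Longrightarrow> K \<subseteq> S \<Longrightarrow> uniform_limit K (\<lambda>k. s (\<sigma> k)) g sequentially"
  | \<sigma> where "strict_mono (\<sigma> :: nat \<Rightarrow> nat)"
    "\<And>K. compact K \<Longrightarrow> K \<subseteq> S \<Longrightarrow> uniform_limit K (\<lambda>k u. inverse (s (\<sigma> k) u)) (\<lambda>_. 0) sequentially"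
proof (cases "infinite {k. norm (s k a) \<le> 1}")
  case True
  then obtain r where r: "strict_mono (r :: nat \<Rightarrow> nat)" "\<And>n. r n \<in> {k. norm (s k a) \<le> 1}"
    using infinite_enumerate by blast
  have b: "norm (s (r k) a) \<le> 1" for k using r(2)[of k] by simp
  obtain \<sigma> g where g: "strict_mono (\<sigma> :: nat \<Rightarrow> nat)" "g holomorphic_on S"
    "\<And>K. compact K \<Longrightarrow> K \<subseteq> S \<Longrightarrow> uniform_limit K (\<lambda>k. s (r (\<sigma> k))) g sequentially"
    using Montel_omitting_bounded[of "\<lambda>k. s (r k)" S a] hol S omit b by blast
  show ?thesis
  proof (rule that(1)[of "r \<circ> \<sigma>" g])
    show "strict_mono (r \<circ> \<sigma>)" using r g strict_mono_o by blast
    show "uniform_limit K (\<lambda>k. s ((r \<circ> \<sigma>) k)) g sequentially" if "compact K" "K \<subseteq> S" for K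
      using g(3)[OF that] by simp
  qed (rule g)
next
  case False
  have "infinite {k. norm (inverse (s k a)) \<le> 1}"
  proof
    assume fin: "finite {k. norm (inverse (s k a)) \<le> 1}"
    have "{k. norm (s k a) \<le> 1} \<union> {k. norm (inverse (s k a)) \<le> 1} = UNIV"
    proof -
      have "norm (inverse (s k a)) \<le> 1" if "\<not> norm (s k a) \<le> 1" for k
        using that by (simp add: norm_inverse inverse_le_1_iff)
      then show ?thesis by blast
    qed
    then show False using fin False by (metis finite_Un infinite_UNIV_nat)
  qed
  then obtain r where r: "strict_mono (r :: nat \<Rightarrow> nat)" "\<And>n. r n \<in> {k. norm (inverse (s k a)) \<le> 1}"
    using infinite_enumerate by blast
  define t where "t = (\<lambda>k u. inverse (s (r k) u))"
  have b: "norm (t k a) \<le> 1" for k using r(2)[of k] by (simp add: t_def)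
  have holt: "t k holomorphic_on S" for k unfolding t_def
    using hol omit by (intro holomorphic_intros) auto
  have omt: "u \<in> S \<Longrightarrow> t k u \<noteq> 0 \<and> t k u \<noteq> 1" for k u
    using omit by (simp add: t_def)
  obtain \<sigma> h where h: "strict_mono (\<sigma> :: nat \<Rightarrow> nat)" "h holomorphic_on S"
    "\<And>K. compact K \<Longrightarrow> K \<subseteq> S \<Longrightarrow> uniform_limit K (\<lambda>k. t (\<sigma> k)) h sequentially"
    using Montel_omitting_bounded[of t S a] holt S omt b by blast
  have rs: "strict_mono (r \<circ> \<sigma>)" using r h strict_mono_o by blast
  show ?thesis
  proof (cases "\<exists>z\<in>S. h z = 0")
    case True
    then obtain z where z: "z \<in> S" "h z = 0" by blast
    have "h constant_on S"
    proof (rule ccontr)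
      assume nc: "\<not> h constant_on S"
      have "h z \<noteq> 0"
        by (rule Hurwitz_no_zeros[of S "\<lambda>k. t (\<sigma> k)" h z]) (use S holt omt h nc z in auto)
      then show False using z by simp
    qed
    then have h0: "\<And>u. u \<in> S \<Longrightarrow> h u = 0" using z by (metis constant_on_def)
    show ?thesis
    proof (rule that(2)[OF rs])
      fix K assume K: "compact K" "K \<subseteq> S"
      have "uniform_limit K (\<lambda>k. t (\<sigma> k)) (\<lambda>_. 0) sequentially"
        using h(3)[OF K] by (rule uniform_limit_cong'[THEN iffD1, rotated 2]) (use h0 K in auto)
      then show "uniform_limit K (\<lambda>k u. inverse (s ((r \<circ> \<sigma>) k) u)) (\<lambda>_. 0) sequentially"
        by (simp add: t_def)
    qed
  next
    case False
    show ?thesis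
    proof (rule that(1)[OF rs, of "\<lambda>u. inverse (h u)"])
      show "(\<lambda>u. inverse (h u)) holomorphic_on S" using False h(2) by (intro holomorphic_intros) auto
      fix K assume K: "compact K" "K \<subseteq> S"
      have "continuous_on K (\<lambda>u. norm (h u))"
        using h(2) K(2) by (intro continuous_intros holomorphic_on_imp_continuous_on) (rule holomorphic_on_subset)
      then obtain b where b: "b > 0" "\<And>u. u \<in> K \<Longrightarrow> b \<le> norm (h u)"
      proof (cases "K = {}")
        case False
        assume c: "continuous_on K (\<lambda>u. norm (h u))"
        obtain x where "x \<in> K" "\<forall>y\<in>K. norm (h x) \<le> norm (h y)"
          using continuous_attains_inf[OF K(1) False c] by blast
        then show ?thesis using that[of "norm (h x)"] \<open>\<not> (\<exists>z\<in>S. h z = 0)\<close> K by auto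
      qed (use that[of 1] in auto)
      have "uniform_limit K (\<lambda>k u. inverse (t (\<sigma> k) u)) (\<lambda>u. inverse (h u)) sequentially"
        using uniform_lim_inverse[OF h(3)[OF K] b(2) b(1)] by (simp add: o_def)
      then show "uniform_limit K (\<lambda>k. s ((r \<circ> \<sigma>) k)) (\<lambda>u. inverse (h u)) sequentially"
        by (simp add: t_def)
    qed
  qed
qed

section \<open>Iterates in the plane coordinate and their inverse branches\<close>

context expanding_map
begin

text \<open>At points sent to infinity \<open>the\<close> gives an arbitrary value. This is harmless
  where the iterate avoids \<open>Z\<close>, since \<open>Z\<close> contains infinity.\<close>

definition Fn :: "nat \<Rightarrow> complex \<Rightarrow> complex" where "Fn n u = the ((F ^^ n) (Some u))"

text \<open>Only continuity is required, so that branches come directly from lifting through the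
  covering; holomorphy is recovered in \<open>branch_holomorphic\<close>.\<close>

definition branch :: "nat \<Rightarrow> complex set \<Rightarrow> (complex \<Rightarrow> complex) \<Rightarrow> bool" where
  "branch n B s \<longleftrightarrow> continuous_on B s \<and> (\<forall>u\<in>B. (F ^^ n) (Some (s u)) = Some u)"

lemma funpow_Fn: "(F ^^ n) (Some u) \<notin> Z \<Longrightarrow> (F ^^ n) (Some u) = Some (Fn n u)"
  using Z_points unfolding Fn_def by (metis option.exhaust_sel)

lemma hol_Fn: "Fn n holomorphic_on {u. (F ^^ n) (Some u) \<notin> Z}"
proof (induction n)
  case 0
  have "Fn 0 = (\<lambda>u. u)" by (auto simp: Fn_def)
  then show ?case by (simp add: holomorphic_on_ident)
next
  case (Suc n)
  let ?A = "{u. (F ^^ Suc n) (Some u) \<notin> Z}"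
  have sub: "?A \<subseteq> {u. (F ^^ n) (Some u) \<notin> Z}" using F_Z by auto
  have im: "Fn n ` ?A \<subseteq> X"
    using funpow_Fn sub by (fastforce simp: X_def)
  have eq: "Fn (Suc n) u = (Fc \<circ> Fn n) u" if "u \<in> ?A" for u
    using funpow_Fn[of n u] sub that by (auto simp: Fn_def Fc_def)
  have "Fc \<circ> Fn n holomorphic_on ?A"
    by (rule holomorphic_on_compose_gen[OF holomorphic_on_subset[OF Suc sub] hol_Fc im])
  then show ?case using eq by (metis (no_types, lifting) holomorphic_cong)
qed

text \<open>Induction on \<open>n\<close>: composing with \<open>Fc\<close> turns lifts through
  \<open>Suc n\<close> steps into lifts through \<open>n\<close> steps, which agree by induction,
  and the covering settles the remaining step. The base map \<open>t\<close> is kept general because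
  \<open>branch_limit_constant\<close> compares lifts of maps other than the identity.\<close>

lemma lift_unique:
  assumes "connected D" "a \<in> D" "x \<in> D" "h1 a = h2 a"
    and "continuous_on D h1" "continuous_on D h2"
    and "\<And>u. u \<in> D \<Longrightarrow> t u \<in> Y"
    and "\<And>u. u \<in> D \<Longrightarrow> (F ^^ n) (Some (h1 u)) = Some (t u)"
    and "\<And>u. u \<in> D \<Longrightarrow> (F ^^ n) (Some (h2 u)) = Some (t u)"
  shows "h1 x = h2 x"
  using assms(2-)
proof (induction n arbitrary: h1 h2 x)
  case 0
  then show ?case by simp
next
  case (Suc n)
  have X: "h u \<in> X" if "\<And>u. u \<in> D \<Longrightarrow> (F ^^ Suc n) (Some (h u)) = Some (t u)" "u \<in> D" for h u
  proof -
    have "(F ^^ n) (F (Some (h u))) \<notin> Z"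
      using that Suc.prems(6)[OF that(2)] by (simp add: funpow_swap1 Y_def)
    then show ?thesis using funpow_Z by (auto simp: X_def)
  qed
  have X1: "h1 u \<in> X" and X2: "h2 u \<in> X" if "u \<in> D" for u
    using X[of h1, OF Suc.prems(7) that] X[of h2, OF Suc.prems(8) that] by auto
  have cF: "continuous_on X Fc" using hol_Fc holomorphic_on_imp_continuous_on by blast
  have c1: "continuous_on D (Fc \<circ> h1)"
    by (rule continuous_on_compose[OF Suc.prems(4) continuous_on_subset[OF cF]]) (use X1 in auto)
  have c2: "continuous_on D (Fc \<circ> h2)"
    by (rule continuous_on_compose[OF Suc.prems(5) continuous_on_subset[OF cF]]) (use X2 in auto)
  have eq: "(Fc \<circ> h1) y = (Fc \<circ> h2) y" if "y \<in> D" for y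
  proof (rule Suc.IH)
    show "(F ^^ n) (Some ((Fc \<circ> h1) u)) = Some (t u)" if "u \<in> D" for u
      using Suc.prems(7)[OF that] F_Fc[of "h1 u"] X1 that by (auto simp: funpow_swap1)
    show "(F ^^ n) (Some ((Fc \<circ> h2) u)) = Some (t u)" if "u \<in> D" for u
      using Suc.prems(8)[OF that] F_Fc[of "h2 u"] X2 that by (auto simp: funpow_swap1)
  qed (use Suc.prems that c1 c2 in auto)
  show ?case
  proof (rule covering_space_lift_unique[OF covering, of h1 a h2 D "Fc \<circ> h1"])
    show "Fc \<circ> h1 \<in> D \<rightarrow> Y" using X1 Fc_in_Y by (auto simp: Pi_iff)
    show "\<And>u. u \<in> D \<Longrightarrow> (Fc \<circ> h1) u = Fc (h2 u)" using eq by simp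
  qed (use Suc.prems assms(1) c1 X1 X2 in \<open>auto simp: Pi_iff\<close>)
qed

text \<open>The lift is built from the target backwards: the inductive lift \<open>s'\<close> passes
  through \<open>Fc w\<close>, stays in \<open>Y\<close> by forward invariance of \<open>Z\<close>,
  and is lifted once more through the covering.\<close>

lemma lift_exists:
  fixes U :: "complex set"
  assumes "simply_connected U" "locally path_connected U" "z \<in> U"
    and "continuous_on U t" and "\<And>u. u \<in> U \<Longrightarrow> t u \<in> Y"
    and "(F ^^ n) (Some w) = Some (t z)"
  obtains s where "continuous_on U s" "s z = w" "\<And>u. u \<in> U \<Longrightarrow> (F ^^ n) (Some (s u)) = Some (t u)"
proof -
  have "\<exists>s. continuous_on U s \<and> s z = w \<and> (\<forall>u\<in>U. (F ^^ n) (Some (s u)) = Some (t u))"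
    using assms(6)
  proof (induction n arbitrary: w)
    case 0
    then show ?case using assms by (intro exI[of _ t]) auto
  next
    case (Suc n)
    have "(F ^^ n) (F (Some w)) \<notin> Z"
      using Suc.prems assms(5)[OF assms(3)] by (simp add: funpow_swap1 Y_def)
    then have wX: "w \<in> X" using funpow_Z by (auto simp: X_def)
    then have "(F ^^ n) (Some (Fc w)) = Some (t z)"
      using Suc.prems F_Fc by (simp add: funpow_swap1)
    from Suc.IH[OF this] obtain s' where s': "continuous_on U s'" "s' z = Fc w"
      "\<And>u. u \<in> U \<Longrightarrow> (F ^^ n) (Some (s' u)) = Some (t u)" by blast
    have s'Y: "s' \<in> U \<rightarrow> Y"
    proof (rule Pi_I)
      fix u assume "u \<in> U"
      then have "(F ^^ n) (Some (s' u)) \<notin> Z" using s'(3) assms(5) by (simp add: Y_def)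
      then show "s' u \<in> Y" using funpow_Z by (auto simp: Y_def)
    qed
    obtain s where s: "continuous_on U s" "s \<in> U \<rightarrow> X" "s z = w" "\<And>y. y \<in> U \<Longrightarrow> Fc (s y) = s' y"
      by (rule covering_space_lift_strong[OF covering wX assms(3) assms(1,2) s'(1) s'Y s'(2)]) blast
    have "(F ^^ Suc n) (Some (s u)) = Some (t u)" if "u \<in> U" for u
    proof -
      have "F (Some (s u)) = Some (s' u)" using F_Fc[of "s u"] s that by (auto simp: Pi_iff)
      then show ?thesis using s'(3)[OF that] by (simp add: funpow_swap1)
    qed
    then show ?case using s by blast
  qed
  then show ?thesis using that by blast
qed

lemma branch_exists:
  assumes "ball a R \<subseteq> Y" "z \<in> ball a R" "(F ^^ n) (Some w) = Some z"
  obtains s where "branch n (ball a R) s" "s z = w"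
proof -
  obtain s where "continuous_on (ball a R) s" "s z = w"
     "\<And>u. u \<in> ball a R \<Longrightarrow> (F ^^ n) (Some (s u)) = Some u"
    by (rule lift_exists[of "ball a R" z "\<lambda>u. u" n w])
      (use assms in \<open>auto simp: convex_imp_simply_connected convex_imp_locally_path_connected\<close>)
  then show ?thesis using that unfolding branch_def by blast
qed

lemma branch_subset: "branch n B s \<Longrightarrow> C \<subseteq> B \<Longrightarrow> branch n C s"
  unfolding branch_def using continuous_on_subset by blast

lemma branch_in_Y: "branch n B s \<Longrightarrow> B \<subseteq> Y \<Longrightarrow> u \<in> B \<Longrightarrow> s u \<in> Y"
  using funpow_Z[of "Some (s u)" n] unfolding branch_def Y_def by auto

text \<open>Forward invariance of \<open>Z\<close> keeps branches off \<open>Z\<close>, so 0 and 1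
  are omitted by branches of every order at once; this is what normality needs.\<close>

lemma branch_omit: "branch n B s \<Longrightarrow> B \<subseteq> Y \<Longrightarrow> u \<in> B \<Longrightarrow> s u \<noteq> 0 \<and> s u \<noteq> 1"
  using branch_in_Y Z_points unfolding Y_def by fastforce

lemma branch_iterate_notin_Z:
  assumes "branch (m + n) B s" "B \<subseteq> Y" "u \<in> B"
  shows "(F ^^ m) (Some (s u)) \<notin> Z"
  using assms funpow_Z_mono[of m "Some (s u)" "m + n"] unfolding branch_def Y_def by fastforce

text \<open>A branch has the left inverse \<open>Fn n\<close>, hence is injective, and invariance of
  domain makes its image open. On that image \<open>Fn n\<close> is holomorphic and injective, so
  its inverse, which is the branch, is holomorphic.\<close>

lemma branch_holomorphic:
  assumes "branch n B s" "open B" "B \<subseteq> Y"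
  shows "s holomorphic_on B"
proof -
  have cs: "continuous_on B s" and e: "\<And>u. u \<in> B \<Longrightarrow> (F ^^ n) (Some (s u)) = Some u"
    using assms unfolding branch_def by auto
  have inv: "u \<in> B \<Longrightarrow> Fn n (s u) = u" for u using e by (simp add: Fn_def)
  have inj: "inj_on s B" by (metis inj_onI inv)
  have op: "open (s ` B)" by (rule invariance_of_domain[OF cs assms(2) inj])
  have sub: "s ` B \<subseteq> {u. (F ^^ n) (Some u) \<notin> Z}" using e assms(3) by (auto simp: Y_def)
  have h: "Fn n holomorphic_on s ` B" by (rule holomorphic_on_subset[OF hol_Fn sub])
  have inj2: "inj_on (Fn n) (s ` B)" by (rule inj_onI) (auto simp: inv)
  obtain g where g: "g holomorphic_on (Fn n ` s ` B)" "\<And>z. z \<in> s ` B \<Longrightarrow> g (Fn n z) = z"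
    by (rule holomorphic_has_inverse[OF h op inj2]) blast
  have "Fn n ` s ` B = B" using inv by force
  then have "g holomorphic_on B" using g by simp
  moreover have "g u = s u" if "u \<in> B" for u using g(2)[of "s u"] inv that by simp
  ultimately show ?thesis by (rule holomorphic_transform)
qed

text \<open>Along a pulled back disc every intermediate image is again the image of a branch, of the
  remaining order. Contraction can therefore be applied at each time of an orbit segment.\<close>

lemma branch_shift:
  assumes "branch (m + n) B s" "B \<subseteq> Y"
  shows "branch n B (\<lambda>u. Fn m (s u))"
  unfolding branch_def
proof
  have "continuous_on {u. (F ^^ m) (Some u) \<notin> Z} (Fn m)"
    by (rule holomorphic_on_imp_continuous_on[OF hol_Fn])
  then show "continuous_on B (\<lambda>u. Fn m (s u))"
    by (rule continuous_on_compose2) (use assms branch_iterate_notin_Z in \<open>auto simp: branch_def\<close>)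
  show "\<forall>u\<in>B. (F ^^ n) (Some (Fn m (s u))) = Some u"
  proof
    fix u assume u: "u \<in> B"
    have "Some (Fn m (s u)) = (F ^^ m) (Some (s u))"
      using funpow_Fn branch_iterate_notin_Z[OF assms u] by simp
    then have "(F ^^ n) (Some (Fn m (s u))) = (F ^^ (n + m)) (Some (s u))"
      by (simp add: funpow_add)
    then show "(F ^^ n) (Some (Fn m (s u))) = Some u"
      using assms u unfolding branch_def by (simp add: add.commute)
  qed
qed

end

lemma tendsto_uniform_limit_moving:
  fixes f :: "nat \<Rightarrow> complex \<Rightarrow> complex"
  assumes ul: "uniform_limit K f g sequentially" and g: "continuous_on K g" and xK: "x \<in> K"
    and X: "X \<longlonglongrightarrow> x" and XK: "\<forall>\<^sub>F k in sequentially. X k \<in> K"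
  shows "(\<lambda>k. f k (X k)) \<longlonglongrightarrow> g x"
proof -
  have 1: "(\<lambda>k. g (X k)) \<longlonglongrightarrow> g x"
    by (rule continuous_on_tendsto_compose[OF g X xK XK])
  have 2: "(\<lambda>k. f k (X k) - g (X k)) \<longlonglongrightarrow> 0"
  proof (rule tendstoI)
    fix e :: real assume "e > 0"
    then have "\<forall>\<^sub>F k in sequentially. \<forall>x\<in>K. dist (f k x) (g x) < e"
      using ul by (simp add: uniform_limit_iff)
    then show "\<forall>\<^sub>F k in sequentially. dist (f k (X k) - g (X k)) 0 < e"
      using XK by eventually_elim (auto simp: dist_norm)
  qed
  from tendsto_add[OF 2 1] show ?thesis by simp
qed

lemma openin_sphere_None:
  assumes "openin sphere_topology U" "None \<in> U"
  obtains M where "\<And>w. norm w > M \<Longrightarrow> Some w \<in> U"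
proof -
  obtain C where C: "compact C" "U = insert None (Some ` (UNIV - C))"
    using assms unfolding sphere_topology_def openin_Alexandroff_compactification by auto
  then obtain M where "\<And>w. w \<in> C \<Longrightarrow> norm w \<le> M"
    using compact_imp_bounded bounded_iff by metis
  then have "norm w > M \<Longrightarrow> Some w \<in> U" for w using C(2) by force
  then show ?thesis using that by blast
qed

section \<open>Contraction of inverse branches\<close>

context expanding_map
begin

text \<open>If branches of orders tending to infinity had a nonconstant limit, comparing two of them
  would give points with this property. It spreads over the connected set \<open>Y\<close>, but fails
  at points whose orbit meets \<open>Z\<close>.\<close>

definition near_id :: "complex \<Rightarrow> bool" where
  "near_id a \<longleftrightarrow> (\<exists>r>0. \<exists>m \<tau>. ball a r \<subseteq> Y \<and> filterlim m at_top sequentially \<and>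
     (\<forall>k. branch (m k) (ball a r) (\<tau> k)) \<and> uniform_limit (ball a r) \<tau> (\<lambda>u. u) sequentially)"

lemma near_idI:
  assumes "r > 0" "ball a r \<subseteq> Y" "filterlim m at_top sequentially"
    "\<And>k. branch (m k) (ball a r) (\<tau> k)" "uniform_limit (ball a r) \<tau> (\<lambda>u. u) sequentially"
  shows "near_id a"
  unfolding near_id_def using assms by blast

lemma near_idE:
  assumes "near_id a"
  obtains r m \<tau> where "r > 0" "ball a r \<subseteq> Y" "filterlim m at_top sequentially"
    "\<forall>k. branch (m k) (ball a r) (\<tau> k)" "uniform_limit (ball a r) \<tau> (\<lambda>u. u) sequentially"
  using assms unfolding near_id_def by (elim exE conjE, intro that) auto

lemma near_id_open:
  assumes "near_id a"
  obtains r where "r > 0" "\<And>a'. a' \<in> ball a r \<Longrightarrow> near_id a'"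
proof -
  obtain r m \<tau> where r: "r > 0" "ball a r \<subseteq> Y" "filterlim m at_top sequentially"
    "\<forall>k. branch (m k) (ball a r) (\<tau> k)" "uniform_limit (ball a r) \<tau> (\<lambda>u. u) sequentially"
    using assms by (rule near_idE)
  have "near_id a'" if a': "a' \<in> ball a r" for a'
  proof -
    obtain r' where r': "r' > 0" "ball a' r' \<subseteq> ball a r"
      by (rule openE[OF open_ball a'])
    show ?thesis
      by (rule near_idI[OF r'(1) _ r(3), of _ \<tau>])
        (use r r' branch_subset[OF r(4)[rule_format] r'(2)] uniform_limit_on_subset[OF r(5) r'(2)] in blast)+
  qed
  then show ?thesis by (rule that[OF r(1)])
qed

text \<open>Take \<open>a'\<close> close to \<open>a\<close> with branches tending to the identity
  near \<open>a'\<close>. They extend to a disc about \<open>a\<close> whose radius depends on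
  \<open>a\<close> only; Montel gives a limit there, and the identity theorem makes it the identity.
  Divergence to infinity is excluded by the values at \<open>a'\<close>, which converge to
  \<open>a'\<close>.\<close>

lemma near_id_closed:
  assumes aY: "a \<in> Y" and lim: "\<And>e. e > 0 \<Longrightarrow> \<exists>a'\<in>ball a e. near_id a'"
  shows "near_id a"
proof -
  obtain R where R: "R > 0" "ball a R \<subseteq> Y" using open_Y aY open_contains_ball by blast
  obtain a' where a': "a' \<in> ball a (R/2)" "near_id a'" using lim[of "R/2"] R by auto
  obtain r m \<tau> where r: "r > 0" "ball a' r \<subseteq> Y" "filterlim m at_top sequentially"
    "\<forall>k. branch (m k) (ball a' r) (\<tau> k)" "uniform_limit (ball a' r) \<tau> (\<lambda>u. u) sequentially"
    using a'(2) by (rule near_idE)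
  define r' where "r' = min r (R/2)"
  have r'0: "r' > 0" using r R by (simp add: r'_def)
  have sub: "ball a' r' \<subseteq> ball a R" "ball a' r' \<subseteq> ball a' r"
  proof -
    show "ball a' r' \<subseteq> ball a R"
    proof
      fix x assume "x \<in> ball a' r'"
      then show "x \<in> ball a R" using a'(1) dist_triangle[of a x a'] by (auto simp: r'_def)
    qed
  qed (auto simp: r'_def)
  have a'R: "a' \<in> ball a R" using a'(1) R by auto
  have "a' \<in> Y" using a'R R(2) by blast
  then have a'0: "a' \<noteq> 0" using Z_points by (auto simp: Y_def)
  have "\<forall>k. \<exists>s. branch (m k) (ball a R) s \<and> s a' = \<tau> k a'"
  proof
    fix k
    have "(F ^^ m k) (Some (\<tau> k a')) = Some a'" using r(4)[rule_format, of k] r(1) by (auto simp: branch_def)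
    from branch_exists[OF R(2) a'R this]
    show "\<exists>s. branch (m k) (ball a R) s \<and> s a' = \<tau> k a'" by blast
  qed
  then obtain s where s: "\<And>k. branch (m k) (ball a R) (s k)" "\<And>k. s k a' = \<tau> k a'" by metis
  have eq: "s k u = \<tau> k u" if "u \<in> ball a' r'" for k u
  proof (rule lift_unique[of "ball a' r'" a' u "s k" "\<tau> k" "\<lambda>u. u" "m k"])
    show "continuous_on (ball a' r') (s k)" "continuous_on (ball a' r') (\<tau> k)"
      using branch_subset[OF s(1) sub(1)] branch_subset[OF r(4)[rule_format] sub(2)] by (auto simp: branch_def)
    show "u \<in> Y" if "u \<in> ball a' r'" for u using that sub R by blast
    show "(F ^^ m k) (Some (s k u)) = Some u" "(F ^^ m k) (Some (\<tau> k u)) = Some u"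
      if "u \<in> ball a' r'" for u
      using branch_subset[OF s(1) sub(1)] branch_subset[OF r(4)[rule_format] sub(2)] that by (auto simp: branch_def)
  qed (use that r'0 s(2) in auto)
  have lim: "(\<lambda>k. s k u) \<longlonglongrightarrow> u" if "u \<in> ball a' r'" for u
  proof -
    have "(\<lambda>k. \<tau> k u) \<longlonglongrightarrow> u"
      using tendsto_uniform_limitI[OF r(5)] that sub(2) by blast
    then show ?thesis using eq[OF that] by simp
  qed
  have hol: "s k holomorphic_on ball a R" for k
    by (rule branch_holomorphic[OF s(1) open_ball R(2)])
  have om: "u \<in> ball a R \<Longrightarrow> s k u \<noteq> 0 \<and> s k u \<noteq> 1" for k u
    using branch_omit[OF s(1) R(2)] by blast
  show ?thesis
  proof (rule Montel_omitting[of s "ball a R" a])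
    fix \<sigma> g assume \<sigma>: "strict_mono (\<sigma> :: nat \<Rightarrow> nat)" and g: "g holomorphic_on ball a R"
      and ul: "\<And>K. compact K \<Longrightarrow> K \<subseteq> ball a R \<Longrightarrow> uniform_limit K (\<lambda>k. s (\<sigma> k)) g sequentially"
    have g1: "g u = u" if "u \<in> ball a' r'" for u
    proof -
      have "uniform_limit {u} (\<lambda>k. s (\<sigma> k)) g sequentially" using that sub by (intro ul) auto
      then have "(\<lambda>k. s (\<sigma> k) u) \<longlonglongrightarrow> g u" by (simp add: tendsto_uniform_limitI)
      moreover have "(\<lambda>k. s (\<sigma> k) u) \<longlonglongrightarrow> u"
        using LIMSEQ_subseq_LIMSEQ[OF lim[OF that] \<sigma>] by (simp add: o_def)
      ultimately show ?thesis by (rule LIMSEQ_unique)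
    qed
    have g2: "g u = u" if "u \<in> ball a R" for u
    proof (rule analytic_continuation_open[of "ball a' r'" "ball a R" g "\<lambda>u. u"])
      show "ball a' r' \<noteq> {}" using r'0 by simp
    qed (use g g1 that sub in \<open>auto simp: holomorphic_on_ident\<close>)
    \<comment> \<open>Convergence is known on compact subsets only, whereas \<open>near_id\<close>
      asks for it on a whole disc; hence the smaller radius.\<close>
    have cb: "cball a (R/2) \<subseteq> ball a R" using R by auto
    have "uniform_limit (cball a (R/2)) (\<lambda>k. s (\<sigma> k)) g sequentially"
      using cb by (intro ul) auto
    then have "uniform_limit (ball a (R/2)) (\<lambda>k. s (\<sigma> k)) g sequentially"
      by (rule uniform_limit_on_subset) auto
    then have ul2: "uniform_limit (ball a (R/2)) (\<lambda>k. s (\<sigma> k)) (\<lambda>u. u) sequentially"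
      by (rule uniform_limit_cong'[THEN iffD1, rotated 2]) (use g2 R in auto)
    show ?thesis
    proof (rule near_idI[of "R/2" a "\<lambda>k. m (\<sigma> k)" "\<lambda>k. s (\<sigma> k)"])
      show "filterlim (\<lambda>k. m (\<sigma> k)) at_top sequentially"
        using filterlim_compose[OF r(3) filterlim_subseq[OF \<sigma>]] .
      show "branch (m (\<sigma> k)) (ball a (R/2)) (s (\<sigma> k))" for k
        by (rule branch_subset[OF s(1)]) (use R in auto)
      show "ball a (R/2) \<subseteq> Y" using R by auto
    qed (use R ul2 in auto)
  next
    fix \<sigma> assume \<sigma>: "strict_mono (\<sigma> :: nat \<Rightarrow> nat)"
      and ul: "\<And>K. compact K \<Longrightarrow> K \<subseteq> ball a R \<Longrightarrow>
         uniform_limit K (\<lambda>k u. inverse (s (\<sigma> k) u)) (\<lambda>_. 0) sequentially"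
    have "uniform_limit {a'} (\<lambda>k u. inverse (s (\<sigma> k) u)) (\<lambda>_. 0) sequentially"
      using a'R by (intro ul) auto
    then have "(\<lambda>k. inverse (s (\<sigma> k) a')) \<longlonglongrightarrow> 0"
      using tendsto_uniform_limitI by fastforce
    moreover have "(\<lambda>k. inverse (s (\<sigma> k) a')) \<longlonglongrightarrow> inverse a'"
    proof (rule tendsto_inverse)
      show "(\<lambda>k. s (\<sigma> k) a') \<longlonglongrightarrow> a'"
        using LIMSEQ_subseq_LIMSEQ[OF lim[of a'] \<sigma>] r'0 by (simp add: o_def)
      show "a' \<noteq> 0" by (rule a'0)
    qed
    ultimately have "inverse a' = 0" using LIMSEQ_unique by blast
    then show ?thesis using a'0 by simp
  qed (use hol om R in auto)
qed

text \<open>By Hurwitz some branch close to the identity takes the value \<open>c\<close> at a point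
  \<open>z\<close> of \<open>Y\<close>. Its order is at least \<open>j\<close>, so the corresponding
  iterate of \<open>c\<close> is in \<open>Z\<close> by forward invariance; but this iterate equals
  \<open>z\<close>.\<close>

lemma not_near_id_precritical:
  assumes "(F ^^ j) (Some c) \<in> Z"
  shows "\<not> near_id c"
proof
  assume "near_id c"
  then obtain r m \<tau> where r: "r > 0" "ball c r \<subseteq> Y" "filterlim m at_top sequentially"
    "\<forall>k. branch (m k) (ball c r) (\<tau> k)" "uniform_limit (ball c r) \<tau> (\<lambda>u. u) sequentially"
    by (rule near_idE)
  have "\<forall>\<^sub>F k in sequentially. m k \<ge> j" using r(3) by (simp add: filterlim_at_top)
  then obtain N where N: "\<And>k. k \<ge> N \<Longrightarrow> m k \<ge> j" by (auto simp: eventually_sequentially)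
  have "(\<lambda>u. u - c) c \<noteq> 0"
  proof (rule Hurwitz_no_zeros[of "ball c r" "\<lambda>k u. \<tau> (k + N) u - c" "\<lambda>u. u - c"])
    show "(\<lambda>u. \<tau> (k + N) u - c) holomorphic_on ball c r" for k
      by (intro holomorphic_intros branch_holomorphic[OF r(4)[rule_format]] open_ball r(2))
    show "(\<lambda>u. u - c) holomorphic_on ball c r" by (intro holomorphic_intros)
    show "uniform_limit K (\<lambda>k u. \<tau> (k + N) u - c) (\<lambda>u. u - c) sequentially"
      if "compact K" "K \<subseteq> ball c r" for K
    proof -
      have "strict_mono (\<lambda>k. k + N)" by (simp add: strict_mono_def)
      from uniform_limit_subseq[OF uniform_limit_on_subset[OF r(5) that(2)] this]
      show ?thesis by (simp add: uniform_limit_iff dist_norm)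
    qed
    show "\<not> (\<lambda>u. u - c) constant_on ball c r"
    proof
      assume "(\<lambda>u. u - c) constant_on ball c r"
      then obtain d where d: "\<And>u. u \<in> ball c r \<Longrightarrow> u - c = d" by (auto simp: constant_on_def)
      have "c + of_real (r/2) \<in> ball c r" using r(1) by (simp add: dist_norm)
      from d[OF this] d[of c] r(1) show False by simp
    qed
    show "\<tau> (k + N) z - c \<noteq> 0" if "z \<in> ball c r" for k z
    proof
      assume "\<tau> (k + N) z - c = 0"
      then have "(F ^^ m (k + N)) (Some c) = Some z" using r(4)[rule_format, of "k + N"] that by (auto simp: branch_def)
      moreover have "(F ^^ m (k + N)) (Some c) \<in> Z" by (rule funpow_Z_mono[OF assms N]) simp
      ultimately show False using that r(2) by (auto simp: Y_def)
    qed
  qed (use r in auto)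
  then show False by simp
qed

lemma not_near_id: "\<not> near_id a"
proof
  assume na: "near_id a"
  define A where "A = {a \<in> Y. near_id a}"
  have nY: "near_id a \<Longrightarrow> a \<in> Y" for a
    by (erule near_idE) auto
  have "open A"
    unfolding open_contains_ball
  proof
    fix x assume "x \<in> A"
    then obtain r where "r > 0" "\<And>a'. a' \<in> ball x r \<Longrightarrow> near_id a'"
      using near_id_open[of x] unfolding A_def by blast
    then show "\<exists>e>0. ball x e \<subseteq> A" using nY unfolding A_def by blast
  qed
  moreover have "open (Y - A)"
    unfolding open_contains_ball
  proof
    fix x assume x: "x \<in> Y - A"
    then obtain e where e: "e > 0" "\<And>a'. a' \<in> ball x e \<Longrightarrow> \<not> near_id a'"
      using near_id_closed[of x] unfolding A_def by blast
    obtain R where "R > 0" "ball x R \<subseteq> Y" using open_Y x open_contains_ball by blast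
    then have "ball x (min e R) \<subseteq> Y - A" "min e R > 0" using e unfolding A_def by auto
    then show "\<exists>e>0. ball x e \<subseteq> Y - A" by blast
  qed
  ultimately have "A \<inter> Y = {} \<or> (Y - A) \<inter> Y = {}"
    by (intro connectedD[OF connected_Y]) (auto simp: A_def)
  then have all: "\<And>y. y \<in> Y \<Longrightarrow> near_id y" using na nY by (auto simp: A_def)
  \<comment> \<open>\<open>backward_Z\<close> supplies a point of \<open>Y\<close> that eventually
    hits infinity; there \<open>near_id\<close> fails.\<close>
  obtain j q where jq: "q \<notin> Z" "(F ^^ j) q = None" using backward_Z[OF Z_points(1)] by blast
  then obtain c where "q = Some c" using Z_points by (cases q) auto
  then show False using not_near_id_precritical[of j c] jq Z_points all by (auto simp: Y_def)
qed

end

context expanding_map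
begin

text \<open>Suppose the limit \<open>g\<close> is nonconstant, hence injective near some
  \<open>b\<close>. By Hurwitz late branches take the value \<beta> = \<open>g b\<close> at points
  \<open>bs k\<close> tending to \<open>b\<close>. For two of them let \<tau> be the iterate of the
  lower order applied to the branch of higher order: it is a branch whose order is the difference,
  and it sends \<open>bs (Suc k)\<close> to \<open>bs k\<close>. By uniqueness of lifts the lower
  branch composed with \<tau> is the higher one. A limit \<open>t\<close> of the \<tau> satisfies
  \<open>g (t u) = g u\<close>, so it is the identity near \<open>b\<close>, against
  \<open>not_near_id\<close>.\<close>

lemma branch_limit_constant:
  assumes R: "ball a R \<subseteq> Y" and n: "filterlim n at_top sequentially"
    and s: "\<And>k. branch (n k) (ball a R) (s k)" and g: "g holomorphic_on ball a R"
    and ul: "\<And>K. compact K \<Longrightarrow> K \<subseteq> ball a R \<Longrightarrow> uniform_limit K s g sequentially"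
  shows "g constant_on ball a R"
proof (rule ccontr)
  assume nc: "\<not> g constant_on ball a R"
  have "\<exists>b\<in>ball a R. deriv g b \<noteq> 0"
  proof (rule ccontr)
    assume "\<not> (\<exists>b\<in>ball a R. deriv g b \<noteq> 0)"
    then have "(g has_field_derivative 0) (at x within ball a R)" if "x \<in> ball a R" for x
      using holomorphic_derivI[OF g open_ball that] that by (metis has_field_derivative_at_within)
    then have "\<exists>c. \<forall>x\<in>ball a R. g x = c"
      by (intro has_field_derivative_zero_constant) auto
    then show False using nc by (auto simp: constant_on_def)
  qed
  then obtain b where b: "b \<in> ball a R" "deriv g b \<noteq> 0" by blast
  obtain \<rho> where \<rho>: "\<rho> > 0" "ball b \<rho> \<subseteq> ball a R" "inj_on g (ball b \<rho>)"
    by (rule has_complex_derivative_locally_injective[OF g b(1) open_ball b(2)])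
  define \<beta> where "\<beta> = g b"
  have zeros: "\<forall>\<^sub>F k in sequentially. \<exists>u\<in>ball b \<eta>. s k u = \<beta>" if \<eta>: "0 < \<eta>" "\<eta> \<le> \<rho>" for \<eta>
  proof (rule ccontr)
    have sub: "ball b \<eta> \<subseteq> ball b \<rho>" using \<eta> by (simp add: subset_ball)
    assume "\<not> (\<forall>\<^sub>F k in sequentially. \<exists>u\<in>ball b \<eta>. s k u = \<beta>)"
    then have "infinite {k. \<not> (\<exists>u\<in>ball b \<eta>. s k u = \<beta>)}"
      by (simp add: cofinite_eq_sequentially[symmetric] eventually_cofinite)
    then obtain r where r: "strict_mono (r :: nat \<Rightarrow> nat)"
      "\<And>k. r k \<in> {k. \<not> (\<exists>u\<in>ball b \<eta>. s k u = \<beta>)}" using infinite_enumerate by blast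
    have "(\<lambda>u. g u - \<beta>) b \<noteq> 0"
    proof (rule Hurwitz_no_zeros[of "ball b \<eta>" "\<lambda>k u. s (r k) u - \<beta>" "\<lambda>u. g u - \<beta>"])
      show "(\<lambda>u. s (r k) u - \<beta>) holomorphic_on ball b \<eta>" for k
        by (intro holomorphic_intros holomorphic_on_subset[OF branch_holomorphic[OF s open_ball R]])
          (use sub \<rho> in auto)
      show "(\<lambda>u. g u - \<beta>) holomorphic_on ball b \<eta>"
        by (intro holomorphic_intros holomorphic_on_subset[OF g]) (use sub \<rho> in auto)
      show "uniform_limit K (\<lambda>k u. s (r k) u - \<beta>) (\<lambda>u. g u - \<beta>) sequentially"
        if K: "compact K" "K \<subseteq> ball b \<eta>" for K
      proof -
        have "uniform_limit K s g sequentially" by (rule ul[OF K(1)]) (use K sub \<rho> in auto)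
        from uniform_limit_subseq[OF this r(1)]
        show ?thesis by (simp add: uniform_limit_iff dist_norm)
      qed
      show "\<not> (\<lambda>u. g u - \<beta>) constant_on ball b \<eta>"
      proof
        assume "(\<lambda>u. g u - \<beta>) constant_on ball b \<eta>"
        then obtain d where d: "\<And>u. u \<in> ball b \<eta> \<Longrightarrow> g u - \<beta> = d" by (auto simp: constant_on_def)
        have m: "b + of_real (\<eta>/2) \<in> ball b \<eta>" "b \<in> ball b \<eta>" using \<eta> by (auto simp: dist_norm)
        have "g (b + of_real (\<eta>/2)) - \<beta> = g b - \<beta>" using d[OF m(1)] d[OF m(2)] by metis
        then have "g (b + of_real (\<eta>/2)) = g b" by simp
        then have "b + of_real (\<eta>/2) = b" using \<rho>(3) m sub by (meson inj_onD subsetD)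
        then show False using \<eta> by simp
      qed
      show "s (r k) z - \<beta> \<noteq> 0" if "z \<in> ball b \<eta>" for k z
        using r(2)[of k] that by auto
    qed (use \<eta> in auto)
    then show False by (simp add: \<beta>_def)
  qed
  \<comment> \<open>The subsequence is chosen with solutions in discs of radius
    \<open>\<rho> / Suc k\<close> and with order gaps of at least \<open>k\<close>, so that
    \<open>bs\<close> converges to \<open>b\<close> and the orders \<open>m k\<close> tend to
    infinity.\<close>
  have "\<exists>f. \<forall>k. (\<exists>u\<in>ball b (\<rho> / Suc k). s (f k) u = \<beta>) \<and> (f k < f (Suc k) \<and> n (f k) + k \<le> n (f (Suc k)))"
  proof (rule dependent_nat_choice)
    show "\<exists>x. \<exists>u\<in>ball b (\<rho> / Suc 0). s x u = \<beta>"
      using eventually_happens'[OF _ zeros[of \<rho>]] \<rho> by auto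
  next
    fix x k
    have 1: "\<forall>\<^sub>F y in sequentially. \<exists>u\<in>ball b (\<rho> / Suc (Suc k)). s y u = \<beta>"
      by (rule zeros) (use \<rho> in \<open>auto simp: divide_le_eq\<close>)
    have 2: "\<forall>\<^sub>F y in sequentially. n x + k \<le> n y" using n by (simp add: filterlim_at_top)
    have 3: "\<forall>\<^sub>F y in sequentially. x < y" by (rule eventually_gt_at_top)
    from eventually_happens'[OF _ eventually_conj[OF 1 eventually_conj[OF 2 3]]]
    show "\<exists>y. (\<exists>u\<in>ball b (\<rho> / Suc (Suc k)). s y u = \<beta>) \<and> (x < y \<and> n x + k \<le> n y)" by auto
  qed
  then obtain f where f: "\<And>k. \<exists>u\<in>ball b (\<rho> / Suc k). s (f k) u = \<beta>"
     "\<And>k. f k < f (Suc k)" "\<And>k. n (f k) + k \<le> n (f (Suc k))" by auto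
  have fm: "strict_mono f" using f(2) by (simp add: strict_mono_Suc_iff)
  obtain bs where bs: "\<And>k. bs k \<in> ball b (\<rho> / Suc k)" "\<And>k. s (f k) (bs k) = \<beta>"
    using f(1) by metis
  have bs_lim: "bs \<longlonglongrightarrow> b"
  proof (rule tendsto_dist_iff[THEN iffD2], rule Lim_null_comparison)
    show "(\<lambda>k. \<rho> / Suc k) \<longlonglongrightarrow> 0"
      using LIMSEQ_Suc[OF lim_const_over_n[of \<rho>]] by simp
    show "\<forall>\<^sub>F k in sequentially. norm (dist (bs k) b) \<le> \<rho> / Suc k"
      using bs(1) by (intro always_eventually allI) (auto simp: dist_commute less_imp_le)
  qed
  have bsB: "bs k \<in> ball a R" for k
  proof -
    have "\<rho> / Suc k \<le> \<rho>" using \<rho>(1) by (simp add: divide_le_eq)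
    then have "bs k \<in> ball b \<rho>" using bs(1)[of k] by auto
    then show ?thesis using \<rho>(2) by blast
  qed
  define m where "m k = n (f (Suc k)) - n (f k)" for k
  have nm: "n (f (Suc k)) = n (f k) + m k" and mk: "m k \<ge> k" for k
    using f(3)[of k] by (auto simp: m_def)
  define \<tau> where "\<tau> k u = Fn (n (f k)) (s (f (Suc k)) u)" for k u
  have \<tau>: "branch (m k) (ball a R) (\<tau> k)" for k
    using branch_shift[of "n (f k)" "m k", OF _ R] s[of "f (Suc k)"] nm[of k] unfolding \<tau>_def by simp
  have \<tau>F: "(F ^^ n (f k)) (Some (s (f (Suc k)) u)) = Some (\<tau> k u)" if u: "u \<in> ball a R" for k u
    using funpow_Fn[OF branch_iterate_notin_Z[of "n (f k)" "m k", OF _ R u]] s[of "f (Suc k)"] nm[of k]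
    by (simp add: \<tau>_def)
  \<comment> \<open>Both points are the image of \<beta> under the iterate of order
    \<open>n (f k)\<close>.\<close>
  have \<tau>b: "\<tau> k (bs (Suc k)) = bs k" for k
  proof -
    have "(F ^^ n (f k)) (Some \<beta>) = Some (bs k)"
      using s[of "f k"] bsB[of k] bs(2)[of k] by (auto simp: branch_def)
    moreover have "(F ^^ n (f k)) (Some \<beta>) = Some (\<tau> k (bs (Suc k)))"
      using \<tau>F[OF bsB[of "Suc k"], of k] bs(2)[of "Suc k"] by simp
    ultimately show ?thesis by simp
  qed
  have hol: "\<tau> k holomorphic_on ball a R" for k by (rule branch_holomorphic[OF \<tau> open_ball R])
  have om: "u \<in> ball a R \<Longrightarrow> \<tau> k u \<noteq> 0 \<and> \<tau> k u \<noteq> 1" for k u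
    using branch_omit[OF \<tau> R] by blast
  have bY: "b \<in> Y" using b(1) R by blast
  then have b0: "b \<noteq> 0" using Z_points by (auto simp: Y_def)
  have cb: "cball b (\<rho>/2) \<subseteq> ball b \<rho>" using \<rho> by auto
  then have cbR: "cball b (\<rho>/2) \<subseteq> ball a R" using \<rho> by auto
  show False
  proof (rule Montel_omitting[of \<tau> "ball a R" b])
    fix \<sigma> assume \<sigma>: "strict_mono (\<sigma> :: nat \<Rightarrow> nat)"
      and ul0: "\<And>K. compact K \<Longrightarrow> K \<subseteq> ball a R \<Longrightarrow>
         uniform_limit K (\<lambda>k u. inverse (\<tau> (\<sigma> k) u)) (\<lambda>_. 0) sequentially"
    have ss: "strict_mono (\<lambda>k. Suc (\<sigma> k))" using \<sigma> by (simp add: strict_mono_def)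
    have l1: "(\<lambda>k. bs (Suc (\<sigma> k))) \<longlonglongrightarrow> b"
      using LIMSEQ_subseq_LIMSEQ[OF bs_lim ss] by (simp add: o_def)
    \<comment> \<open>Divergence to infinity is impossible: the \<tau> send
      \<open>bs (Suc k)\<close> to \<open>bs k\<close>, and these values converge to the finite
      point \<open>b\<close>.\<close>
    have "(\<lambda>k. inverse (\<tau> (\<sigma> k) (bs (Suc (\<sigma> k))))) \<longlonglongrightarrow> (\<lambda>_. 0) b"
    proof (rule tendsto_uniform_limit_moving[OF ul0[OF compact_cball cbR] _ _ l1])
      show "\<forall>\<^sub>F k in sequentially. bs (Suc (\<sigma> k)) \<in> cball b (\<rho>/2)"
        using tendstoD[OF l1 half_gt_zero[OF \<rho>(1)]] by eventually_elim (auto simp: dist_commute)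
    qed (use \<rho> in auto)
    then have "(\<lambda>k. inverse (bs (\<sigma> k))) \<longlonglongrightarrow> 0" by (simp add: \<tau>b)
    moreover have "(\<lambda>k. inverse (bs (\<sigma> k))) \<longlonglongrightarrow> inverse b"
      using LIMSEQ_subseq_LIMSEQ[OF bs_lim \<sigma>] by (intro tendsto_inverse b0) (simp add: o_def)
    ultimately have "inverse b = 0" using LIMSEQ_unique by blast
    then show False using b0 by simp
  next
    fix \<sigma> t assume \<sigma>: "strict_mono (\<sigma> :: nat \<Rightarrow> nat)" and t: "t holomorphic_on ball a R"
      and ul0: "\<And>K. compact K \<Longrightarrow> K \<subseteq> ball a R \<Longrightarrow> uniform_limit K (\<lambda>k. \<tau> (\<sigma> k)) t sequentially"
    have ss: "strict_mono (\<lambda>k. Suc (\<sigma> k))" using \<sigma> by (simp add: strict_mono_def)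
    have l0: "(\<lambda>k. bs (\<sigma> k)) \<longlonglongrightarrow> b"
      using LIMSEQ_subseq_LIMSEQ[OF bs_lim \<sigma>] by (simp add: o_def)
    have l1: "(\<lambda>k. bs (Suc (\<sigma> k))) \<longlonglongrightarrow> b"
      using LIMSEQ_subseq_LIMSEQ[OF bs_lim ss] by (simp add: o_def)
    have ct: "continuous_on (ball a R) t" using t by (rule holomorphic_on_imp_continuous_on)
    have "(\<lambda>k. \<tau> (\<sigma> k) (bs (Suc (\<sigma> k)))) \<longlonglongrightarrow> t b"
    proof (rule tendsto_uniform_limit_moving[OF ul0[OF compact_cball cbR] _ _ l1])
      show "\<forall>\<^sub>F k in sequentially. bs (Suc (\<sigma> k)) \<in> cball b (\<rho>/2)"
        using tendstoD[OF l1 half_gt_zero[OF \<rho>(1)]] by eventually_elim (auto simp: dist_commute)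
      show "continuous_on (cball b (\<rho>/2)) t" by (rule continuous_on_subset[OF ct cbR])
    qed (use \<rho> in auto)
    then have "(\<lambda>k. bs (\<sigma> k)) \<longlonglongrightarrow> t b" by (simp add: \<tau>b)
    then have tb: "t b = b" using l0 LIMSEQ_unique by blast
    have "isCont t b" using ct b(1) continuous_on_eq_continuous_at open_ball by blast
    then obtain \<eta>0 where \<eta>0: "\<eta>0 > 0" "\<And>x. dist x b < \<eta>0 \<Longrightarrow> dist (t x) (t b) < \<rho>/4"
      using \<rho>(1) unfolding continuous_at_eps_delta by (metis divide_pos_pos zero_less_numeral)
    define \<eta> where "\<eta> = min (\<eta>0/2) (\<rho>/2)"
    have \<eta>: "\<eta> > 0" using \<eta>0 \<rho> by (simp add: \<eta>_def)
    have tt: "dist (t x) b < \<rho>/4" if "x \<in> cball b \<eta>" for x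
      using \<eta>0(2)[of x] that \<eta>0(1) tb by (auto simp: \<eta>_def dist_commute)
    have cR: "cball b \<eta> \<subseteq> ball a R" using cbR by (auto simp: \<eta>_def)
    have "\<forall>\<^sub>F k in sequentially. \<forall>x\<in>cball b \<eta>. dist (\<tau> (\<sigma> k) x) (t x) < \<rho>/4"
      by (rule uniform_limitD[OF ul0[OF compact_cball cR]]) (use \<rho>(1) in simp)
    then have ev1: "\<forall>\<^sub>F k in sequentially. \<forall>x\<in>cball b \<eta>. \<tau> (\<sigma> k) x \<in> cball b (\<rho>/2)"
    proof eventually_elim
      case (elim k)
      show ?case
      proof
        fix x assume x: "x \<in> cball b \<eta>"
        have "dist b (\<tau> (\<sigma> k) x) \<le> dist b (t x) + dist (t x) (\<tau> (\<sigma> k) x)" by (rule dist_triangle)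
        also have "\<dots> < \<rho>/4 + \<rho>/4" using tt[OF x] elim x by (intro add_strict_mono) (auto simp: dist_commute)
        finally show "\<tau> (\<sigma> k) x \<in> cball b (\<rho>/2)" by simp
      qed
    qed
    have ev2: "\<forall>\<^sub>F k in sequentially. bs (Suc (\<sigma> k)) \<in> ball b \<eta>"
      using tendstoD[OF l1 \<eta>] by eventually_elim (auto simp: dist_commute)
    \<comment> \<open>Both sides lift \<tau> through the same iterate and agree at
      \<open>bs (Suc (\<sigma> k))\<close>. The radius \<eta> was chosen so that \<tau> maps
      \<open>ball b \<eta>\<close> into the domain of the lower branch.\<close>
    have ev3: "\<forall>\<^sub>F k in sequentially. \<forall>x\<in>ball b \<eta>. s (f (\<sigma> k)) (\<tau> (\<sigma> k) x) = s (f (Suc (\<sigma> k))) x"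
      using ev1 ev2
    proof eventually_elim
      case (elim k)
      have sub: "ball b \<eta> \<subseteq> ball a R" using cR by auto
      have im: "\<tau> (\<sigma> k) x \<in> ball a R" if "x \<in> ball b \<eta>" for x
        using elim(1) that cbR ball_subset_cball[of b \<eta>] by blast
      have cs: "continuous_on (ball a R) (s j)" "continuous_on (ball a R) (\<tau> j)" for j
        using s[of j] \<tau>[of j] by (auto simp: branch_def)
      show ?case
      proof
        fix x assume x: "x \<in> ball b \<eta>"
        show "s (f (\<sigma> k)) (\<tau> (\<sigma> k) x) = s (f (Suc (\<sigma> k))) x"
        proof (rule lift_unique[of "ball b \<eta>" "bs (Suc (\<sigma> k))" x _ _ "\<tau> (\<sigma> k)" "n (f (\<sigma> k))"])
          show "s (f (\<sigma> k)) (\<tau> (\<sigma> k) (bs (Suc (\<sigma> k)))) = s (f (Suc (\<sigma> k))) (bs (Suc (\<sigma> k)))"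
            by (simp add: \<tau>b bs(2))
          show "continuous_on (ball b \<eta>) (\<lambda>x. s (f (\<sigma> k)) (\<tau> (\<sigma> k) x))"
            by (rule continuous_on_compose2[OF cs(1) continuous_on_subset[OF cs(2) sub]]) (use im in auto)
          show "continuous_on (ball b \<eta>) (s (f (Suc (\<sigma> k))))" by (rule continuous_on_subset[OF cs(1) sub])
          show "\<tau> (\<sigma> k) u \<in> Y" if "u \<in> ball b \<eta>" for u using im[OF that] R by blast
          show "(F ^^ n (f (\<sigma> k))) (Some (s (f (\<sigma> k)) (\<tau> (\<sigma> k) u))) = Some (\<tau> (\<sigma> k) u)"
            if "u \<in> ball b \<eta>" for u using s[of "f (\<sigma> k)"] im[OF that] by (auto simp: branch_def)
          show "(F ^^ n (f (\<sigma> k))) (Some (s (f (Suc (\<sigma> k))) u)) = Some (\<tau> (\<sigma> k) u)"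
            if "u \<in> ball b \<eta>" for u using \<tau>F sub that by blast
        qed (use elim x in auto)
      qed
    qed
    have t_id: "t u = u" if u: "u \<in> ball b \<eta>" for u
    proof -
      have fs: "strict_mono (\<lambda>k. f (\<sigma> k))" "strict_mono (\<lambda>k. f (Suc (\<sigma> k)))"
        using fm \<sigma> by (auto simp: strict_mono_def)
      have uR: "u \<in> ball a R" using u cR ball_subset_cball[of b \<eta>] by blast
      have "uniform_limit {u} (\<lambda>k. \<tau> (\<sigma> k)) t sequentially" using uR by (intro ul0) auto
      then have lt: "(\<lambda>k. \<tau> (\<sigma> k) u) \<longlonglongrightarrow> t u" by (simp add: tendsto_uniform_limitI)
      have gc: "continuous_on (cball b (\<rho>/2)) g"
        using holomorphic_on_imp_continuous_on[OF g] cbR by (rule continuous_on_subset)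
      have tu: "t u \<in> cball b (\<rho>/2)" using tt[of u] u \<rho>(1) by (auto simp: dist_commute)
      have "(\<lambda>k. s (f (\<sigma> k)) (\<tau> (\<sigma> k) u)) \<longlonglongrightarrow> g (t u)"
        by (rule tendsto_uniform_limit_moving[OF uniform_limit_subseq[OF ul[OF compact_cball cbR] fs(1)] gc tu lt])
          (use ev1 u in \<open>auto elim!: eventually_mono\<close>)
      moreover have "\<forall>\<^sub>F k in sequentially. s (f (\<sigma> k)) (\<tau> (\<sigma> k) u) = s (f (Suc (\<sigma> k))) u"
        using ev3 by eventually_elim (use u in blast)
      ultimately have "(\<lambda>k. s (f (Suc (\<sigma> k))) u) \<longlonglongrightarrow> g (t u)"
        using tendsto_cong by fastforce
      moreover have "(\<lambda>k. s (f (Suc (\<sigma> k))) u) \<longlonglongrightarrow> g u"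
      proof -
        have "uniform_limit {u} s g sequentially" using uR by (intro ul) auto
        from tendsto_uniform_limitI[OF uniform_limit_subseq[OF this fs(2)]] show ?thesis by simp
      qed
      ultimately have "g (t u) = g u" using LIMSEQ_unique by blast
      moreover have "t u \<in> ball b \<rho>" using tu cb by blast
      moreover have "u \<in> ball b \<rho>" using u \<rho>(1) by (auto simp: \<eta>_def)
      ultimately show ?thesis using \<rho>(3) by (meson inj_onD)
    qed
    have "near_id b"
    proof (rule near_idI[of \<eta> b "\<lambda>k. m (\<sigma> k)" "\<lambda>k. \<tau> (\<sigma> k)"])
      show "ball b \<eta> \<subseteq> Y" using cR R ball_subset_cball[of b \<eta>] by blast
      have "k \<le> m (\<sigma> k)" for k using mk[of "\<sigma> k"] seq_suble[OF \<sigma>, of k] by simp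
      then show "filterlim (\<lambda>k. m (\<sigma> k)) at_top sequentially"
        by (intro filterlim_at_top_mono[OF filterlim_ident]) (auto intro: always_eventually)
      show "branch (m (\<sigma> k)) (ball b \<eta>) (\<tau> (\<sigma> k))" for k
        by (rule branch_subset[OF \<tau>]) (use cR in auto)
      have "uniform_limit (ball b \<eta>) (\<lambda>k. \<tau> (\<sigma> k)) t sequentially"
        by (rule uniform_limit_on_subset[OF ul0[OF compact_cball cR]]) auto
      then show "uniform_limit (ball b \<eta>) (\<lambda>k. \<tau> (\<sigma> k)) (\<lambda>u. u) sequentially"
        by (rule uniform_limit_cong'[THEN iffD1, rotated 2]) (use t_id in auto)
    qed (rule \<eta>)
    then show False using not_near_id by blast
  qed (use hol om b in auto)
qed

text \<open>In both cases the images of a compact set shrink to one point of the sphere; in the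
  second case this point is infinity.\<close>

lemma branch_dichotomy:
  assumes R: "R > 0" "ball a R \<subseteq> Y" and n: "filterlim n at_top sequentially"
    and s: "\<And>k. branch (n k) (ball a R) (s k)"
  obtains \<sigma> c where "strict_mono (\<sigma> :: nat \<Rightarrow> nat)"
    "\<And>K. compact K \<Longrightarrow> K \<subseteq> ball a R \<Longrightarrow> uniform_limit K (\<lambda>k. s (\<sigma> k)) (\<lambda>_. c) sequentially"
  | \<sigma> where "strict_mono (\<sigma> :: nat \<Rightarrow> nat)"
    "\<And>K. compact K \<Longrightarrow> K \<subseteq> ball a R \<Longrightarrow> uniform_limit K (\<lambda>k u. inverse (s (\<sigma> k) u)) (\<lambda>_. 0) sequentially"
proof (rule Montel_omitting[of s "ball a R" a])
  fix \<sigma> g assume \<sigma>: "strict_mono (\<sigma> :: nat \<Rightarrow> nat)" and g: "g holomorphic_on ball a R"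
    and ul: "\<And>K. compact K \<Longrightarrow> K \<subseteq> ball a R \<Longrightarrow> uniform_limit K (\<lambda>k. s (\<sigma> k)) g sequentially"
  have "g constant_on ball a R"
    by (rule branch_limit_constant[OF R(2) filterlim_compose[OF n filterlim_subseq[OF \<sigma>]] s g ul])
  then obtain c where c: "\<And>u. u \<in> ball a R \<Longrightarrow> g u = c" by (auto simp: constant_on_def)
  show ?thesis
  proof (rule that(1)[OF \<sigma>])
    fix K assume K: "compact K" "K \<subseteq> ball a R"
    show "uniform_limit K (\<lambda>k. s (\<sigma> k)) (\<lambda>_. c) sequentially"
      using ul[OF K] by (rule uniform_limit_cong'[THEN iffD1, rotated 2]) (use c K in auto)
  qed
next
  fix \<sigma> assume \<sigma>: "strict_mono (\<sigma> :: nat \<Rightarrow> nat)"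
    "\<And>K. compact K \<Longrightarrow> K \<subseteq> ball a R \<Longrightarrow> uniform_limit K (\<lambda>k u. inverse (s (\<sigma> k) u)) (\<lambda>_. 0) sequentially"
  then show ?thesis by (rule that(2))
next
  show "s k holomorphic_on ball a R" for k by (rule branch_holomorphic[OF s open_ball R(2)])
  show "s k u \<noteq> 0 \<and> s k u \<noteq> 1" if "u \<in> ball a R" for k u using branch_omit[OF s R(2) that] .
qed (use R in auto)

end

section \<open>Recurrence and bridges\<close>

lemma connected_open_induct:
  fixes S :: "complex set"
  assumes S: "connected S" "open S" "a \<in> S" "P a"
    and op: "\<And>x. x \<in> S \<Longrightarrow> P x \<Longrightarrow> \<exists>r>0. \<forall>y\<in>ball x r. y \<in> S \<longrightarrow> P y"
    and cl: "\<And>x. x \<in> S \<Longrightarrow> (\<And>e. e > 0 \<Longrightarrow> \<exists>y\<in>ball x e. y \<in> S \<and> P y) \<Longrightarrow> P x"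
    and x: "x \<in> S"
  shows "P x"
proof -
  define A where "A = {x \<in> S. P x}"
  have "open A"
    unfolding open_contains_ball
  proof
    fix y assume y: "y \<in> A"
    then obtain r where r: "r > 0" "\<forall>z\<in>ball y r. z \<in> S \<longrightarrow> P z" using op[of y] by (auto simp: A_def)
    obtain r' where r': "r' > 0" "ball y r' \<subseteq> S"
      by (rule openE[OF S(2), of y]) (use y in \<open>auto simp: A_def\<close>)
    have "ball y (min r r') \<subseteq> A" "min r r' > 0" using r r' by (auto simp: A_def)
    then show "\<exists>e>0. ball y e \<subseteq> A" by blast
  qed
  moreover have "open (S - A)"
    unfolding open_contains_ball
  proof
    fix y assume y: "y \<in> S - A"
    have "\<not> P y" using y by (auto simp: A_def)
    then obtain e where e: "e > 0" "\<not> (\<exists>z\<in>ball y e. z \<in> S \<and> P z)" using cl[of y] y by blast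
    obtain r' where r': "r' > 0" "ball y r' \<subseteq> S"
      by (rule openE[OF S(2), of y]) (use y in auto)
    have "ball y (min e r') \<subseteq> S - A" "min e r' > 0" using e r' by (auto simp: A_def)
    then show "\<exists>e>0. ball y e \<subseteq> S - A" by blast
  qed
  ultimately have "A \<inter> S = {} \<or> (S - A) \<inter> S = {}"
    by (intro connectedD[OF S(1)]) (auto simp: A_def)
  then show ?thesis using S(3,4) x by (auto simp: A_def)
qed

text \<open>Every orbit in \<open>Z\<close> enters a cycle. Any multiple of the period of this cycle
  that is at least the preperiod works for one point, and a product of such numbers works for all of
  them. For \<open>F\<close> on \<open>Z\<close> the resulting power fixes each point of its image,
  so cycles reduce to fixed points.\<close>

lemma finite_selfmap_idempotent_power:
  assumes "finite Z" "f ` Z \<subseteq> Z"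
  shows "\<exists>R>0. \<forall>x\<in>Z. (f ^^ R) ((f ^^ R) x) = (f ^^ R) x"
proof -
  have it: "(f ^^ n) x \<in> Z" if "x \<in> Z" for n x
    using that assms(2) by (induction n) auto
  have single: "\<exists>R>0. (f ^^ R) ((f ^^ R) x) = (f ^^ R) x" if "x \<in> Z" for x
  proof -
    have "\<not> inj_on (\<lambda>n. (f ^^ n) x) {0..card Z}"
    proof
      assume "inj_on (\<lambda>n. (f ^^ n) x) {0..card Z}"
      then have "card {0..card Z} \<le> card Z"
        by (rule card_inj_on_le) (use it that assms(1) in auto)
      then show False by simp
    qed
    then obtain a b where ab: "a < b" "(f ^^ a) x = (f ^^ b) x"
      by (auto simp: inj_on_def) (metis linorder_neqE_nat)
    define p where "p = b - a"
    have p: "p > 0" "(f ^^ (a + p)) x = (f ^^ a) x" using ab by (auto simp: p_def)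
    have p2: "(f ^^ (j + a + p * k)) x = (f ^^ (j + a)) x" for j k
    proof (induction k)
      case (Suc k)
      have "(f ^^ (j + a + p * Suc k)) x = (f ^^ (j + p * k)) ((f ^^ (a + p)) x)"
        by (metis (no_types, opaque_lifting) comp_apply funpow_add mult_Suc_right add.assoc add.commute)
      also have "\<dots> = (f ^^ (j + a + p * k)) x" unfolding p(2)
        by (metis (no_types, opaque_lifting) comp_apply funpow_add add.assoc add.commute)
      finally show ?case using Suc by simp
    qed simp
    \<comment> \<open>The factor \<open>a + 1\<close> makes \<open>R\<close> at least the preperiod
      \<open>a\<close> and keeps it positive when \<open>a\<close> is 0.\<close>
    define R where "R = p * (a + 1)"
    have "R > 0" using p by (simp add: R_def)
    have "R \<ge> a" using p by (simp add: R_def) (metis le_add2 le_trans mult_le_mono1 nat_mult_1 Suc_leI One_nat_def)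
    then obtain j where j: "R = j + a" by (metis le_Suc_ex add.commute)
    have "(f ^^ R) ((f ^^ R) x) = (f ^^ (R + R)) x" by (simp add: funpow_add)
    also have "R + R = j + a + p * (a + 1)" using j by (simp add: R_def)
    also have "(f ^^ \<dots>) x = (f ^^ R) x" using p2[of j "a + 1"] j by simp
    finally show ?thesis using \<open>R > 0\<close> by blast
  qed
  have mult: "(f ^^ (R * k)) ((f ^^ (R * k)) x) = (f ^^ (R * k)) x"
    if idem: "(f ^^ R) ((f ^^ R) x) = (f ^^ R) x" and k0: "k > 0" for R k x
  proof -
    have 1: "(f ^^ (R * j)) ((f ^^ R) x) = (f ^^ R) x" for j
      by (induction j) (use idem in \<open>auto simp: funpow_add\<close>)
    obtain k' where k: "k = Suc k'" using k0 gr0_implies_Suc by blast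
    have 2: "(f ^^ (R * k)) x = (f ^^ R) x"
    proof -
      have "(f ^^ (R * k)) x = (f ^^ (R * k' + R)) x" by (simp add: k add.commute)
      also have "\<dots> = (f ^^ R) x" using 1[of k'] by (simp add: funpow_add)
      finally show ?thesis .
    qed
    show ?thesis using 1 2 by simp
  qed
  have "\<exists>R>0. \<forall>x\<in>S. (f ^^ R) ((f ^^ R) x) = (f ^^ R) x" if "finite S" "S \<subseteq> Z" for S
    using that
  proof (induction S rule: finite_induct)
    case empty
    show ?case by (intro exI[of _ 1]) auto
  next
    case (insert x S)
    then obtain R where R: "R > 0" "\<forall>x\<in>S. (f ^^ R) ((f ^^ R) x) = (f ^^ R) x" by auto
    obtain R' where R': "R' > 0" "(f ^^ R') ((f ^^ R') x) = (f ^^ R') x" using single insert.prems by blast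
    show ?case
    proof (intro exI[of _ "R * R'"] conjI ballI)
      fix y assume "y \<in> insert x S"
      then show "(f ^^ (R * R')) ((f ^^ (R * R')) y) = (f ^^ (R * R')) y"
        using mult[of R y R'] mult[of R' x R] R R' by (auto simp: mult.commute)
    qed (use R R' in auto)
  qed
  then show ?thesis using assms(1) by blast
qed

lemma Hausdorff_finite_separation:
  assumes "Hausdorff_space T" "finite Z" "Z \<subseteq> topspace T"
  obtains U where "\<And>x. x \<in> Z \<Longrightarrow> openin T (U x) \<and> x \<in> U x"
    "\<And>x y. x \<in> Z \<Longrightarrow> y \<in> Z \<Longrightarrow> x \<noteq> y \<Longrightarrow> U x \<inter> U y = {}"
proof -
  have "\<exists>A B. openin T A \<and> openin T B \<and> x \<in> A \<and> y \<in> B \<and> disjnt A B"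
    if xy: "x \<in> Z" "y \<in> Z" "x \<noteq> y" for x y
    using assms(1)[unfolded Hausdorff_space_def, rule_format, of x y] xy assms(3) by auto
  then obtain A B where AB: "\<And>x y. x \<in> Z \<Longrightarrow> y \<in> Z \<Longrightarrow> x \<noteq> y \<Longrightarrow>
      openin T (A x y) \<and> openin T (B x y) \<and> x \<in> A x y \<and> y \<in> B x y \<and> disjnt (A x y) (B x y)"
    by metis
  define U where "U x = \<Inter> (insert (topspace T) ((\<lambda>y. A x y \<inter> B y x) ` (Z - {x})))" for x
  show ?thesis
  proof (rule that[of U])
    fix x assume x: "x \<in> Z"
    have "openin T W \<and> x \<in> W" if W: "W \<in> insert (topspace T) ((\<lambda>y. A x y \<inter> B y x) ` (Z - {x}))" for W
    proof (cases "W = topspace T")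
      case True
      then show ?thesis using x assms(3) by auto
    next
      case False
      then obtain y where "y \<in> Z" "y \<noteq> x" "W = A x y \<inter> B y x" using W by auto
      then show ?thesis using AB[of x y] AB[of y x] x by (simp add: openin_Int)
    qed
    note W = this
    have "openin T (U x)" unfolding U_def
      by (rule openin_Inter) (simp_all only: finite_insert finite_imageI finite_Diff assms(2) W insert_not_empty not_False_eq_True)
    moreover have "x \<in> U x" unfolding U_def using W by blast
    ultimately show "openin T (U x) \<and> x \<in> U x" ..
  next
    fix x y assume "x \<in> Z" "y \<in> Z" "x \<noteq> y"
    then have "U x \<subseteq> A x y" "U y \<subseteq> B x y" "disjnt (A x y) (B x y)"
      using AB by (auto simp: U_def)
    then show "U x \<inter> U y = {}" by (auto simp: disjnt_def)
  qed
qed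

context expanding_map
begin

text \<open>The relation \<open>Q\<close> stands for closeness of \<open>x\<close> and \<open>y\<close> in the sphere; \<open>far\<close> is its
  behaviour near infinity.\<close>

lemma branch_eventually:
  assumes near: "\<And>c. \<exists>\<delta>>0. \<forall>x\<in>ball c \<delta>. \<forall>y\<in>ball c \<delta>. Q x y"
    and far: "\<exists>M. \<forall>x y. norm x > M \<longrightarrow> norm y > M \<longrightarrow> Q x y"
    and R: "0 < R" "ball a R \<subseteq> Y" "r < R"
  shows "\<exists>N. \<forall>n\<ge>N. \<forall>s. branch n (ball a R) s \<longrightarrow> (\<forall>u\<in>cball a r. \<forall>v\<in>cball a r. Q (s u) (s v))"
proof (rule ccontr)
  \<comment> \<open>A failure for arbitrarily large orders gives a sequence of branches. A
    subsequence contracts to one point of the sphere: \<open>near\<close> contradicts the failures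
    if this point is finite, and \<open>far\<close> if it is infinity.\<close>
  assume "\<not> ?thesis"
  then have "\<forall>N. \<exists>n s u v. n \<ge> N \<and> branch n (ball a R) s \<and> u \<in> cball a r \<and> v \<in> cball a r \<and> \<not> Q (s u) (s v)"
    by blast
  then obtain n s u v where *: "\<And>N. n N \<ge> N" "\<And>N. branch (n N) (ball a R) (s N)"
    "\<And>N. u N \<in> cball a r" "\<And>N. v N \<in> cball a r" "\<And>N. \<not> Q (s N (u N)) (s N (v N))"
    by metis
  have n: "filterlim n at_top sequentially"
    by (rule filterlim_at_top_mono[OF filterlim_ident]) (use *(1) in \<open>auto intro: always_eventually\<close>)
  have sub: "cball a r \<subseteq> ball a R" using R by auto
  show False
  proof (rule branch_dichotomy[OF R(1,2) n *(2)])
    fix \<sigma> c assume \<sigma>: "strict_mono (\<sigma> :: nat \<Rightarrow> nat)" and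
      ul: "\<And>K. compact K \<Longrightarrow> K \<subseteq> ball a R \<Longrightarrow> uniform_limit K (\<lambda>k. s (\<sigma> k)) (\<lambda>_. c) sequentially"
    obtain \<delta> where \<delta>: "\<delta> > 0" "\<forall>x\<in>ball c \<delta>. \<forall>y\<in>ball c \<delta>. Q x y" using near by blast
    have "\<forall>\<^sub>F k in sequentially. \<forall>x\<in>cball a r. dist (s (\<sigma> k) x) c < \<delta>"
      by (rule uniform_limitD[OF ul[OF compact_cball sub] \<delta>(1)])
    then obtain k where k: "\<forall>x\<in>cball a r. dist (s (\<sigma> k) x) c < \<delta>"
      using eventually_happens'[OF sequentially_bot] by blast
    then show False using \<delta>(2) *(3,4,5)[of "\<sigma> k"] by (auto simp: dist_commute)
  next
    fix \<sigma> assume \<sigma>: "strict_mono (\<sigma> :: nat \<Rightarrow> nat)" and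
      ul: "\<And>K. compact K \<Longrightarrow> K \<subseteq> ball a R \<Longrightarrow>
         uniform_limit K (\<lambda>k u. inverse (s (\<sigma> k) u)) (\<lambda>_. 0) sequentially"
    obtain M where M: "\<forall>x y. norm x > M \<longrightarrow> norm y > M \<longrightarrow> Q x y" using far by blast
    have "\<forall>\<^sub>F k in sequentially. \<forall>x\<in>cball a r. dist (inverse (s (\<sigma> k) x)) 0 < inverse (\<bar>M\<bar> + 1)"
      by (rule uniform_limitD[OF ul[OF compact_cball sub]]) simp
    then obtain k where k: "\<forall>x\<in>cball a r. dist (inverse (s (\<sigma> k) x)) 0 < inverse (\<bar>M\<bar> + 1)"
      using eventually_happens'[OF sequentially_bot] by blast
    have "norm (s (\<sigma> k) x) > M" if x: "x \<in> cball a r" for x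
    proof -
      have "x \<in> ball a R" using sub x by blast
      then have "norm (s (\<sigma> k) x) > 0" using branch_omit[OF *(2) R(2)] by auto
      moreover have "inverse (norm (s (\<sigma> k) x)) < inverse (\<bar>M\<bar> + 1)"
        using k x by (auto simp: norm_inverse)
      ultimately have "norm (s (\<sigma> k) x) > \<bar>M\<bar> + 1" using inverse_less_imp_less by blast
      then show ?thesis by simp
    qed
    then show False using M *(3,4,5)[of "\<sigma> k"] by blast
  qed
qed

text \<open>Cover \<open>K\<close> by finitely many discs of radius \<rho> about centres
  \<open>a\<close>. If \<open>e\<close> is in such a disc, then \<open>ball e (5 * \<rho>)\<close>
  contains \<open>ball a (4 * \<rho>)\<close>, and \<open>cball e \<rho>\<close> lies in
  \<open>cball a (2 * \<rho>)\<close>. So the bounds for the centres serve all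
  \<open>e\<close>.\<close>

lemma branch_eventually_uniform:
  assumes near: "\<And>c. \<exists>\<delta>>0. \<forall>x\<in>ball c \<delta>. \<forall>y\<in>ball c \<delta>. Q x y"
    and far: "\<exists>M. \<forall>x y. norm x > M \<longrightarrow> norm y > M \<longrightarrow> Q x y"
    and K: "compact K" "\<rho> > 0" "\<And>e. e \<in> K \<Longrightarrow> ball e (5 * \<rho>) \<subseteq> Y"
  shows "\<exists>N. \<forall>n\<ge>N. \<forall>e\<in>K. \<forall>s. branch n (ball e (5 * \<rho>)) s \<longrightarrow>
     (\<forall>u\<in>cball e \<rho>. Q (s u) (s e))"
proof -
  obtain A where A: "A \<subseteq> K" "finite A" "K \<subseteq> (\<Union>a\<in>A. ball a \<rho>)"
    using compactE_image[OF K(1), of K "\<lambda>a. ball a \<rho>"] K(2) by (metis UN_I centre_in_ball open_ball subsetI)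
  have "\<forall>a\<in>A. \<exists>N. \<forall>n\<ge>N. \<forall>s. branch n (ball a (4 * \<rho>)) s \<longrightarrow>
      (\<forall>u\<in>cball a (2 * \<rho>). \<forall>v\<in>cball a (2 * \<rho>). Q (s u) (s v))"
  proof
    fix a assume a: "a \<in> A"
    have "ball a (4 * \<rho>) \<subseteq> ball a (5 * \<rho>)" using K(2) by (intro subset_ball) simp
    then have "ball a (4 * \<rho>) \<subseteq> Y" using K(3)[of a] a A(1) by blast
    then show "\<exists>N. \<forall>n\<ge>N. \<forall>s. branch n (ball a (4 * \<rho>)) s \<longrightarrow>
      (\<forall>u\<in>cball a (2 * \<rho>). \<forall>v\<in>cball a (2 * \<rho>). Q (s u) (s v))"
      using K(2) by (intro branch_eventually near far) auto
  qed
  then obtain N where N: "\<And>a n s. a \<in> A \<Longrightarrow> n \<ge> N a \<Longrightarrow> branch n (ball a (4 * \<rho>)) s \<Longrightarrow>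
      (\<forall>u\<in>cball a (2 * \<rho>). \<forall>v\<in>cball a (2 * \<rho>). Q (s u) (s v))" by metis
  show ?thesis
  proof (intro exI[of _ "Max (insert 0 (N ` A))"] allI impI ballI)
    fix n e s u
    assume n: "n \<ge> Max (insert 0 (N ` A))" and e: "e \<in> K" and s: "branch n (ball e (5 * \<rho>)) s"
      and u: "u \<in> cball e \<rho>"
    obtain a where a: "a \<in> A" "e \<in> ball a \<rho>" using A(3) e by blast
    have "N a \<le> n" using n a(1) A(2) by (metis Max_ge finite_imageI finite_insert imageI insertCI le_trans)
    moreover have "branch n (ball a (4 * \<rho>)) s"
    proof (rule branch_subset[OF s])
      show "ball a (4 * \<rho>) \<subseteq> ball e (5 * \<rho>)"
      proof
        fix x assume "x \<in> ball a (4 * \<rho>)"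
        then show "x \<in> ball e (5 * \<rho>)" using a(2) dist_triangle[of e x a] by (auto simp: dist_commute)
      qed
    qed
    moreover have "u \<in> cball a (2 * \<rho>)" using u a(2) dist_triangle[of a u e] by (auto simp: dist_commute)
    moreover have "e \<in> cball a (2 * \<rho>)" using a(2) K(2) by auto
    ultimately show "Q (s u) (s e)" using N[OF a(1)] by blast
  qed
qed

text \<open>Together with \<open>osc_far\<close> this supplies the relation \<open>Q\<close> for a
  test function: its values at two points of a contracted image differ by less than
  \<epsilon>.\<close>

lemma osc_near:
  assumes "continuous_map sphere_topology euclideanreal g" "\<epsilon> > 0"
  shows "\<exists>\<delta>>0. \<forall>x\<in>ball c \<delta>. \<forall>y\<in>ball c \<delta>. \<bar>g (Some x) - g (Some y)\<bar> < \<epsilon>"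
proof -
  have "continuous_on UNIV (\<lambda>u. g (Some u))" by (rule continuous_on_Some_comp[OF assms(1)])
  then have "isCont (\<lambda>u. g (Some u)) c" by (simp add: continuous_on_eq_continuous_at)
  then obtain \<delta> where \<delta>: "\<delta> > 0" "\<And>x. dist x c < \<delta> \<Longrightarrow> dist (g (Some x)) (g (Some c)) < \<epsilon>/2"
    using half_gt_zero[OF assms(2)] unfolding continuous_at_eps_delta by blast
  have "\<bar>g (Some x) - g (Some y)\<bar> < \<epsilon>" if "x \<in> ball c \<delta>" "y \<in> ball c \<delta>" for x y
  proof -
    have "\<bar>g (Some x) - g (Some c)\<bar> < \<epsilon>/2" "\<bar>g (Some y) - g (Some c)\<bar> < \<epsilon>/2"
      using \<delta>(2)[of x] \<delta>(2)[of y] that by (auto simp: dist_commute[of _ c] dist_real_def)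
    then show ?thesis
      using abs_triangle_ineq4[of "g (Some x) - g (Some c)" "g (Some y) - g (Some c)"] by simp
  qed
  then show ?thesis using \<delta>(1) by blast
qed

lemma openin_level:
  assumes "continuous_map sphere_topology euclideanreal g"
  shows "openin sphere_topology {x. \<bar>g x - c\<bar> < \<epsilon>}"
proof -
  have "openin sphere_topology {x \<in> topspace sphere_topology. g x \<in> ball c \<epsilon>}"
    by (rule openin_continuous_map_preimage[OF assms]) simp
  moreover have "{x \<in> topspace sphere_topology. g x \<in> ball c \<epsilon>} = {x. \<bar>g x - c\<bar> < \<epsilon>}"
    by (auto simp: dist_real_def abs_minus_commute)
  ultimately show ?thesis by simp
qed

lemma osc_far:
  assumes "continuous_map sphere_topology euclideanreal g" "\<epsilon> > 0"
  shows "\<exists>M. \<forall>x y. norm x > M \<longrightarrow> norm y > M \<longrightarrow> \<bar>g (Some x) - g (Some y)\<bar> < \<epsilon>"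
proof -
  obtain M where M: "\<And>w. norm w > M \<Longrightarrow> Some w \<in> {x. \<bar>g x - g None\<bar> < \<epsilon>/2}"
    using openin_sphere_None[OF openin_level[OF assms(1)], of "g None" "\<epsilon>/2"] assms(2) by auto
  have "\<bar>g (Some x) - g (Some y)\<bar> < \<epsilon>" if "norm x > M" "norm y > M" for x y
    using M[OF that(1)] M[OF that(2)] abs_triangle_ineq4[of "g (Some x) - g None" "g (Some y) - g None"]
    by simp
  then show ?thesis by blast
qed

text \<open>Images near infinity may have large Euclidean diameter. The premise
  \<open>norm y \<le> B\<close> restricts the claim to branches with a value in a bounded region,
  and makes \<open>diam_far\<close> vacuous.\<close>

lemma diam_near: "\<epsilon> > 0 \<Longrightarrow> \<exists>\<delta>>0. \<forall>x\<in>ball c \<delta>. \<forall>y\<in>ball c \<delta>. norm y \<le> B \<longrightarrow> dist x y < (\<epsilon>::real)"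
  for c :: complex
proof (intro exI[of _ "\<epsilon>/2"] conjI ballI impI)
  fix x y assume "x \<in> ball c (\<epsilon>/2)" "y \<in> ball c (\<epsilon>/2)"
  then show "dist x y < \<epsilon>" using dist_triangle_half_l[of x c \<epsilon> y] by (simp add: dist_commute)
qed simp

lemma diam_far: "\<exists>M. \<forall>x y. norm x > M \<longrightarrow> norm y > M \<longrightarrow> norm y \<le> B \<longrightarrow> dist x y < (\<epsilon>::real)"
  by (rule exI[of _ B]) auto

text \<open>Around the points of \<open>Z\<close> choose disjoint neighbourhoods, expelling in the
  sense of \<open>repelling_Z\<close> at the points fixed by \<open>F ^^ R\<close>. An orbit that
  stays in their union from some time on moves from the neighbourhood of \<open>x\<close> to that of
  \<open>(F ^^ R) x\<close>; so after one such move it stays near a fixed point \<open>p\<close> of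
  \<open>F ^^ R\<close> along all multiples of \<open>R\<close>. Expulsion gives equality with
  \<open>p\<close>, and the orbit meets \<open>Z\<close>. The set \<open>K\<close> is the complement
  of the union.\<close>

lemma recurrent_outside_Z:
  obtains K where "closedin sphere_topology K" "K \<inter> Z = {}"
    "\<forall>z. (\<forall>n. (F ^^ n) z \<notin> Z) \<longrightarrow> infinite {n. (F ^^ n) z \<in> K}"
proof -
  obtain R where R: "R > 0" "\<forall>x\<in>Z. (F ^^ R) ((F ^^ R) x) = (F ^^ R) x"
    using finite_selfmap_idempotent_power[OF finite_Z F_Z] by blast
  obtain U0 where U0: "\<And>x. x \<in> Z \<Longrightarrow> openin sphere_topology (U0 x) \<and> x \<in> U0 x"
    "\<And>x y. x \<in> Z \<Longrightarrow> y \<in> Z \<Longrightarrow> x \<noteq> y \<Longrightarrow> U0 x \<inter> U0 y = {}"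
    using Hausdorff_finite_separation[OF Hausdorff_space_sphere finite_Z] by (metis subset_UNIV topspace_sphere)
  have "\<forall>x\<in>Z. \<exists>U. openin sphere_topology U \<and> x \<in> U \<and>
     ((F ^^ R) x = x \<longrightarrow> (\<forall>z. (\<forall>k. (F ^^ (R * k)) z \<in> U) \<longrightarrow> z = x))"
    using repelling_Z R(1) U0(1) by metis
  then obtain U1 where U1: "\<And>x. x \<in> Z \<Longrightarrow> openin sphere_topology (U1 x) \<and> x \<in> U1 x \<and>
     ((F ^^ R) x = x \<longrightarrow> (\<forall>z. (\<forall>k. (F ^^ (R * k)) z \<in> U1 x) \<longrightarrow> z = x))" by metis
  define U where "U x = U0 x \<inter> U1 x" for x
  have U: "openin sphere_topology (U x)" "x \<in> U x" if "x \<in> Z" for x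
    using U0(1) U1 that by (auto simp: U_def)
  have Ud: "x = y" if "x \<in> Z" "y \<in> Z" "w \<in> U x" "w \<in> U y" for x y w
    using U0(2)[of x y] that by (auto simp: U_def)
  \<comment> \<open>Shrinking \<open>U\<close> so that \<open>F ^^ R\<close> sends it into the
    neighbourhood of the image point ties the itinerary of a nearby orbit to that of
    \<open>x\<close>; disjointness excludes any other itinerary.\<close>
  define V where "V x = U x \<inter> {w. (F ^^ R) w \<in> U ((F ^^ R) x)}" for x
  have V: "openin sphere_topology (V x)" "x \<in> V x" if x: "x \<in> Z" for x
    unfolding V_def using U x funpow_Z[OF x] openin_funpow_vimage by (auto intro!: openin_Int)
  define K where "K = - (\<Union>x\<in>Z. V x)"
  show ?thesis
  proof (rule that[of K])
    have "openin sphere_topology (\<Union>x\<in>Z. V x)" using V by blast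
    then show "closedin sphere_topology K" by (simp add: K_def closedin_def Compl_eq_Diff_UNIV Diff_Diff_Int)
    show "K \<inter> Z = {}" using V by (auto simp: K_def)
    show "\<forall>z. (\<forall>n. (F ^^ n) z \<notin> Z) \<longrightarrow> infinite {n. (F ^^ n) z \<in> K}"
    proof (intro allI impI notI)
      fix z assume z: "\<forall>n. (F ^^ n) z \<notin> Z"
      assume "finite {n. (F ^^ n) z \<in> K}"
      then obtain k0 where "\<forall>n\<in>{n. (F ^^ n) z \<in> K}. n < k0" using finite_nat_set_iff_bounded by blast
      then have k0: "\<And>n. n \<ge> k0 \<Longrightarrow> (F ^^ n) z \<in> (\<Union>x\<in>Z. V x)" by (force simp: K_def)
      have inV: "(F ^^ R) w \<in> V ((F ^^ R) x)" if xw: "x \<in> Z" "w \<in> V x" "(F ^^ R) w = (F ^^ n) z" "n \<ge> k0" for x w n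
      proof -
        obtain x' where x': "x' \<in> Z" "(F ^^ R) w \<in> V x'" using k0[OF xw(4)] xw(3) by auto
        have "(F ^^ R) w \<in> U ((F ^^ R) x)" using xw(2) by (auto simp: V_def)
        moreover have "(F ^^ R) w \<in> U x'" using x' by (auto simp: V_def)
        ultimately have "x' = (F ^^ R) x" using Ud x'(1) funpow_Z[OF xw(1)] by blast
        then show ?thesis using x' by simp
      qed
      obtain x where x: "x \<in> Z" "(F ^^ k0) z \<in> V x" using k0[of k0] by auto
      define p where "p = (F ^^ R) x"
      have p: "p \<in> Z" "(F ^^ R) p = p" using R(2) x(1) funpow_Z by (auto simp: p_def)
      define z1 where "z1 = (F ^^ R) ((F ^^ k0) z)"
      have st: "(F ^^ (R * k)) z1 \<in> V p" for k
      proof (induction k)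
        case 0
        have "(F ^^ R) ((F ^^ k0) z) = (F ^^ (R + k0)) z" by (simp add: funpow_add)
        then show ?case using inV[OF x, of "R + k0"] by (simp add: z1_def p_def)
      next
        case (Suc k)
        have "(F ^^ R) ((F ^^ (R * k)) z1) = (F ^^ (R + R * k + (R + k0))) z"
          by (simp add: z1_def funpow_add)
        then have "(F ^^ R) ((F ^^ (R * k)) z1) \<in> V ((F ^^ R) p)"
          by (rule inV[OF p(1) Suc]) simp
        then show ?case using p(2) by (simp add: funpow_add)
      qed
      then have "z1 = p" using U1[OF p(1)] p(2) by (auto simp: V_def U_def)
      then have "(F ^^ (R + k0)) z \<in> Z" using p by (simp add: z1_def funpow_add)
      then show False using z by blast
    qed
  qed
qed

lemma countable_landing: "countable {z. \<exists>n. (F ^^ n) z \<in> Z}"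
proof -
  have "{z. \<exists>n. (F ^^ n) z \<in> Z} = (\<Union>n. \<Union>y\<in>Z. {z. (F ^^ n) z = y})" by auto
  moreover have "countable (\<Union>n. \<Union>y\<in>Z. {z. (F ^^ n) z = y})"
    by (intro countable_UN countableI_type countable_finite finite_Z finite_fibre_funpow)
  ultimately show ?thesis by simp
qed

text \<open>Points landing in \<open>Z\<close> are countable, discs are not. Such points start the
  recurrent orbits behind the bridges, and also the orbits that imitate a cycle of
  \<open>Z\<close>.\<close>

lemma nonlanding_in_open:
  assumes "openin sphere_topology U" "Some c \<in> U"
  obtains z where "Some z \<in> U" "\<And>n. (F ^^ n) (Some z) \<notin> Z"
proof -
  obtain r where r: "r > 0" "ball c r \<subseteq> {u. Some u \<in> U}"
    by (rule openE[OF open_Some_preimage[OF assms(1)], of c]) (use assms(2) in auto)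
  have "{u. Some u \<in> {z. \<exists>n. (F ^^ n) z \<in> Z}} \<subseteq> the ` {z. \<exists>n. (F ^^ n) z \<in> Z}"
    by (auto simp: image_iff) (metis option.sel)
  then have "countable {u. Some u \<in> {z. \<exists>n. (F ^^ n) z \<in> Z}}"
    by (rule countable_subset[OF _ countable_image[OF countable_landing]])
  then have "\<not> ball c r \<subseteq> {u. Some u \<in> {z. \<exists>n. (F ^^ n) z \<in> Z}}"
    using uncountable_ball[OF r(1), of c] countable_subset[of "ball c r"] by metis
  then obtain z where z: "z \<in> ball c r" "z \<notin> {u. Some u \<in> {z. \<exists>n. (F ^^ n) z \<in> Z}}"
    unfolding subset_iff by blast
  show ?thesis by (rule that[of z]) (use z r(2) in auto)
qed

end

section \<open>Birkhoff sums\<close>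

definition birkhoff_sum :: "('a \<Rightarrow> 'a) \<Rightarrow> ('a \<Rightarrow> real) \<Rightarrow> nat \<Rightarrow> 'a \<Rightarrow> real" where
  "birkhoff_sum f g n x = (\<Sum>i<n. g ((f ^^ i) x))"

lemma birkhoff_sum_add:
  "birkhoff_sum f g (m + n) x = birkhoff_sum f g m x + birkhoff_sum f g n ((f ^^ m) x)"
proof -
  have "birkhoff_sum f g (m + n) x = (\<Sum>i<m. g ((f ^^ i) x)) + (\<Sum>i\<in>{m..<m + n}. g ((f ^^ i) x))"
    unfolding birkhoff_sum_def by (simp add: sum.atLeastLessThan_concat flip: atLeast0LessThan)
  also have "(\<Sum>i\<in>{m..<m + n}. g ((f ^^ i) x)) = (\<Sum>i<n. g ((f ^^ i) ((f ^^ m) x)))"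
    using sum.shift_bounds_nat_ivl[of "\<lambda>i. g ((f ^^ i) x)" 0 m n]
    by (simp add: funpow_add add.commute flip: atLeast0LessThan)
  finally show ?thesis by (simp add: birkhoff_sum_def)
qed

lemma birkhoff_sum_bound:
  assumes "\<And>x. \<bar>g x\<bar> \<le> C"
  shows "\<bar>birkhoff_sum f g n x\<bar> \<le> C * real n"
proof -
  have "\<bar>birkhoff_sum f g n x\<bar> \<le> (\<Sum>i<n. \<bar>g ((f ^^ i) x)\<bar>)" unfolding birkhoff_sum_def by (rule sum_abs)
  also have "\<dots> \<le> (\<Sum>i<n. C)" by (intro sum_mono assms)
  finally show ?thesis by (simp add: mult.commute)
qed

section \<open>Bridges of bounded length between points of a compact set\<close>

context expanding_map
begin

lemma branch_point:
  assumes "x \<in> Y"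
  obtains r where "r > 0" "ball x (4 * r) \<subseteq> Y"
proof -
  obtain r where r: "r > 0" "ball x r \<subseteq> Y" by (rule openE[OF open_Y assms])
  show ?thesis by (rule that[of "r/4"]) (use r in auto)
qed

text \<open>Pick \<open>z\<close> in the disc about \<open>e\<close> with an orbit that never meets
  \<open>Z\<close>; it returns to a compact part of \<open>Y\<close> infinitely often, say at times
  \<open>n k\<close> in points \<open>b k\<close> tending to \<open>a\<close>. The branch of order
  \<open>n k\<close> that takes \<open>b k\<close> back to \<open>z\<close> contracts, so a whole
  neighbourhood of \<open>a\<close> is reached from points arbitrarily near \<open>z\<close>.
  Connectedness of \<open>Y\<close> spreads this to every point, and compactness of \<open>K\<close>
  yields one time for all of \<open>K\<close>.\<close>

lemma bridge_point:
  assumes K: "compact K" "K \<subseteq> Y" and e: "e \<in> Y" "\<rho> > 0"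
  obtains N where "\<And>x. x \<in> K \<Longrightarrow> \<exists>w\<in>ball e \<rho>. (F ^^ N) (Some w) = Some x"
proof -
  obtain K' where K': "closedin sphere_topology K'" "K' \<inter> Z = {}"
    and K'inf: "\<forall>z. (\<forall>n. (F ^^ n) z \<notin> Z) \<longrightarrow> infinite {n. (F ^^ n) z \<in> K'}"
    by (rule recurrent_outside_Z)
  have "openin sphere_topology (Some ` ball e \<rho>)" by simp
  then obtain z where z: "Some z \<in> Some ` ball e \<rho>" "\<And>n. (F ^^ n) (Some z) \<notin> Z"
    by (rule nonlanding_in_open[of _ e]) (use e in auto)
  have ze: "z \<in> ball e \<rho>" using z(1) by auto
  obtain \<delta>0 where \<delta>0: "\<delta>0 > 0" "ball z \<delta>0 \<subseteq> ball e \<rho>" by (rule openE[OF open_ball ze])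
  obtain n0 where n0: "strict_mono (n0 :: nat \<Rightarrow> nat)" "\<And>k. n0 k \<in> {n. (F ^^ n) (Some z) \<in> K'}"
    using infinite_enumerate[of "{n. (F ^^ n) (Some z) \<in> K'}"] K'inf z(2) by auto
  define C where "C = {u. Some u \<in> K'}"
  have "None \<notin> K'" using K'(2) Z_points by auto
  then have C: "compact C" using compact_Some_preimage[OF K'(1)] by (simp add: C_def)
  have CY: "C \<subseteq> Y" using K'(2) by (auto simp: C_def Y_def)
  have FnC: "Fn (n0 k) z \<in> C" "(F ^^ n0 k) (Some z) = Some (Fn (n0 k) z)" for k
    using n0(2)[of k] funpow_Fn[OF z(2), of "n0 k"] by (auto simp: C_def)
  obtain a \<sigma> where a: "a \<in> C" "strict_mono (\<sigma> :: nat \<Rightarrow> nat)" "((\<lambda>k. Fn (n0 k) z) \<circ> \<sigma>) \<longlonglongrightarrow> a"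
    using compact_imp_seq_compact[OF C] FnC(1) unfolding seq_compact_def by metis
  define n where "n k = n0 (\<sigma> k)" for k
  define b where "b k = Fn (n k) z" for k
  have bl: "b \<longlonglongrightarrow> a" using a(3) by (simp add: o_def b_def[abs_def] n_def)
  have bF: "(F ^^ n k) (Some z) = Some (b k)" for k using FnC(2) by (simp add: b_def n_def)
  have "strict_mono n" using n0(1) a(2) by (auto simp: strict_mono_def n_def)
  then have nk: "k \<le> n k" for k by (rule seq_suble)
  \<comment> \<open>Quantifying over all large \<open>k\<close>, for one sequence \<open>n\<close>
    fixed in advance, allows a single time \<open>n k\<close> for a finite cover of
    \<open>K\<close>. The radius \<open>r\<close> does not depend on \<delta>, which makes the
    property open.\<close>
  define P where "P x \<longleftrightarrow> (\<exists>r>0. \<forall>\<delta>>0. \<exists>k0. \<forall>k\<ge>k0. \<forall>y\<in>ball x r. \<exists>w\<in>ball z \<delta>. (F ^^ n k) (Some w) = Some y)" for x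
  have diam: "\<exists>N. \<forall>j\<ge>N. \<forall>s. branch j (ball x (4 * r)) s \<longrightarrow>
     (\<forall>u\<in>cball x (2 * r). \<forall>v\<in>cball x (2 * r). norm (s v) \<le> norm z + 1 \<longrightarrow> dist (s u) (s v) < \<delta>)"
    if "r > 0" "ball x (4 * r) \<subseteq> Y" "\<delta> > 0" for x r \<delta>
    by (rule branch_eventually) (use that diam_near diam_far in auto)
  \<comment> \<open>A single reachable point \<open>y\<close> near \<open>x\<close> is enough: the
    branch about \<open>x\<close> that sends \<open>y\<close> to a point near \<open>z\<close> has a
    small image, so the whole disc about \<open>x\<close> is reached from near \<open>z\<close>.
    This gives both the start at \<open>a\<close> and the closedness.\<close>
  have key: "P x" if x: "x \<in> Y"
    and ap: "\<And>\<eta> \<delta>. \<eta> > 0 \<Longrightarrow> \<delta> > 0 \<Longrightarrow>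
       \<exists>k0. \<forall>k\<ge>k0. \<exists>y\<in>ball x \<eta>. \<exists>w\<in>ball z \<delta>. (F ^^ n k) (Some w) = Some y" for x
  proof -
    obtain r where r: "r > 0" "ball x (4 * r) \<subseteq> Y" by (rule branch_point[OF x])
    have "\<exists>k0. \<forall>k\<ge>k0. \<forall>y\<in>ball x r. \<exists>w\<in>ball z \<delta>. (F ^^ n k) (Some w) = Some y" if \<delta>: "\<delta> > 0" for \<delta>
    proof -
      obtain N where N: "\<And>j s u v. j \<ge> N \<Longrightarrow> branch j (ball x (4 * r)) s \<Longrightarrow> u \<in> cball x (2 * r) \<Longrightarrow>
          v \<in> cball x (2 * r) \<Longrightarrow> norm (s v) \<le> norm z + 1 \<Longrightarrow> dist (s u) (s v) < \<delta>/2"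
        using diam[OF r half_gt_zero[OF \<delta>]] by metis
      \<comment> \<open>The bound 1 keeps a value of the branch in the bounded region for which
        \<open>diam\<close> is stated.\<close>
      obtain k0 where k0: "\<And>k. k \<ge> k0 \<Longrightarrow> \<exists>y\<in>ball x r. \<exists>w\<in>ball z (min 1 (\<delta>/2)). (F ^^ n k) (Some w) = Some y"
        using ap[of r "min 1 (\<delta>/2)"] r \<delta> by auto
      show ?thesis
      proof (intro exI[of _ "max k0 N"] allI impI ballI)
        fix k y assume k: "k \<ge> max k0 N" and y: "y \<in> ball x r"
        obtain y' w where y': "y' \<in> ball x r" "w \<in> ball z (min 1 (\<delta>/2))" "(F ^^ n k) (Some w) = Some y'"
          using k0[of k] k by auto
        have y'4: "y' \<in> ball x (4 * r)" using y'(1) r(1) by auto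
        obtain s where s: "branch (n k) (ball x (4 * r)) s" "s y' = w"
          by (rule branch_exists[OF r(2) y'4 y'(3)])
        have "norm w \<le> norm z + 1"
          using y'(2) norm_triangle_sub[of w z] by (auto simp: dist_norm norm_minus_commute)
        then have "dist (s y) (s y') < \<delta>/2"
          using k nk[of k] y y'(1) r(1) s(2) by (intro N[OF _ s(1)]) auto
        then have "dist z (s y) < \<delta>"
          using y'(2) s(2) dist_triangle[of z "s y" w] by (auto simp: dist_commute)
        moreover have "(F ^^ n k) (Some (s y)) = Some y" using s(1) y r(1) by (auto simp: branch_def)
        ultimately show "\<exists>w\<in>ball z \<delta>. (F ^^ n k) (Some w) = Some y" by auto
      qed
    qed
    then show ?thesis using r(1) unfolding P_def by blast
  qed
  have Pa: "P a"
  proof (rule key)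
    show "a \<in> Y" using a(1) CY by blast
    fix \<eta> \<delta> :: real assume "\<eta> > 0" "\<delta> > 0"
    obtain k0 where "\<And>k. k \<ge> k0 \<Longrightarrow> dist (b k) a < \<eta>"
      using bl \<open>\<eta> > 0\<close> unfolding lim_sequentially by blast
    then show "\<exists>k0. \<forall>k\<ge>k0. \<exists>y\<in>ball a \<eta>. \<exists>w\<in>ball z \<delta>. (F ^^ n k) (Some w) = Some y"
      using bF \<open>\<delta> > 0\<close> by (intro exI[of _ k0]) (force simp: dist_commute)
  qed
  have PY: "P x" if "x \<in> Y" for x
  proof (rule connected_open_induct[where S = Y and a = a and P = P])
    show "a \<in> Y" using a(1) CY by blast
  next
    fix x assume "P x"
    then obtain r where r: "r > 0" "\<And>\<delta>. \<delta> > 0 \<Longrightarrow>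
        \<exists>k0. \<forall>k\<ge>k0. \<forall>y\<in>ball x r. \<exists>w\<in>ball z \<delta>. (F ^^ n k) (Some w) = Some y" unfolding P_def by blast
    have "P y" if y: "y \<in> ball x r" for y
    proof -
      obtain r' where r': "r' > 0" "ball y r' \<subseteq> ball x r" by (rule openE[OF open_ball y])
      have "\<exists>k0. \<forall>k\<ge>k0. \<forall>y\<in>ball y r'. \<exists>w\<in>ball z \<delta>. (F ^^ n k) (Some w) = Some y" if "\<delta> > 0" for \<delta>
        using r(2)[OF that] r'(2) by (meson subsetD)
      then show ?thesis using r'(1) unfolding P_def by blast
    qed
    then show "\<exists>r>0. \<forall>y\<in>ball x r. y \<in> Y \<longrightarrow> P y" using r(1) by blast
  next
    fix x assume x: "x \<in> Y" and cl: "\<And>e. e > 0 \<Longrightarrow> \<exists>y\<in>ball x e. y \<in> Y \<and> P y"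
    show "P x"
    proof (rule key[OF x])
      fix \<eta> \<delta> :: real assume "\<eta> > 0" "\<delta> > 0"
      obtain y where y: "y \<in> ball x \<eta>" "P y" using cl[OF \<open>\<eta> > 0\<close>] by blast
      obtain r where r: "r > 0" "\<And>\<delta>. \<delta> > 0 \<Longrightarrow>
        \<exists>k0. \<forall>k\<ge>k0. \<forall>y\<in>ball y r. \<exists>w\<in>ball z \<delta>. (F ^^ n k) (Some w) = Some y"
        using y(2) unfolding P_def by blast
      obtain k0 where k0: "\<forall>k\<ge>k0. \<forall>y\<in>ball y r. \<exists>w\<in>ball z \<delta>. (F ^^ n k) (Some w) = Some y"
        using r(2)[OF \<open>\<delta> > 0\<close>] by blast
      have "y \<in> ball y r" using r(1) by simp
      then show "\<exists>k0. \<forall>k\<ge>k0. \<exists>y\<in>ball x \<eta>. \<exists>w\<in>ball z \<delta>. (F ^^ n k) (Some w) = Some y"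
        using k0 y(1) by blast
    qed
  qed (rule connected_Y open_Y Pa that)+
  have "\<forall>x\<in>K. \<exists>r k0. r > 0 \<and> (\<forall>k\<ge>k0. \<forall>y\<in>ball x r. \<exists>w\<in>ball z \<delta>0. (F ^^ n k) (Some w) = Some y)"
    using PY K(2) \<delta>0(1) unfolding P_def by (meson subsetD)
  then obtain r k0 where rk: "\<And>x. x \<in> K \<Longrightarrow> r x > 0"
    "\<And>x k y. x \<in> K \<Longrightarrow> k \<ge> k0 x \<Longrightarrow> y \<in> ball x (r x) \<Longrightarrow> \<exists>w\<in>ball z \<delta>0. (F ^^ n k) (Some w) = Some y"
    by metis
  have "K \<subseteq> (\<Union>x\<in>K. ball x (r x))" using rk(1) by force
  then obtain A where A: "A \<subseteq> K" "finite A" "K \<subseteq> (\<Union>x\<in>A. ball x (r x))"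
    using compactE_image[OF K(1), of K "\<lambda>x. ball x (r x)"] by (metis open_ball)
  define k where "k = Max (insert 0 (k0 ` A))"
  show ?thesis
  proof (rule that[of "n k"])
    fix x assume "x \<in> K"
    then obtain x' where x': "x' \<in> A" "x \<in> ball x' (r x')" using A(3) by blast
    have "k0 x' \<le> k" unfolding k_def using A(2) x'(1) by (intro Max_ge) auto
    then obtain w where "w \<in> ball z \<delta>0" "(F ^^ n k) (Some w) = Some x" using rk(2)[of x' k x] x' A(1) by blast
    then show "\<exists>w\<in>ball e \<rho>. (F ^^ n k) (Some w) = Some x" using \<delta>0(2) by blast
  qed
qed

text \<open>The time in \<open>bridge_point\<close> depends on the starting point \<open>e\<close>.
  Nearby starting points can share it when the bridge starts in a disc of half the radius, so
  finitely many times suffice; hence an upper bound \<open>N0\<close> and not one common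
  time.\<close>

lemma bridge_uniform:
  assumes K: "compact K" "K \<subseteq> Y" and \<rho>: "\<rho> > 0"
  obtains N0 where "\<And>e x. e \<in> K \<Longrightarrow> x \<in> K \<Longrightarrow> \<exists>N\<le>N0. \<exists>w\<in>ball e \<rho>. (F ^^ N) (Some w) = Some x"
proof -
  have "\<forall>e\<in>K. \<exists>N. \<forall>x\<in>K. \<exists>w\<in>ball e (\<rho>/2). (F ^^ N) (Some w) = Some x"
  proof
    fix e assume "e \<in> K"
    then obtain N where "\<And>x. x \<in> K \<Longrightarrow> \<exists>w\<in>ball e (\<rho>/2). (F ^^ N) (Some w) = Some x"
      using bridge_point[OF K, of e "\<rho>/2"] \<rho> K(2) by (metis half_gt_zero subsetD)
    then show "\<exists>N. \<forall>x\<in>K. \<exists>w\<in>ball e (\<rho>/2). (F ^^ N) (Some w) = Some x" by blast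
  qed
  then obtain N where N: "\<And>e x. e \<in> K \<Longrightarrow> x \<in> K \<Longrightarrow> \<exists>w\<in>ball e (\<rho>/2). (F ^^ N e) (Some w) = Some x" by metis
  have "K \<subseteq> (\<Union>x\<in>K. ball x (\<rho>/2))" using \<rho> by force
  then obtain A where A: "A \<subseteq> K" "finite A" "K \<subseteq> (\<Union>x\<in>A. ball x (\<rho>/2))"
    using compactE_image[OF K(1), of K "\<lambda>x. ball x (\<rho>/2)"] by (metis open_ball)
  show ?thesis
  proof (rule that[of "Max (insert 0 (N ` A))"])
    fix e x assume e: "e \<in> K" "x \<in> K"
    then obtain a where a: "a \<in> A" "e \<in> ball a (\<rho>/2)" using A(3) by blast
    obtain w where w: "w \<in> ball a (\<rho>/2)" "(F ^^ N a) (Some w) = Some x" using N[of a x] a A(1) e by blast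
    have "w \<in> ball e \<rho>" using w(1) a(2) dist_triangle_half_r[of a e \<rho> w] by simp
    moreover have "N a \<le> Max (insert 0 (N ` A))" using A(2) a(1) by (intro Max_ge) auto
    ultimately show "\<exists>N'\<le>Max (insert 0 (N ` A)). \<exists>w\<in>ball e \<rho>. (F ^^ N') (Some w) = Some x"
      using w(2) by blast
  qed
qed

end

section \<open>Shadowing by periodic orbits\<close>

lemma finite_family_bounded:
  assumes "finite G" "\<And>g. g \<in> G \<Longrightarrow> continuous_map sphere_topology euclideanreal g"
  obtains C where "C > 0" "\<And>g x. g \<in> G \<Longrightarrow> \<bar>g x\<bar> \<le> C"
proof -
  have "\<forall>g\<in>G. \<exists>c. \<forall>x. \<bar>g x\<bar> \<le> c" using assms(2) continuous_map_sphere_bounded by metis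
  then obtain c where c: "\<And>g x. g \<in> G \<Longrightarrow> \<bar>g x\<bar> \<le> c g" by metis
  have "\<bar>g x\<bar> \<le> 1 + (\<Sum>g\<in>G. c g)" if g: "g \<in> G" for g x
  proof -
    have "c g \<le> (\<Sum>g\<in>G. c g)"
      by (rule member_le_sum[OF g _ assms(1)]) (use c abs_ge_zero order_trans in blast)
    then show ?thesis using c[OF g, of x] by linarith
  qed
  moreover have "1 + (\<Sum>g\<in>G. c g) > 0"
  proof -
    have "(\<Sum>g\<in>G. c g) \<ge> 0" by (rule sum_nonneg) (use c abs_ge_zero order_trans in blast)
    then show ?thesis by simp
  qed
  ultimately show ?thesis using that by blast
qed

context expanding_map
begin

text \<open>A segment \<open>(x, n)\<close> stands for the orbit piece \<open>x, \<dots>, F\<^sup>n\<^sup>-\<^sup>1 x\<close>.\<close>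

definition segment_in :: "complex set \<Rightarrow> complex \<times> nat \<Rightarrow> bool" where
  "segment_in K p \<longleftrightarrow> fst p \<in> K \<and> (F ^^ snd p) (Some (fst p)) \<in> Some ` K"

text \<open>The disc about the endpoint of the segment is pulled back along the segment and then
  along a bridge that starts near \<open>e0\<close>. Contraction places the result inside
  \<open>cball e0 \<rho>\<close>, which lets segments be chained. At time \<open>i\<close> of the
  segment the remaining order is \<open>n - i\<close>; as long as it exceeds \<open>N\<close>, the
  shadowing orbit is close to the segment for all test functions. The last \<open>N\<close> steps
  and the bridge are estimated trivially.\<close>

lemma shadow_segment:
  assumes K: "compact K" "K \<subseteq> Y" and \<rho>: "\<rho> > 0" "\<And>e. e \<in> K \<Longrightarrow> ball e (5 * \<rho>) \<subseteq> Y"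
    and G: "finite G" "\<And>g. g \<in> G \<Longrightarrow> continuous_map sphere_topology euclideanreal g" and \<epsilon>: "\<epsilon> > 0"
  obtains N D where "N > 0" "D \<ge> 0"
    "\<And>e0 x n. e0 \<in> K \<Longrightarrow> segment_in K (x, n) \<Longrightarrow> n \<ge> N \<Longrightarrow>
      \<exists>T s. n \<le> T \<and> real T \<le> real n + D \<and> continuous_on (cball (Fn n x) \<rho>) s \<and>
        s ` cball (Fn n x) \<rho> \<subseteq> cball e0 \<rho> \<and>
        (\<forall>u\<in>cball (Fn n x) \<rho>. (F ^^ T) (Some (s u)) = Some u \<and>
          (\<forall>g\<in>G. \<bar>birkhoff_sum F g T (Some (s u)) - birkhoff_sum F g n (Some x)\<bar> \<le> \<epsilon> * real n + D))"
proof -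
  obtain C where C: "C > 0" "\<And>g x. g \<in> G \<Longrightarrow> \<bar>g x\<bar> \<le> C" using finite_family_bounded[OF G] by blast
  obtain B where B: "\<And>w. w \<in> K \<Longrightarrow> norm w \<le> B" using compact_imp_bounded[OF K(1)] bounded_iff by metis
  obtain N0 where N0: "\<And>e x. e \<in> K \<Longrightarrow> x \<in> K \<Longrightarrow> \<exists>N\<le>N0. \<exists>w\<in>ball e (\<rho>/2). (F ^^ N) (Some w) = Some x"
    using bridge_uniform[OF K half_gt_zero[OF \<rho>(1)]] by metis
  have "\<exists>N. \<forall>n\<ge>N. \<forall>e\<in>K. \<forall>s. branch n (ball e (5 * \<rho>)) s \<longrightarrow>
     (\<forall>u\<in>cball e \<rho>. norm (s e) \<le> B + \<rho> \<longrightarrow> dist (s u) (s e) < \<rho>/2)"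
    by (rule branch_eventually_uniform[OF diam_near diam_far K(1) \<rho>]) (use \<rho> in auto)
  then obtain N1 where N1: "\<And>n e s u. n \<ge> N1 \<Longrightarrow> e \<in> K \<Longrightarrow> branch n (ball e (5 * \<rho>)) s \<Longrightarrow>
     u \<in> cball e \<rho> \<Longrightarrow> norm (s e) \<le> B + \<rho> \<Longrightarrow> dist (s u) (s e) < \<rho>/2" by metis
  have "\<exists>N. \<forall>n\<ge>N. \<forall>e\<in>K. \<forall>s. branch n (ball e (5 * \<rho>)) s \<longrightarrow>
     (\<forall>u\<in>cball e \<rho>. \<bar>g (Some (s u)) - g (Some (s e))\<bar> < \<epsilon>)" if "g \<in> G" for g
    by (rule branch_eventually_uniform[OF osc_near[OF G(2)[OF that] \<epsilon>] osc_far[OF G(2)[OF that] \<epsilon>] K(1) \<rho>])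
  then obtain N2 where N2: "\<And>g n e s u. g \<in> G \<Longrightarrow> n \<ge> N2 g \<Longrightarrow> e \<in> K \<Longrightarrow> branch n (ball e (5 * \<rho>)) s \<Longrightarrow>
     u \<in> cball e \<rho> \<Longrightarrow> \<bar>g (Some (s u)) - g (Some (s e))\<bar> < \<epsilon>" by metis
  define N where "N = Suc (N1 + Max (insert 0 (N2 ` G)))"
  have N2N: "N2 g \<le> N" if "g \<in> G" for g
  proof -
    have "N2 g \<le> Max (insert 0 (N2 ` G))" using G(1) that by (intro Max_ge) auto
    then show ?thesis by (simp add: N_def)
  qed
  \<comment> \<open>The terms account for the length of the bridge, its Birkhoff sum, and the
    Birkhoff sums over the last \<open>N\<close> steps of both orbits.\<close>
  define D where "D = real N0 + C * real N0 + 2 * (C * real N)"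
  have D: "D \<ge> real N0" "D \<ge> C * real N0 + 2 * (C * real N)" using C(1) by (auto simp: D_def)
  show ?thesis
  proof (rule that[of N D])
    show "N > 0" by (simp add: N_def)
    show "D \<ge> 0" using D(1) by simp
    fix e0 x n assume e0: "e0 \<in> K" and seg: "segment_in K (x, n)" and n: "n \<ge> N"
    define e where "e = Fn n x"
    have xK: "x \<in> K" and eK: "e \<in> K" and Fe: "(F ^^ n) (Some x) = Some e"
      using seg by (auto simp: segment_in_def e_def Fn_def)
    obtain m w where m: "m \<le> N0" "w \<in> ball e0 (\<rho>/2)" "(F ^^ m) (Some w) = Some x"
      using N0[OF e0 xK] by blast
    define T where "T = m + n"
    have FT: "(F ^^ T) (Some w) = Some e" using m(3) Fe by (simp add: T_def funpow_add add.commute[of m])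
    obtain s where s: "branch T (ball e (5 * \<rho>)) s" "s e = w"
      by (rule branch_exists[OF \<rho>(2)[OF eK] _ FT]) (use \<rho> in auto)
    have bY: "ball e (5 * \<rho>) \<subseteq> Y" by (rule \<rho>(2)[OF eK])
    have cb: "cball e \<rho> \<subseteq> ball e (5 * \<rho>)" using \<rho>(1) by auto
    have "norm w \<le> B + \<rho>"
    proof -
      have "norm w \<le> norm e0 + norm (w - e0)" using norm_triangle_sub by blast
      then show ?thesis using B[OF e0] m(2) \<rho>(1) by (auto simp: dist_norm norm_minus_commute)
    qed
    then have dst: "dist (s u) w < \<rho>/2" if "u \<in> cball e \<rho>" for u
      using N1[OF _ eK s(1) that] s(2) n by (simp add: T_def N_def)
    have sum: "\<bar>birkhoff_sum F g T (Some (s u)) - birkhoff_sum F g n (Some x)\<bar> \<le> \<epsilon> * real n + D"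
      if u: "u \<in> cball e \<rho>" and g: "g \<in> G" for u g
    proof -
      have cl: "\<bar>g ((F ^^ i) ((F ^^ m) (Some (s u)))) - g ((F ^^ i) (Some x))\<bar> \<le> \<epsilon>" if i: "i < n - N" for i
      proof -
        have br: "branch ((m + i) + (n - i)) (ball e (5 * \<rho>)) s" using s(1) i by (simp add: T_def)
        have br2: "branch (n - i) (ball e (5 * \<rho>)) (\<lambda>u. Fn (m + i) (s u))" by (rule branch_shift[OF br bY])
        have Fs: "(F ^^ (m + i)) (Some (s v)) = Some (Fn (m + i) (s v))" if "v \<in> ball e (5 * \<rho>)" for v
          by (rule funpow_Fn[OF branch_iterate_notin_Z[OF br bY that]])
        have "\<bar>g (Some (Fn (m + i) (s u))) - g (Some (Fn (m + i) (s e)))\<bar> < \<epsilon>"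
          by (rule N2[OF g _ eK br2 u]) (use i N2N[OF g] in simp)
        moreover have "Some (Fn (m + i) (s u)) = (F ^^ i) ((F ^^ m) (Some (s u)))"
          using Fs[of u] u cb by (auto simp: funpow_add add.commute[of m])
        moreover have "Some (Fn (m + i) (s e)) = (F ^^ i) (Some x)"
          using Fs[of e] \<rho>(1) s(2) m(3) by (simp add: funpow_add add.commute[of m])
        ultimately show ?thesis by simp
      qed
      define y where "y = (F ^^ m) (Some (s u))"
      have n2: "n = (n - N) + N" using n by simp
      have "\<bar>birkhoff_sum F g (n - N) y - birkhoff_sum F g (n - N) (Some x)\<bar>
          \<le> (\<Sum>i<n - N. \<bar>g ((F ^^ i) y) - g ((F ^^ i) (Some x))\<bar>)"
        unfolding birkhoff_sum_def sum_subtractf[symmetric] by (rule sum_abs)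
      also have "\<dots> \<le> (\<Sum>i<n - N. \<epsilon>)" by (rule sum_mono) (use cl in \<open>auto simp: y_def\<close>)
      also have "\<dots> \<le> \<epsilon> * real n" using \<epsilon> by (simp add: mult.commute)
      finally have 1: "\<bar>birkhoff_sum F g (n - N) y - birkhoff_sum F g (n - N) (Some x)\<bar> \<le> \<epsilon> * real n" .
      have 2: "\<bar>birkhoff_sum F g N ((F ^^ (n - N)) y)\<bar> \<le> C * real N"
        "\<bar>birkhoff_sum F g N ((F ^^ (n - N)) (Some x))\<bar> \<le> C * real N"
        by (rule birkhoff_sum_bound[OF C(2)[OF g]])+
      have "\<bar>birkhoff_sum F g m (Some (s u))\<bar> \<le> C * real m"
        by (rule birkhoff_sum_bound[OF C(2)[OF g]])
      also have "\<dots> \<le> C * real N0" using C(1) m(1) by simp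
      finally have 3: "\<bar>birkhoff_sum F g m (Some (s u))\<bar> \<le> C * real N0" .
      have 4: "birkhoff_sum F g T (Some (s u)) = birkhoff_sum F g m (Some (s u)) + birkhoff_sum F g n y"
        by (simp add: T_def birkhoff_sum_add y_def)
      have 5: "birkhoff_sum F g n z = birkhoff_sum F g (n - N) z + birkhoff_sum F g N ((F ^^ (n - N)) z)" for z
        by (subst n2) (rule birkhoff_sum_add)
      show ?thesis unfolding 4 5 using 1 2 3 D(2) by linarith
    qed
    show "\<exists>T s. n \<le> T \<and> real T \<le> real n + D \<and> continuous_on (cball (Fn n x) \<rho>) s \<and>
        s ` cball (Fn n x) \<rho> \<subseteq> cball e0 \<rho> \<and>
        (\<forall>u\<in>cball (Fn n x) \<rho>. (F ^^ T) (Some (s u)) = Some u \<and>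
          (\<forall>g\<in>G. \<bar>birkhoff_sum F g T (Some (s u)) - birkhoff_sum F g n (Some x)\<bar> \<le> \<epsilon> * real n + D))"
      unfolding e_def[symmetric]
    proof (intro exI[of _ T] exI[of _ s] conjI ballI)
      show "n \<le> T" "real T \<le> real n + D" using m(1) D(1) by (auto simp: T_def)
      show "continuous_on (cball e \<rho>) s" using branch_subset[OF s(1) cb] by (simp add: branch_def)
      show "s ` cball e \<rho> \<subseteq> cball e0 \<rho>"
      proof (rule image_subsetI)
        fix u assume "u \<in> cball e \<rho>"
        then show "s u \<in> cball e0 \<rho>"
          using dst[of u] m(2) dist_triangle[of e0 "s u" w] by (auto simp: dist_commute)
      qed
      show "(F ^^ T) (Some (s u)) = Some u" if "u \<in> cball e \<rho>" for u
        using branch_subset[OF s(1) cb] that by (simp add: branch_def)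
    qed (rule sum)
  qed
qed

text \<open>Shadowing the segments of \<open>L\<close> backwards gives an inverse branch that maps a closed disc into
  itself; its fixed point is periodic.\<close>

lemma closing:
  assumes K: "compact K" "K \<subseteq> Y"
    and G: "finite G" "\<And>g. g \<in> G \<Longrightarrow> continuous_map sphere_topology euclideanreal g" and \<epsilon>: "\<epsilon> > 0"
  obtains N D where "D \<ge> 0"
    "\<forall>L. L \<noteq> [] \<and> (\<forall>p\<in>set L. segment_in K p \<and> N \<le> snd p) \<longrightarrow>
      (\<exists>y T. T > 0 \<and> (F ^^ T) y = y \<and> (\<Sum>p\<leftarrow>L. real (snd p)) \<le> real T \<and>
        real T \<le> (\<Sum>p\<leftarrow>L. real (snd p) + D) \<and>
        (\<forall>g\<in>G. \<bar>birkhoff_sum F g T y - (\<Sum>p\<leftarrow>L. birkhoff_sum F g (snd p) (Some (fst p)))\<bar>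
           \<le> (\<Sum>p\<leftarrow>L. \<epsilon> * real (snd p) + D)))"
proof -
  obtain \<rho>0 where \<rho>0: "\<rho>0 > 0" "(\<Union>x\<in>K. ball x \<rho>0) \<subseteq> Y"
    using compact_subset_open_imp_ball_epsilon_subset[OF K(1) open_Y K(2)] by blast
  define \<rho> where "\<rho> = \<rho>0 / 5"
  have \<rho>: "\<rho> > 0" "\<And>e. e \<in> K \<Longrightarrow> ball e (5 * \<rho>) \<subseteq> Y" using \<rho>0 by (auto simp: \<rho>_def)
  obtain N D where N: "N > 0" and D: "D \<ge> 0" and st:
    "\<And>e0 x n. e0 \<in> K \<Longrightarrow> segment_in K (x, n) \<Longrightarrow> n \<ge> N \<Longrightarrow>
      \<exists>T s. n \<le> T \<and> real T \<le> real n + D \<and> continuous_on (cball (Fn n x) \<rho>) s \<and>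
        s ` cball (Fn n x) \<rho> \<subseteq> cball e0 \<rho> \<and>
        (\<forall>u\<in>cball (Fn n x) \<rho>. (F ^^ T) (Some (s u)) = Some u \<and>
          (\<forall>g\<in>G. \<bar>birkhoff_sum F g T (Some (s u)) - birkhoff_sum F g n (Some x)\<bar> \<le> \<epsilon> * real n + D))"
    using shadow_segment[OF K \<rho> G \<epsilon>] by metis
  define E where "E p = Fn (snd p) (fst p)" for p :: "complex \<times> nat"
  have EK: "E p \<in> K" if "segment_in K p" for p
    using that by (auto simp: segment_in_def E_def Fn_def)
  \<comment> \<open>The anchor \<open>e0\<close> is arbitrary: in the induction the tail is anchored
    at the endpoint \<open>E p\<close> of the first segment, so that the two pulled back maps
    compose.\<close>
  have chain: "\<exists>T s. T > 0 \<and> (\<Sum>p\<leftarrow>L. real (snd p)) \<le> real T \<and> real T \<le> (\<Sum>p\<leftarrow>L. real (snd p) + D) \<and>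
      continuous_on (cball (E (last L)) \<rho>) s \<and> s ` cball (E (last L)) \<rho> \<subseteq> cball e0 \<rho> \<and>
      (\<forall>u\<in>cball (E (last L)) \<rho>. (F ^^ T) (Some (s u)) = Some u \<and>
        (\<forall>g\<in>G. \<bar>birkhoff_sum F g T (Some (s u)) - (\<Sum>p\<leftarrow>L. birkhoff_sum F g (snd p) (Some (fst p)))\<bar>
          \<le> (\<Sum>p\<leftarrow>L. \<epsilon> * real (snd p) + D)))"
    if "L \<noteq> []" "\<forall>p\<in>set L. segment_in K p \<and> N \<le> snd p" "e0 \<in> K" for L e0
    using that
  proof (induction L arbitrary: e0 rule: list_nonempty_induct)
    case (single p)
    obtain x n where p: "p = (x, n)" by (cases p)
    obtain T s where Ts: "n \<le> T \<and> real T \<le> real n + D \<and> continuous_on (cball (Fn n x) \<rho>) s \<and>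
        s ` cball (Fn n x) \<rho> \<subseteq> cball e0 \<rho> \<and>
        (\<forall>u\<in>cball (Fn n x) \<rho>. (F ^^ T) (Some (s u)) = Some u \<and>
          (\<forall>g\<in>G. \<bar>birkhoff_sum F g T (Some (s u)) - birkhoff_sum F g n (Some x)\<bar> \<le> \<epsilon> * real n + D))"
      using st[of e0 x n] single p by auto
    then show ?case using single(1) p N by (intro exI[of _ T] exI[of _ s]) (auto simp: E_def)
  next
    case (cons p L)
    obtain x n where p: "p = (x, n)" by (cases p)
    have e1: "E p \<in> K" using cons.prems(1) EK by simp
    obtain T1 s1 where 1: "n \<le> T1" "real T1 \<le> real n + D" "continuous_on (cball (E p) \<rho>) s1"
        "s1 ` cball (E p) \<rho> \<subseteq> cball e0 \<rho>"
        "\<And>u. u \<in> cball (E p) \<rho> \<Longrightarrow> (F ^^ T1) (Some (s1 u)) = Some u"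
        "\<And>u g. u \<in> cball (E p) \<rho> \<Longrightarrow> g \<in> G \<Longrightarrow>
           \<bar>birkhoff_sum F g T1 (Some (s1 u)) - birkhoff_sum F g n (Some x)\<bar> \<le> \<epsilon> * real n + D"
      using st[of e0 x n] cons.prems p unfolding E_def by auto
    obtain T2 s2 where 2: "T2 > 0" "(\<Sum>p\<leftarrow>L. real (snd p)) \<le> real T2" "real T2 \<le> (\<Sum>p\<leftarrow>L. real (snd p) + D)"
        "continuous_on (cball (E (last L)) \<rho>) s2" "s2 ` cball (E (last L)) \<rho> \<subseteq> cball (E p) \<rho>"
        "\<And>u. u \<in> cball (E (last L)) \<rho> \<Longrightarrow> (F ^^ T2) (Some (s2 u)) = Some u"
        "\<And>u g. u \<in> cball (E (last L)) \<rho> \<Longrightarrow> g \<in> G \<Longrightarrow>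
           \<bar>birkhoff_sum F g T2 (Some (s2 u)) - (\<Sum>p\<leftarrow>L. birkhoff_sum F g (snd p) (Some (fst p)))\<bar>
             \<le> (\<Sum>p\<leftarrow>L. \<epsilon> * real (snd p) + D)"
      using cons.IH[OF _ e1] cons.prems(1) by auto
    have s2: "s2 u \<in> cball (E p) \<rho>" if "u \<in> cball (E (last L)) \<rho>" for u using 2(5) that by blast
    show ?case
    proof (intro exI[of _ "T1 + T2"] exI[of _ "\<lambda>u. s1 (s2 u)"] conjI ballI)
      show "T1 + T2 > 0" using 2(1) by simp
      show "(\<Sum>p\<leftarrow>p # L. real (snd p)) \<le> real (T1 + T2)" using 1(1) 2(2) p by simp
      show "real (T1 + T2) \<le> (\<Sum>p\<leftarrow>p # L. real (snd p) + D)" using 1(2) 2(3) p by simp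
      show "continuous_on (cball (E (last (p # L))) \<rho>) (\<lambda>u. s1 (s2 u))"
        using continuous_on_compose2[OF 1(3) 2(4,5)] cons.hyps by simp
      show "(\<lambda>u. s1 (s2 u)) ` cball (E (last (p # L))) \<rho> \<subseteq> cball e0 \<rho>"
        using 1(4) s2 cons.hyps by auto
      fix u assume "u \<in> cball (E (last (p # L))) \<rho>"
      then have u: "u \<in> cball (E (last L)) \<rho>" using cons.hyps by simp
      have F1: "(F ^^ T1) (Some (s1 (s2 u))) = Some (s2 u)" by (rule 1(5)[OF s2[OF u]])
      show "(F ^^ (T1 + T2)) (Some (s1 (s2 u))) = Some u"
        using F1 2(6)[OF u] by (simp add: funpow_add add.commute[of T1])
      fix g assume g: "g \<in> G"
      show "\<bar>birkhoff_sum F g (T1 + T2) (Some (s1 (s2 u))) - (\<Sum>p\<leftarrow>p # L. birkhoff_sum F g (snd p) (Some (fst p)))\<bar>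
          \<le> (\<Sum>p\<leftarrow>p # L. \<epsilon> * real (snd p) + D)"
        using 1(6)[OF s2[OF u] g] 2(7)[OF u g] F1 p by (simp add: birkhoff_sum_add)
    qed
  qed
  show ?thesis
  proof (rule that[OF D, of N], intro allI impI)
    fix L assume "L \<noteq> [] \<and> (\<forall>p\<in>set L. segment_in K p \<and> N \<le> snd p)"
    then have L: "L \<noteq> []" "\<forall>p\<in>set L. segment_in K p \<and> N \<le> snd p" by auto
    \<comment> \<open>Anchoring the chain at the end of its own last segment is what gives the
      composite branch the same disc as domain and target.\<close>
    define e where "e = E (last L)"
    have eK: "e \<in> K" unfolding e_def using L by (intro EK) auto
    obtain T s where Ts: "T > 0" "(\<Sum>p\<leftarrow>L. real (snd p)) \<le> real T" "real T \<le> (\<Sum>p\<leftarrow>L. real (snd p) + D)"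
        "continuous_on (cball e \<rho>) s" "s ` cball e \<rho> \<subseteq> cball e \<rho>"
        "\<And>u. u \<in> cball e \<rho> \<Longrightarrow> (F ^^ T) (Some (s u)) = Some u"
        "\<And>u g. u \<in> cball e \<rho> \<Longrightarrow> g \<in> G \<Longrightarrow>
           \<bar>birkhoff_sum F g T (Some (s u)) - (\<Sum>p\<leftarrow>L. birkhoff_sum F g (snd p) (Some (fst p)))\<bar>
             \<le> (\<Sum>p\<leftarrow>L. \<epsilon> * real (snd p) + D)"
      using chain[OF L(1) _ eK] L(2) unfolding e_def by auto
    obtain u where u: "u \<in> cball e \<rho>" "s u = u"
      by (rule brouwer_ball[OF \<rho>(1) Ts(4)]) (use Ts(5) in auto)
    show "\<exists>y T. T > 0 \<and> (F ^^ T) y = y \<and> (\<Sum>p\<leftarrow>L. real (snd p)) \<le> real T \<and>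
        real T \<le> (\<Sum>p\<leftarrow>L. real (snd p) + D) \<and>
        (\<forall>g\<in>G. \<bar>birkhoff_sum F g T y - (\<Sum>p\<leftarrow>L. birkhoff_sum F g (snd p) (Some (fst p)))\<bar>
           \<le> (\<Sum>p\<leftarrow>L. \<epsilon> * real (snd p) + D))"
      using Ts(1-3) Ts(6)[OF u(1)] Ts(7)[OF u(1)] u(2)
      by (intro exI[of _ "Some u"] exI[of _ T]) auto
  qed
qed

end

section \<open>Orbit segments representing an invariant measure\<close>

context expanding_map
begin

lemma segment_in_mono: "segment_in K p \<Longrightarrow> K \<subseteq> K' \<Longrightarrow> segment_in K' p"
  by (auto simp: segment_in_def)

lemma birkhoff_sum_shadow_periodic:
  assumes "\<And>j. j < J \<Longrightarrow> \<bar>birkhoff_sum F g R ((F ^^ (R * j)) y) - b\<bar> \<le> c"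
  shows "\<bar>birkhoff_sum F g (R * J) y - real J * b\<bar> \<le> real J * c"
  using assms
proof (induction J)
  case 0
  then show ?case by (simp add: birkhoff_sum_def)
next
  case (Suc J)
  have "birkhoff_sum F g (R * Suc J) y = birkhoff_sum F g (R * J) y + birkhoff_sum F g R ((F ^^ (R * J)) y)"
    using birkhoff_sum_add[of F g "R * J" R y] by (simp add: add.commute)
  moreover have "\<bar>birkhoff_sum F g (R * J) y - real J * b\<bar> \<le> real J * c"
    by (rule Suc.IH) (use Suc.prems in simp)
  moreover have "\<bar>birkhoff_sum F g R ((F ^^ (R * J)) y) - b\<bar> \<le> c" by (rule Suc.prems) simp
  moreover have "real (Suc J) * b = real J * b + b" "real (Suc J) * c = real J * c + c"
    by (simp_all add: algebra_simps)
  ultimately show ?case by linarith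
qed

text \<open>Start near a preimage of \<open>p\<close> outside \<open>Z\<close>, come close to
  \<open>p\<close> after \<open>m\<close> steps, and follow the cycle for more than
  \<open>k0\<close> rounds of \<open>R\<close> steps until the first exit from a small neighbourhood
  \<open>V\<close>. Repulsion forces the exit, and the exit point lies in a compact subset of
  \<open>Y\<close> that does not depend on the length of the stay. So arbitrarily long segments have
  both ends in one set \<open>K\<close>.\<close>

lemma periodic_segments:
  assumes p: "p \<in> Z" "R > 0" "(F ^^ R) p = p"
    and G: "finite G" "\<And>g. g \<in> G \<Longrightarrow> continuous_map sphere_topology euclideanreal g" and \<epsilon>: "\<epsilon> > 0"
  obtains K where "compact K" "K \<subseteq> Y"
    "\<And>n0. \<exists>x n. n0 \<le> n \<and> segment_in K (x, n) \<and>
      (\<forall>g\<in>G. \<bar>birkhoff_sum F g n (Some x) - real n * (birkhoff_sum F g R p / real R)\<bar> \<le> \<epsilon> * real n)"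
proof -
  obtain C where C: "C > 0" "\<And>g x. g \<in> G \<Longrightarrow> \<bar>g x\<bar> \<le> C" using finite_family_bounded[OF G] by blast
  obtain U where U: "openin sphere_topology U" "p \<in> U" "\<forall>z. (\<forall>k. (F ^^ (R * k)) z \<in> U) \<longrightarrow> z = p"
    using repelling_Z[OF p] by blast
  define Z1 where "Z1 = {x. (F ^^ R) x \<in> Z}"
  have "Z1 = (\<Union>y\<in>Z. {x. (F ^^ R) x = y})" by (auto simp: Z1_def)
  then have finZ1: "finite Z1" using finite_Z finite_fibre_funpow by simp
  have ZZ1: "Z \<subseteq> Z1" using funpow_Z by (auto simp: Z1_def)
  obtain A where A: "\<And>x. x \<in> Z1 \<Longrightarrow> openin sphere_topology (A x) \<and> x \<in> A x"
    "\<And>x y. x \<in> Z1 \<Longrightarrow> y \<in> Z1 \<Longrightarrow> x \<noteq> y \<Longrightarrow> A x \<inter> A y = {}"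
    using Hausdorff_finite_separation[OF Hausdorff_space_sphere finZ1] by (metis subset_UNIV topspace_sphere)
  \<comment> \<open>The exit point is the image under \<open>F ^^ R\<close> of a point of
    \<open>Cl\<close>. Since \<open>Cl\<close> avoids all points other than \<open>p\<close> that
    \<open>F ^^ R\<close> sends into \<open>Z\<close>, and \<open>p\<close> itself stays in
    \<open>V\<close>, the exit point is outside \<open>Z\<close>.\<close>
  define Cl where "Cl = - (\<Union>x\<in>Z1 - {p}. A x)"
  have clCl: "closedin sphere_topology Cl" unfolding closedin_sphere_Compl Cl_def using A(1) by auto
  have ClZ: "x = p" if "x \<in> Cl" "x \<in> Z1" for x using that A(1) by (auto simp: Cl_def)
  define W where "W = {y. \<forall>i\<in>{..<R}. \<forall>g\<in>G. (F ^^ i) y \<in> {x. \<bar>g x - g ((F ^^ i) p)\<bar> < \<epsilon>/2}}"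
  have "W = (\<Inter>i\<in>{..<R}. (\<Inter>g\<in>G. {y. (F ^^ i) y \<in> {x. \<bar>g x - g ((F ^^ i) p)\<bar> < \<epsilon>/2}}) \<inter> topspace sphere_topology)"
    by (auto simp: W_def)
  also have "openin sphere_topology \<dots>"
    by (intro openin_INT2 openin_INT G finite_lessThan openin_funpow_vimage openin_level)
      (use p(2) in auto)
  finally have opW: "openin sphere_topology W" .
  define V where "V = U \<inter> A p \<inter> W"
  have pZ1: "p \<in> Z1" using p(1) ZZ1 by blast
  have V: "openin sphere_topology V" "p \<in> V"
    unfolding V_def using U A(1)[OF pZ1] opW \<epsilon> by (auto simp: W_def intro!: openin_Int)
  have VCl: "V \<subseteq> Cl" using A(2)[OF pZ1] by (auto simp: V_def Cl_def)
  have VU: "V \<subseteq> U" by (auto simp: V_def)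
  define K1 where "K1 = {u. Some u \<in> (F ^^ R) ` Cl - V}"
  have clex: "closedin sphere_topology ((F ^^ R) ` Cl - V)"
    using closedin_diff[OF closedin_funpow_image[OF clCl] V(1)] .
  have exZ: "y \<notin> Z" if y: "y \<in> (F ^^ R) ` Cl - V" for y
  proof
    assume "y \<in> Z"
    obtain x where x: "x \<in> Cl" "y = (F ^^ R) x" using y by blast
    then have "x = p" using ClZ \<open>y \<in> Z\<close> by (auto simp: Z1_def)
    then show False using x p(3) V(2) y by auto
  qed
  have K1: "compact K1" "K1 \<subseteq> Y"
    unfolding K1_def using compact_Some_preimage[OF clex] exZ Z_points by (auto simp: Y_def)
  obtain m q where q: "q \<notin> Z" "(F ^^ m) q = p" using backward_Z[OF p(1)] by blast
  then obtain c where c: "q = Some c" using Z_points by (cases q) auto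
  obtain r0 where r0: "r0 > 0" "ball c r0 \<subseteq> Y"
    by (rule openE[OF open_Y, of c]) (use q c in \<open>auto simp: Y_def\<close>)
  define r where "r = r0 / 2"
  have r: "r > 0" "cball c r \<subseteq> Y"
  proof -
    show "r > 0" using r0 by (simp add: r_def)
    have "cball c r \<subseteq> ball c r0" using r0(1) by (auto simp: r_def)
    then show "cball c r \<subseteq> Y" using r0(2) by blast
  qed
  show ?thesis
  proof (rule that[of "K1 \<union> cball c r"])
    show "compact (K1 \<union> cball c r)" "K1 \<union> cball c r \<subseteq> Y" using K1 r by auto
    fix n0
    \<comment> \<open>With this many rounds the \<open>m\<close> lead-in steps use at most half of
      the allowed error; the other half is spent on the rounds near the cycle.\<close>
    obtain k1 :: nat where k1: "real k1 \<ge> 4 * C * real m / \<epsilon>" using real_arch_simple by blast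
    define k0 where "k0 = max n0 k1"
    define O1 where "O1 = Some ` ball c r \<inter> (\<Inter>j\<in>{..k0}. {y. (F ^^ (R * j + m)) y \<in> V})"
    have "openin sphere_topology O1" unfolding O1_def
      by (intro openin_Int openin_INT2 openin_funpow_vimage V) auto
    moreover have "Some c \<in> O1"
    proof -
      have "(F ^^ (R * j)) p = p" for j
        by (induction j) (use p(3) in \<open>auto simp: funpow_add\<close>)
      then show ?thesis using q(2) c r(1) V(2) by (auto simp: O1_def funpow_add)
    qed
    \<comment> \<open>A starting point that never lands on \<open>Z\<close> ensures that the orbit
      near \<open>p\<close> does not hit \<open>p\<close> itself, so it has to leave
      \<open>V\<close>.\<close>
    ultimately obtain x where x: "Some x \<in> O1" "\<And>n. (F ^^ n) (Some x) \<notin> Z"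
      by (rule nonlanding_in_open) auto
    have xr: "x \<in> ball c r" using x(1) by (auto simp: O1_def)
    define y where "y = (F ^^ m) (Some x)"
    have yV: "(F ^^ (R * j)) y \<in> V" if "j \<le> k0" for j
      using x(1) that by (auto simp: O1_def y_def funpow_add)
    have "\<exists>j. (F ^^ (R * j)) y \<notin> V"
    proof (rule ccontr)
      assume "\<not> ?thesis"
      then have "y = p" using U(3) VU by blast
      then show False using x(2)[of m] p(1) by (simp add: y_def)
    qed
    define J where "J = (LEAST j. (F ^^ (R * j)) y \<notin> V)"
    have J: "(F ^^ (R * J)) y \<notin> V" "\<And>j. j < J \<Longrightarrow> (F ^^ (R * j)) y \<in> V"
      using LeastI_ex[OF \<open>\<exists>j. (F ^^ (R * j)) y \<notin> V\<close>] not_less_Least unfolding J_def by blast+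
    have Jk: "J > k0" using J(1) yV not_le by blast
    then obtain J' where J': "J = Suc J'" by (cases J) auto
    have "(F ^^ (R * J)) y = (F ^^ R) ((F ^^ (R * J')) y)" by (simp add: J' funpow_add)
    then have ex: "(F ^^ (R * J)) y \<in> (F ^^ R) ` Cl - V" using J(1) J(2)[of J'] J' VCl by auto
    define n where "n = m + R * J"
    have Fn: "(F ^^ n) (Some x) = (F ^^ (R * J)) y"
      by (simp add: n_def y_def funpow_add add.commute[of m])
    have "(F ^^ (R * J)) y \<in> Some ` K1"
    proof (cases "(F ^^ (R * J)) y")
      case None
      then show ?thesis using exZ[OF ex] Z_points by simp
    next
      case (Some a)
      then show ?thesis using ex by (auto simp: K1_def)
    qed
    then have seg: "segment_in (K1 \<union> cball c r) (x, n)" using xr Fn by (auto simp: segment_in_def)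
    have "J \<le> R * J" using p(2) by simp
    then have nk: "n \<ge> k0" using Jk unfolding n_def by linarith
    have "4 * C * real m \<le> \<epsilon> * real k1" using k1 \<epsilon> by (simp add: divide_le_eq mult.commute)
    also have "\<dots> \<le> \<epsilon> * real n" using nk \<epsilon> by (simp add: k0_def)
    finally have mn: "2 * (C * real m) \<le> \<epsilon> * real n / 2" by simp
    show "\<exists>x n. n0 \<le> n \<and> segment_in (K1 \<union> cball c r) (x, n) \<and>
      (\<forall>g\<in>G. \<bar>birkhoff_sum F g n (Some x) - real n * (birkhoff_sum F g R p / real R)\<bar> \<le> \<epsilon> * real n)"
    proof (intro exI[of _ x] exI[of _ n] conjI ballI)
      show "n0 \<le> n" using nk by (simp add: k0_def)
      fix g assume g: "g \<in> G"
      define b where "b = birkhoff_sum F g R p"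
      have 1: "\<bar>birkhoff_sum F g R ((F ^^ (R * j)) y) - b\<bar> \<le> real R * (\<epsilon>/2)" if "j < J" for j
      proof -
        have inW: "(F ^^ (R * j)) y \<in> W" using J(2)[OF that] by (simp add: V_def)
        have "\<bar>birkhoff_sum F g R ((F ^^ (R * j)) y) - b\<bar>
            \<le> (\<Sum>i<R. \<bar>g ((F ^^ i) ((F ^^ (R * j)) y)) - g ((F ^^ i) p)\<bar>)"
          unfolding b_def birkhoff_sum_def sum_subtractf[symmetric] by (rule sum_abs)
        also have "\<dots> \<le> (\<Sum>i<R. \<epsilon>/2)"
          by (rule sum_mono) (use inW g in \<open>auto simp: W_def less_imp_le\<close>)
        finally show ?thesis by simp
      qed
      have 2: "\<bar>birkhoff_sum F g (R * J) y - real J * b\<bar> \<le> real J * (real R * (\<epsilon>/2))"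
        by (rule birkhoff_sum_shadow_periodic) (rule 1)
      have 3: "\<bar>birkhoff_sum F g m (Some x)\<bar> \<le> C * real m" by (rule birkhoff_sum_bound[OF C(2)[OF g]])
      have "\<bar>b\<bar> \<le> C * real R" unfolding b_def by (rule birkhoff_sum_bound[OF C(2)[OF g]])
      then have "\<bar>b / real R\<bar> \<le> C" using p(2) by (simp add: divide_le_eq)
      then have 4: "\<bar>real m * (b / real R)\<bar> \<le> C * real m"
        by (metis abs_mult abs_of_nat mult.commute mult_right_mono of_nat_0_le_iff)
      have 5: "real n * (b / real R) = real m * (b / real R) + real J * b"
        using p(2) by (simp add: n_def field_simps)
      have 6: "real J * (real R * (\<epsilon>/2)) \<le> \<epsilon> * real n / 2" using \<epsilon> by (simp add: n_def algebra_simps)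
      have 7: "birkhoff_sum F g n (Some x) = birkhoff_sum F g m (Some x) + birkhoff_sum F g (R * J) y"
        by (simp add: n_def birkhoff_sum_add y_def)
      show "\<bar>birkhoff_sum F g n (Some x) - real n * (birkhoff_sum F g R p / real R)\<bar> \<le> \<epsilon> * real n"
      proof -
        have tri: "\<bar>B + A - (M + A')\<bar> \<le> t" if "\<bar>A - A'\<bar> \<le> e1" "\<bar>B\<bar> \<le> e2" "\<bar>M\<bar> \<le> e2"
          "e1 \<le> t/2" "2 * e2 \<le> t/2" for A B M A' e1 e2 t :: real
          using that by linarith
        show ?thesis unfolding b_def[symmetric] 5 7 by (rule tri[OF 2 3 4 6 mn])
      qed
    qed (rule seg)
  qed
qed

end

section \<open>Finite weighted sums in place of integrals\<close>

text \<open>The points are representatives of the level sets of the finitely many integrands, rounded to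
  multiples of \<open>\<epsilon>\<close>.\<close>

lemma integral_approx_points:
  fixes h :: "'g \<Rightarrow> 'a \<Rightarrow> real"
  assumes M: "finite_measure M" and G: "finite G" and meas: "\<And>g. g \<in> G \<Longrightarrow> h g \<in> borel_measurable M"
    and bdd: "\<And>g x. g \<in> G \<Longrightarrow> x \<in> space M \<Longrightarrow> \<bar>h g x\<bar> \<le> C" and E: "E \<in> sets M" and \<epsilon>: "\<epsilon> > 0"
  obtains I w where "finite I" "I \<subseteq> E" "\<forall>x. w x \<ge> 0" "(\<Sum>x\<in>I. w x) = measure M E"
    "\<forall>g\<in>G. \<bar>(\<Sum>x\<in>I. w x * h g x) - (\<integral>x. h g x * indicator E x \<partial>M)\<bar> \<le> \<epsilon> * measure M E"
proof -
  interpret finite_measure M by (rule M)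
  define \<kappa> where "\<kappa> x = (\<lambda>g. if g \<in> G then \<lfloor>h g x / \<epsilon>\<rfloor> else 0)" for x
  have ES: "E \<subseteq> space M" using E by (rule sets.sets_into_space)
  have fin: "finite (\<kappa> ` E)"
  proof (rule finite_subset)
    show "\<kappa> ` E \<subseteq> {\<phi>. \<forall>g. (g \<in> G \<longrightarrow> \<phi> g \<in> {\<lfloor>- C / \<epsilon>\<rfloor>..\<lfloor>C / \<epsilon>\<rfloor>}) \<and> (g \<notin> G \<longrightarrow> \<phi> g = 0)}"
    proof (rule image_subsetI)
      fix x assume x: "x \<in> E"
      have "\<lfloor>- C / \<epsilon>\<rfloor> \<le> \<lfloor>h g x / \<epsilon>\<rfloor> \<and> \<lfloor>h g x / \<epsilon>\<rfloor> \<le> \<lfloor>C / \<epsilon>\<rfloor>" if g: "g \<in> G" for g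
      proof -
        have "- C \<le> h g x" "h g x \<le> C" using bdd[OF g, of x] x ES by (auto simp: abs_le_iff)
        then show ?thesis using \<epsilon> by (intro conjI floor_mono divide_right_mono) auto
      qed
      then show "\<kappa> x \<in> {\<phi>. \<forall>g. (g \<in> G \<longrightarrow> \<phi> g \<in> {\<lfloor>- C / \<epsilon>\<rfloor>..\<lfloor>C / \<epsilon>\<rfloor>}) \<and> (g \<notin> G \<longrightarrow> \<phi> g = 0)}"
        by (auto simp: \<kappa>_def)
    qed
    show "finite {\<phi>. \<forall>g. (g \<in> G \<longrightarrow> \<phi> g \<in> {\<lfloor>- C / \<epsilon>\<rfloor>..\<lfloor>C / \<epsilon>\<rfloor>}) \<and> (g \<notin> G \<longrightarrow> \<phi> g = 0)}"
      by (rule finite_set_of_finite_funs[OF G]) simp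
  qed
  define P where "P k = {x \<in> E. \<kappa> x = k}" for k
  have Pm: "P k \<in> sets M" if k: "k \<in> \<kappa> ` E" for k
  proof -
    obtain x0 where x0: "x0 \<in> E" "k = \<kappa> x0" using k by blast
    have "P k = E \<inter> (\<Inter>g\<in>G. {x \<in> space M. \<lfloor>h g x / \<epsilon>\<rfloor> = \<lfloor>h g x0 / \<epsilon>\<rfloor>}) \<inter> space M"
      using ES by (auto simp: P_def \<kappa>_def x0(2) fun_eq_iff)
    moreover have "{x \<in> space M. \<lfloor>h g x / \<epsilon>\<rfloor> = \<lfloor>h g x0 / \<epsilon>\<rfloor>} \<in> sets M" if "g \<in> G" for g
    proof -
      have [measurable]: "h g \<in> borel_measurable M" by (rule meas[OF that])
      show ?thesis by measurable
    qed
    then have "(\<Inter>g\<in>G. {x \<in> space M. \<lfloor>h g x / \<epsilon>\<rfloor> = \<lfloor>h g x0 / \<epsilon>\<rfloor>}) \<inter> space M \<in> sets M"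
      using G by (cases "G = {}") (auto intro!: sets.Int sets.finite_INT simp del: sets.Int_space_eq2)
    ultimately show ?thesis using E by (simp add: Int_assoc sets.Int)
  qed
  obtain r where r: "\<And>k. k \<in> \<kappa> ` E \<Longrightarrow> r k \<in> E" "\<And>k. k \<in> \<kappa> ` E \<Longrightarrow> \<kappa> (r k) = k"
  proof -
    have "\<forall>k\<in>\<kappa> ` E. \<exists>x. x \<in> E \<and> \<kappa> x = k" by blast
    from bchoice[OF this] show thesis using that by blast
  qed
  have inj: "inj_on r (\<kappa> ` E)" by (metis inj_onI r(2))
  have disj: "disjoint_family_on P (\<kappa> ` E)" by (auto simp: disjoint_family_on_def P_def)
  have UP: "(\<Union>k\<in>\<kappa> ` E. P k) = E" by (auto simp: P_def)
  define w where "w x = measure M (P (\<kappa> x))" for x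
  have wr: "w (r k) = measure M (P k)" if "k \<in> \<kappa> ` E" for k using r(2)[OF that] by (simp add: w_def)
  have mE: "measure M E = (\<Sum>k\<in>\<kappa> ` E. measure M (P k))"
    using finite_measure_finite_Union[OF fin _ disj] Pm UP by (metis (no_types, lifting) image_subsetI)
  show ?thesis
  proof (rule that[of "r ` \<kappa> ` E" w])
    show "finite (r ` \<kappa> ` E)" using fin by simp
    show "r ` \<kappa> ` E \<subseteq> E" using r(1) by blast
    show "\<forall>x. w x \<ge> 0" by (simp add: w_def)
    show "(\<Sum>x\<in>r ` \<kappa> ` E. w x) = measure M E"
      unfolding mE sum.reindex[OF inj] by (rule sum.cong) (auto simp: wr)
    show "\<forall>g\<in>G. \<bar>(\<Sum>x\<in>r ` \<kappa> ` E. w x * h g x) - (\<integral>x. h g x * indicator E x \<partial>M)\<bar> \<le> \<epsilon> * measure M E"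
    proof
    fix g assume g: "g \<in> G"
    have [measurable]: "h g \<in> borel_measurable M" by (rule meas[OF g])
    have int: "integrable M (\<lambda>x. h g x * indicator A x)" if "A \<in> sets M" for A
    proof (rule integrable_const_bound[where B = "\<bar>C\<bar>"])
      show "AE x in M. norm (h g x * indicator A x) \<le> \<bar>C\<bar>"
        by (rule AE_I2) (use bdd[OF g] in \<open>force simp: indicator_def\<close>)
    qed (use that in measurable)
    have ind: "indicator E x = (\<Sum>k\<in>\<kappa> ` E. indicator (P k) x :: real)" for x
      using indicator_UN_disjoint[OF fin disj, of x] UP by simp
    have split: "(\<integral>x. h g x * indicator E x \<partial>M) = (\<Sum>k\<in>\<kappa> ` E. \<integral>x. h g x * indicator (P k) x \<partial>M)"
      unfolding ind sum_distrib_left by (rule Bochner_Integration.integral_sum) (rule int[OF Pm])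
    have each: "\<bar>w (r k) * h g (r k) - (\<integral>x. h g x * indicator (P k) x \<partial>M)\<bar> \<le> \<epsilon> * measure M (P k)"
      if k: "k \<in> \<kappa> ` E" for k
    proof -
      have ic: "integrable M (\<lambda>x. c * indicator (P k) x :: real)" for c
        using Pm[OF k] by (intro integrable_mult_right integrable_real_indicator) (auto simp: less_top[symmetric])
      have "w (r k) * h g (r k) - (\<integral>x. h g x * indicator (P k) x \<partial>M) =
         (\<integral>x. h g (r k) * indicator (P k) x - h g x * indicator (P k) x \<partial>M)"
        using Pm[OF k] by (subst Bochner_Integration.integral_diff[OF ic int[OF Pm[OF k]]])
          (simp add: wr[OF k] mult.commute)
      also have "\<bar>\<dots>\<bar> \<le> (\<integral>x. \<bar>h g (r k) * indicator (P k) x - h g x * indicator (P k) x\<bar> \<partial>M)"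
        by (rule integral_abs_bound)
      also have "\<dots> \<le> (\<integral>x. \<epsilon> * indicator (P k) x \<partial>M)"
      proof (rule integral_mono)
        show "integrable M (\<lambda>x. \<bar>h g (r k) * indicator (P k) x - h g x * indicator (P k) x\<bar>)"
          by (intro integrable_abs Bochner_Integration.integrable_diff ic int Pm k)
        show "integrable M (\<lambda>x. \<epsilon> * indicator (P k) x)" by (rule ic)
        fix x assume "x \<in> space M"
        show "\<bar>h g (r k) * indicator (P k) x - h g x * indicator (P k) x\<bar> \<le> \<epsilon> * indicator (P k) x"
        proof (cases "x \<in> P k")
          case True
          have fl: "\<bar>a - b\<bar> \<le> 1" if "\<lfloor>a\<rfloor> = \<lfloor>b\<rfloor>" for a b :: real
            using that by linarith
          have "\<kappa> (r k) g = \<kappa> x g" using True r(2)[OF k] by (simp add: P_def)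
          then have "\<lfloor>h g (r k) / \<epsilon>\<rfloor> = \<lfloor>h g x / \<epsilon>\<rfloor>" by (simp only: \<kappa>_def g if_True)
          then have "\<bar>h g (r k) / \<epsilon> - h g x / \<epsilon>\<bar> \<le> 1" by (rule fl)
          then have "\<bar>h g (r k) - h g x\<bar> / \<epsilon> \<le> 1"
            by (simp only: diff_divide_distrib[symmetric] abs_div_pos[OF \<epsilon>])
          then have "\<bar>h g (r k) - h g x\<bar> \<le> \<epsilon>" using \<epsilon> by (simp add: divide_le_eq)
          then show ?thesis using True by simp
        qed simp
      qed
      also have "\<dots> = \<epsilon> * measure M (P k)" using Pm[OF k] by simp
      finally show ?thesis .
    qed
    have "(\<Sum>x\<in>r ` \<kappa> ` E. w x * h g x) = (\<Sum>k\<in>\<kappa> ` E. w (r k) * h g (r k))"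
      unfolding sum.reindex[OF inj] by (simp add: o_def)
    then have "\<bar>(\<Sum>x\<in>r ` \<kappa> ` E. w x * h g x) - (\<integral>x. h g x * indicator E x \<partial>M)\<bar> =
      \<bar>\<Sum>k\<in>\<kappa> ` E. w (r k) * h g (r k) - (\<integral>x. h g x * indicator (P k) x \<partial>M)\<bar>"
      unfolding split by (simp add: sum_subtractf)
    also have "\<dots> \<le> (\<Sum>k\<in>\<kappa> ` E. \<bar>w (r k) * h g (r k) - (\<integral>x. h g x * indicator (P k) x \<partial>M)\<bar>)"
      by (rule sum_abs)
    also have "\<dots> \<le> (\<Sum>k\<in>\<kappa> ` E. \<epsilon> * measure M (P k))" by (rule sum_mono) (rule each)
    also have "\<dots> = \<epsilon> * measure M E" by (simp add: mE sum_distrib_left)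
    finally show "\<bar>(\<Sum>x\<in>r ` \<kappa> ` E. w x * h g x) - (\<integral>x. h g x * indicator E x \<partial>M)\<bar> \<le> \<epsilon> * measure M E" .
    qed
  qed
qed

section \<open>Borel sets of the sphere\<close>

lemma space_sphere_borel [simp]: "space sphere_borel = UNIV"
  by (simp add: sphere_borel_def)

lemma sets_sphere_borel: "sets sphere_borel = sigma_sets UNIV {U. openin sphere_topology U}"
  by (simp add: sphere_borel_def sets_measure_of)

lemma openin_sphere_borel: "openin sphere_topology U \<Longrightarrow> U \<in> sets sphere_borel"
  by (simp add: sets_sphere_borel sigma_sets.Basic)

lemma closedin_sphere_borel: "closedin sphere_topology U \<Longrightarrow> U \<in> sets sphere_borel"
  using openin_sphere_borel[of "- U"] sets.compl_sets[of "- U" sphere_borel]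
  by (simp add: closedin_sphere_Compl Compl_eq_Diff_UNIV[symmetric])

lemma measurable_sphere_continuous:
  assumes "continuous_map sphere_topology sphere_topology f"
  shows "f \<in> measurable sphere_borel sphere_borel"
proof (rule measurable_sigma_sets[OF sets_sphere_borel])
  show "f -` U \<inter> space sphere_borel \<in> sets sphere_borel" if "U \<in> {U. openin sphere_topology U}" for U
    using openin_continuous_map_preimage[OF assms, of U] that
    by (intro openin_sphere_borel) (simp add: vimage_def)
qed auto

lemma borel_measurable_sphere_continuous:
  assumes "continuous_map sphere_topology euclideanreal g"
  shows "g \<in> borel_measurable sphere_borel"
proof (rule borel_measurableI)
  show "g -` S \<inter> space sphere_borel \<in> sets sphere_borel" if "open S" for S
    using openin_continuous_map_preimage[OF assms, of S] that
    by (intro openin_sphere_borel) (simp add: vimage_def)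
qed

section \<open>Invariant measures as weighted families of segments\<close>

context expanding_map
begin

lemma invariant_measuresD:
  assumes "\<mu> \<in> invariant_measures F"
  shows "prob_space \<mu>" "sets \<mu> = sets sphere_borel" "space \<mu> = UNIV"
    "distr \<mu> sphere_borel (F ^^ n) = \<mu>"
proof -
  show 1: "prob_space \<mu>" and 2: "sets \<mu> = sets sphere_borel"
    using assms by (auto simp: invariant_measures_def sphere_prob_measures_def)
  show "space \<mu> = UNIV" using sets_eq_imp_space_eq[OF 2] by simp
  have d1: "distr \<mu> sphere_borel F = \<mu>" using assms by (simp add: invariant_measures_def)
  have mF: "f \<in> measurable \<mu> sphere_borel" if "f \<in> measurable sphere_borel sphere_borel" for f
    using that measurable_cong_sets[OF 2 refl] by blast
  show "distr \<mu> sphere_borel (F ^^ n) = \<mu>"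
  proof (induction n)
    case 0
    have "distr \<mu> sphere_borel (\<lambda>x. x) = \<mu>" by (rule distr_id2) (simp add: 2)
    then show ?case by (simp add: id_def)
  next
    case (Suc n)
    have "distr \<mu> sphere_borel (F ^^ Suc n) = distr \<mu> sphere_borel (F \<circ> F ^^ n)" by simp
    also have "\<dots> = distr (distr \<mu> sphere_borel (F ^^ n)) sphere_borel F"
      by (rule distr_distr[OF measurable_sphere_continuous[OF cont_F]
            mF[OF measurable_sphere_continuous[OF cont_funpow]], symmetric])
    finally show ?case by (simp only: Suc d1)
  qed
qed

lemma invariant_measure:
  assumes "\<mu> \<in> invariant_measures F" "A \<in> sets sphere_borel"
  shows "measure \<mu> {x. (F ^^ n) x \<in> A} = measure \<mu> A"
proof -
  note D = invariant_measuresD[OF assms(1)]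
  have m: "F ^^ n \<in> measurable \<mu> sphere_borel"
    using measurable_sphere_continuous[OF cont_funpow] measurable_cong_sets[OF D(2) refl] by blast
  have "measure \<mu> A = measure (distr \<mu> sphere_borel (F ^^ n)) A" by (simp add: D(4))
  also have "\<dots> = measure \<mu> ((F ^^ n) -` A \<inter> space \<mu>)" by (rule measure_distr[OF m assms(2)])
  finally show ?thesis by (simp add: D(3) vimage_def)
qed

lemma integrable_continuous:
  assumes "\<mu> \<in> invariant_measures F" "continuous_map sphere_topology euclideanreal g"
  shows "integrable \<mu> g"
proof -
  note D = invariant_measuresD[OF assms(1)]
  interpret prob_space \<mu> by (rule D(1))
  obtain C where C: "\<And>x. \<bar>g x\<bar> \<le> C" using continuous_map_sphere_bounded[OF assms(2)] by blast
  have "g \<in> borel_measurable \<mu>"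
    using borel_measurable_sphere_continuous[OF assms(2)] measurable_cong_sets[OF D(2) refl] by blast
  then show ?thesis by (intro integrable_const_bound[where B = C]) (use C in auto)
qed

lemma cont_comp_funpow:
  assumes "continuous_map sphere_topology euclideanreal g"
  shows "continuous_map sphere_topology euclideanreal (\<lambda>x. g ((F ^^ n) x))"
  using continuous_map_compose[OF cont_funpow assms] by (simp add: o_def)

lemma integral_birkhoff_sum:
  assumes "\<mu> \<in> invariant_measures F" "continuous_map sphere_topology euclideanreal g"
  shows "(\<integral>x. birkhoff_sum F g n x \<partial>\<mu>) = real n * (\<integral>x. g x \<partial>\<mu>)"
proof -
  note D = invariant_measuresD[OF assms(1)]
  have inv: "(\<integral>x. g ((F ^^ i) x) \<partial>\<mu>) = (\<integral>x. g x \<partial>\<mu>)" for i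
  proof -
    have m: "F ^^ i \<in> measurable \<mu> sphere_borel"
      using measurable_sphere_continuous[OF cont_funpow] measurable_cong_sets[OF D(2) refl] by blast
    from integral_distr[OF m borel_measurable_sphere_continuous[OF assms(2)]]
    show ?thesis by (simp add: D(4))
  qed
  show ?thesis unfolding birkhoff_sum_def
    by (subst Bochner_Integration.integral_sum)
      (auto simp: inv intro!: integrable_continuous[OF assms(1)] cont_comp_funpow assms(2))
qed

lemma borel_measurable_birkhoff_sum:
  assumes "\<mu> \<in> invariant_measures F" "continuous_map sphere_topology euclideanreal g"
  shows "birkhoff_sum F g n \<in> borel_measurable \<mu>"
  unfolding birkhoff_sum_def[abs_def]
  by (intro borel_measurable_sum borel_measurable_integrable integrable_continuous[OF assms(1)]
      cont_comp_funpow assms(2))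

lemma invariant_measure_outside_compact:
  assumes \<mu>: "\<mu> \<in> invariant_measures F" and \<eta>: "\<eta> > 0"
  obtains K where "compact K" "K \<subseteq> Y" "measure \<mu> (Some ` Y - Some ` K) < \<eta>"
proof -
  note D = invariant_measuresD[OF \<mu>]
  interpret prob_space \<mu> by (rule D(1))
  obtain C :: "nat \<Rightarrow> complex set" where C: "\<And>n. compact (C n)" "\<And>n. C n \<subseteq> Y" "\<And>n. C n \<subseteq> interior (C (Suc n))"
    "\<Union> (range C) = Y" using open_Union_compact_subsets[OF open_Y] by metis
  have sC: "Some ` C n \<in> sets \<mu>" for n
    unfolding D(2) by (rule closedin_sphere_borel) (simp add: C(1))
  have inc: "incseq (\<lambda>n. Some ` C n)"
    by (rule incseq_SucI) (use C(3) interior_subset in blast)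
  have "(\<lambda>n. measure \<mu> (Some ` C n)) \<longlonglongrightarrow> measure \<mu> (\<Union>n. Some ` C n)"
    by (rule finite_Lim_measure_incseq[OF _ inc]) (use sC in auto)
  moreover have "(\<Union>n. Some ` C n) = Some ` Y" by (simp add: C(4)[symmetric] image_UN)
  ultimately have "(\<lambda>n. measure \<mu> (Some ` C n)) \<longlonglongrightarrow> measure \<mu> (Some ` Y)" by simp
  then obtain n where n: "dist (measure \<mu> (Some ` C n)) (measure \<mu> (Some ` Y)) < \<eta>"
    using \<eta> unfolding lim_sequentially by blast
  have "Some ` Y \<in> sets \<mu>" unfolding D(2) by (rule openin_sphere_borel) (simp add: open_Y)
  then have "measure \<mu> (Some ` Y - Some ` C n) = measure \<mu> (Some ` Y) - measure \<mu> (Some ` C n)"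
    by (rule finite_measure_Diff[OF _ sC]) (use C(2) in blast)
  then have "measure \<mu> (Some ` Y - Some ` C n) < \<eta>" using n by (simp add: dist_real_def)
  then show ?thesis using that C(1,2) by blast
qed

text \<open>By invariance \<open>g\<close> and its Birkhoff average \<open>A g\<close> over
  \<open>n\<close> steps have the same integral. The sphere splits into the set \<open>E\<close> of
  points that are in \<open>K0\<close> now and after \<open>n\<close> steps, whose orbit pieces are
  segments; the periodic part \<open>Z'\<close> of \<open>Z\<close>, whose cycles are imitated; and
  a set \<open>B\<close> of small mass. Over \<open>E\<close> the integral is replaced by a finite
  weighted sum, over \<open>Z'\<close> it is a sum over atoms. The set \<open>K\<close> is fixed
  before \<open>N\<close>, because the constants of \<open>closing\<close> depend on it.\<close>

lemma weighted_segments: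
  assumes \<mu>: "\<mu> \<in> invariant_measures F"
    and G: "finite G" "\<And>g. g \<in> G \<Longrightarrow> continuous_map sphere_topology euclideanreal g" and \<epsilon>: "\<epsilon> > 0"
  obtains K where "compact K" "K \<subseteq> Y"
    "\<forall>N. \<exists>J seg w. finite (J :: sphere set) \<and>
      (\<forall>j\<in>J. segment_in K (seg j) \<and> N < snd (seg j) \<and> 0 \<le> w j) \<and> \<bar>(\<Sum>j\<in>J. w j) - 1\<bar> \<le> \<epsilon> \<and>
      (\<forall>g\<in>G. \<bar>(\<Sum>j\<in>J. w j * (birkhoff_sum F g (snd (seg j)) (Some (fst (seg j))) / real (snd (seg j))))
         - (\<integral>x. g x \<partial>\<mu>)\<bar> \<le> \<epsilon>)"
proof -
  note D = invariant_measuresD[OF \<mu>]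
  interpret prob_space \<mu> by (rule D(1))
  obtain C where C: "C > 0" "\<And>g x. g \<in> G \<Longrightarrow> \<bar>g x\<bar> \<le> C" using finite_family_bounded[OF G] by blast
  \<comment> \<open>A quarter of \<epsilon> is spent on the approximation over \<open>E\<close> and
    \<open>Z'\<close>, and one half on \<open>B\<close>, whose mass is at most
    \<open>2 * \<eta>\<close>.\<close>
  define \<epsilon>1 where "\<epsilon>1 = \<epsilon> / 4"
  have \<epsilon>1: "\<epsilon>1 > 0" using \<epsilon> by (simp add: \<epsilon>1_def)
  define \<eta> where "\<eta> = \<epsilon> / (4 * (C + 1))"
  have \<eta>: "\<eta> > 0" using \<epsilon> C(1) by (simp add: \<eta>_def)
  have \<eta>C: "2 * \<eta> * C \<le> \<epsilon> / 2" "2 * \<eta> \<le> \<epsilon> / 2"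
    using \<epsilon> C(1) by (simp_all add: \<eta>_def field_simps)
  obtain R where R: "R > 0" "\<forall>x\<in>Z. (F ^^ R) ((F ^^ R) x) = (F ^^ R) x"
    using finite_selfmap_idempotent_power[OF finite_Z F_Z] by blast
  define Z' where "Z' = (F ^^ R) ` Z"
  have Z': "Z' \<subseteq> Z" "finite Z'" "\<And>p. p \<in> Z' \<Longrightarrow> (F ^^ R) p = p"
    using R(2) funpow_Z finite_Z by (auto simp: Z'_def)
  have sfin: "S \<in> sets \<mu>" if "finite S" for S
    unfolding D(2) by (intro closedin_sphere_borel closedin_sphere_finite that)
  \<comment> \<open>\<open>F ^^ R\<close> maps \<open>Z\<close> into \<open>Z'\<close>, so
    invariance bounds the mass of \<open>Z\<close> by that of \<open>Z'\<close>: an invariant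
    measure does not charge the points of \<open>Z\<close> that are not periodic.\<close>
  have mZ': "measure \<mu> (Z - Z') = 0"
  proof -
    have "measure \<mu> Z \<le> measure \<mu> {x. (F ^^ R) x \<in> Z'}"
    proof (rule finite_measure_mono)
      show "{x. (F ^^ R) x \<in> Z'} \<in> sets \<mu>"
        unfolding D(2)
        by (rule closedin_sphere_borel, unfold closedin_sphere_Compl)
          (use openin_funpow_vimage[of "- Z'" R] closedin_sphere_finite[OF Z'(2)] in
            \<open>simp add: closedin_sphere_Compl Collect_neg_eq[symmetric]\<close>)
    qed (auto simp: Z'_def)
    also have "\<dots> = measure \<mu> Z'" using sfin[OF Z'(2)] D(2) by (intro invariant_measure[OF \<mu>]) simp
    finally show ?thesis using finite_measure_Diff[OF sfin[OF finite_Z] sfin[OF Z'(2)] Z'(1)]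
      finite_measure_mono[OF Z'(1) sfin[OF finite_Z]] by simp
  qed
  have "\<forall>p\<in>Z'. \<exists>K. compact K \<and> K \<subseteq> Y \<and> (\<forall>n0. \<exists>x n. n0 \<le> n \<and> segment_in K (x, n) \<and>
      (\<forall>g\<in>G. \<bar>birkhoff_sum F g n (Some x) - real n * (birkhoff_sum F g R p / real R)\<bar> \<le> \<epsilon>1 * real n))"
  proof
    fix p assume "p \<in> Z'"
    then have "p \<in> Z" "(F ^^ R) p = p" using Z' by auto
    from periodic_segments[OF this(1) R(1) this(2) G \<epsilon>1]
    show "\<exists>K. compact K \<and> K \<subseteq> Y \<and> (\<forall>n0. \<exists>x n. n0 \<le> n \<and> segment_in K (x, n) \<and>
      (\<forall>g\<in>G. \<bar>birkhoff_sum F g n (Some x) - real n * (birkhoff_sum F g R p / real R)\<bar> \<le> \<epsilon>1 * real n))"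
      by metis
  qed
  then obtain KZ where KZ: "\<And>p. p \<in> Z' \<Longrightarrow> compact (KZ p) \<and> KZ p \<subseteq> Y"
    "\<And>p n0. p \<in> Z' \<Longrightarrow> \<exists>x n. n0 \<le> n \<and> segment_in (KZ p) (x, n) \<and>
      (\<forall>g\<in>G. \<bar>birkhoff_sum F g n (Some x) - real n * (birkhoff_sum F g R p / real R)\<bar> \<le> \<epsilon>1 * real n)"
    by metis
  obtain K0 where K0: "compact K0" "K0 \<subseteq> Y" "measure \<mu> (Some ` Y - Some ` K0) < \<eta>"
    by (rule invariant_measure_outside_compact[OF \<mu> \<eta>])
  define K where "K = K0 \<union> (\<Union>p\<in>Z'. KZ p)"
  show ?thesis
  proof (rule that[of K])
    show "compact K" unfolding K_def using K0(1) KZ(1) Z'(2) by (intro compact_Un compact_UN) auto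
    show "K \<subseteq> Y" unfolding K_def using K0(2) KZ(1) by blast
    show "\<forall>N. \<exists>J seg w. finite (J :: sphere set) \<and>
      (\<forall>j\<in>J. segment_in K (seg j) \<and> N < snd (seg j) \<and> 0 \<le> w j) \<and> \<bar>(\<Sum>j\<in>J. w j) - 1\<bar> \<le> \<epsilon> \<and>
      (\<forall>g\<in>G. \<bar>(\<Sum>j\<in>J. w j * (birkhoff_sum F g (snd (seg j)) (Some (fst (seg j))) / real (snd (seg j))))
         - (\<integral>x. g x \<partial>\<mu>)\<bar> \<le> \<epsilon>)"
    proof
    fix N
    \<comment> \<open>A multiple of \<open>R\<close>, so that the average over \<open>n\<close>
      steps at a point of \<open>Z'\<close> is exactly the average over its cycle; the factor
      \<open>Suc N\<close> makes it larger than \<open>N\<close>.\<close>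
    define n where "n = R * Suc N"
    have n: "n > N"
    proof -
      have "N < 1 * Suc N" by simp
      also have "\<dots> \<le> R * Suc N" by (rule mult_le_mono1) (use R(1) in simp)
      finally show ?thesis unfolding n_def .
    qed
    define A where "A g x = birkhoff_sum F g n x / real n" for g x
    have Am: "A g \<in> borel_measurable \<mu>" if "g \<in> G" for g
      unfolding A_def[abs_def] using borel_measurable_birkhoff_sum[OF \<mu> G(2)[OF that]] by (intro borel_measurable_divide) auto
    have Ab: "\<bar>A g x\<bar> \<le> C" if "g \<in> G" for g x
      using birkhoff_sum_bound[OF C(2)[OF that], where f = F and n = n and x = x] n by (simp add: A_def divide_le_eq)
    have Aint: "(\<integral>x. A g x \<partial>\<mu>) = (\<integral>x. g x \<partial>\<mu>)" if "g \<in> G" for g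
      using integral_birkhoff_sum[OF \<mu> G(2)[OF that], of n] n by (simp add: A_def)
    have sK0: "Some ` K0 \<in> sets sphere_borel" by (rule closedin_sphere_borel) (simp add: K0(1))
    have sYb: "Some ` Y \<in> sets sphere_borel" by (rule openin_sphere_borel) (simp add: open_Y)
    have spre: "{x. (F ^^ n) x \<in> S} \<in> sets \<mu>" if "S \<in> sets sphere_borel" for S
      using measurable_sets[OF measurable_sphere_continuous[OF cont_funpow[of n]] that] D(2)
      by (simp add: vimage_def)
    define E where "E = Some ` K0 \<inter> {x. (F ^^ n) x \<in> Some ` K0}"
    have sE: "E \<in> sets \<mu>" unfolding E_def using sK0 spre[OF sK0] D(2) by auto
    obtain I w1 where I: "finite I" "I \<subseteq> E" "\<forall>x. w1 x \<ge> 0" "(\<Sum>x\<in>I. w1 x) = measure \<mu> E"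
      "\<forall>g\<in>G. \<bar>(\<Sum>x\<in>I. w1 x * A g x) - (\<integral>x. A g x * indicator E x \<partial>\<mu>)\<bar> \<le> \<epsilon>1 * measure \<mu> E"
      by (rule integral_approx_points[OF finite_measure_axioms G(1) Am Ab sE \<epsilon>1])
    have EZ: "E \<inter> Z' = {}" using K0(2) Z'(1) by (auto simp: E_def Y_def)
    define B where "B = - (E \<union> Z')"
    have sB: "B \<in> sets \<mu>"
    proof -
      have "B = space \<mu> - (E \<union> Z')" by (auto simp: B_def D(3))
      then show ?thesis using sE sfin[OF Z'(2)] by (metis sets.Un sets.compl_sets)
    qed
    \<comment> \<open>A point of \<open>B\<close> is in \<open>Z - Z'\<close>, or in
      \<open>Y\<close> but not in \<open>K0\<close> now, or so after \<open>n\<close> steps, or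
      outside \<open>Z\<close> now and in \<open>Z\<close> after \<open>n\<close> steps. The first
      and the last set are null by invariance, the other two have mass less than \<eta>.\<close>
    have mB: "measure \<mu> B \<le> 2 * \<eta>"
    proof -
      let ?B2 = "Some ` Y - Some ` K0"
      let ?B3 = "{x. (F ^^ n) x \<in> ?B2}"
      let ?B4 = "{x. (F ^^ n) x \<in> Z} - Z"
      have s2: "?B2 \<in> sets \<mu>" using sK0 sYb D(2) by auto
      have s3: "?B3 \<in> sets \<mu>" by (rule spre) (use sK0 sYb in auto)
      have s4: "{x. (F ^^ n) x \<in> Z} \<in> sets \<mu>" by (rule spre) (use sfin[OF finite_Z] D(2) in simp)
      have m3: "measure \<mu> ?B3 < \<eta>"
        using invariant_measure[OF \<mu>, of ?B2 n] sK0 sYb K0(3) by auto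
      have m4: "measure \<mu> ?B4 = 0"
      proof -
        have "measure \<mu> ?B4 = measure \<mu> {x. (F ^^ n) x \<in> Z} - measure \<mu> Z"
          by (rule finite_measure_Diff[OF s4 sfin[OF finite_Z]]) (use funpow_Z in auto)
        then show ?thesis using invariant_measure[OF \<mu>, of Z n] sfin[OF finite_Z] D(2) by simp
      qed
      have "B \<subseteq> ((Z - Z') \<union> ?B2) \<union> (?B3 \<union> ?B4)"
      proof
        fix x assume x: "x \<in> B"
        show "x \<in> ((Z - Z') \<union> ?B2) \<union> (?B3 \<union> ?B4)"
        proof (cases "x \<in> Z")
          case True
          then show ?thesis using x by (auto simp: B_def)
        next
          case False
          have inY: "y \<in> Some ` Y" if "y \<notin> Z" for y
            using that Z_points by (cases y) (auto simp: Y_def)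
          show ?thesis
          proof (cases "x \<in> Some ` K0")
            case True
            then have "(F ^^ n) x \<notin> Some ` K0" using x by (auto simp: B_def E_def)
            then show ?thesis using inY[of "(F ^^ n) x"] False by blast
          qed (use inY[OF False] in blast)
        qed
      qed
      then have "measure \<mu> B \<le> measure \<mu> (((Z - Z') \<union> ?B2) \<union> (?B3 \<union> ?B4))"
        by (rule finite_measure_mono) (use s2 s3 s4 sfin finite_Z Z'(2) in auto)
      also have "\<dots> \<le> measure \<mu> ((Z - Z') \<union> ?B2) + measure \<mu> (?B3 \<union> ?B4)"
        by (rule measure_Un_le) (use s2 s3 s4 sfin finite_Z Z'(2) in auto)
      also have "\<dots> \<le> (measure \<mu> (Z - Z') + measure \<mu> ?B2) + (measure \<mu> ?B3 + measure \<mu> ?B4)"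
        by (intro add_mono measure_Un_le) (use s2 s3 s4 sfin finite_Z Z'(2) in auto)
      also have "\<dots> \<le> 2 * \<eta>" using mZ' m3 m4 K0(3) by simp
      finally show ?thesis .
    qed
    have mZs: "measure \<mu> Z' = (\<Sum>p\<in>Z'. measure \<mu> {p})"
      by (rule measure_eq_sum_singleton[OF Z'(2)]) (use sfin in auto)
    have m1: "measure \<mu> E + measure \<mu> Z' + measure \<mu> B = 1"
    proof -
      have "measure \<mu> (E \<union> Z') = measure \<mu> E + measure \<mu> Z'"
        by (rule finite_measure_Union[OF sE sfin[OF Z'(2)] EZ])
      moreover have "measure \<mu> B = 1 - measure \<mu> (E \<union> Z')"
        using prob_compl[of "E \<union> Z'"] sE sfin[OF Z'(2)] D(3) by (simp add: B_def Compl_eq_Diff_UNIV)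
      ultimately show ?thesis by simp
    qed
    have "\<forall>p\<in>Z'. \<exists>q. N < snd q \<and> segment_in (KZ p) q \<and>
      (\<forall>g\<in>G. \<bar>birkhoff_sum F g (snd q) (Some (fst q)) - real (snd q) * (birkhoff_sum F g R p / real R)\<bar> \<le> \<epsilon>1 * real (snd q))"
    proof
      fix p assume p: "p \<in> Z'"
      obtain x m where "Suc N \<le> m" "segment_in (KZ p) (x, m)"
        "\<forall>g\<in>G. \<bar>birkhoff_sum F g m (Some x) - real m * (birkhoff_sum F g R p / real R)\<bar> \<le> \<epsilon>1 * real m"
        using KZ(2)[OF p, of "Suc N"] by auto
      then show "\<exists>q. N < snd q \<and> segment_in (KZ p) q \<and>
      (\<forall>g\<in>G. \<bar>birkhoff_sum F g (snd q) (Some (fst q)) - real (snd q) * (birkhoff_sum F g R p / real R)\<bar> \<le> \<epsilon>1 * real (snd q))"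
        by (intro exI[of _ "(x, m)"]) auto
    qed
    then obtain sZ where sZ: "\<And>p. p \<in> Z' \<Longrightarrow> N < snd (sZ p) \<and> segment_in (KZ p) (sZ p) \<and>
      (\<forall>g\<in>G. \<bar>birkhoff_sum F g (snd (sZ p)) (Some (fst (sZ p))) - real (snd (sZ p)) * (birkhoff_sum F g R p / real R)\<bar>
         \<le> \<epsilon>1 * real (snd (sZ p)))" by metis
    \<comment> \<open>A point of \<open>I\<close> starts its own segment of length \<open>n\<close>,
      whereas a point of \<open>Z'\<close> is represented by the segment that imitates its cycle, of
      unrelated length. Averages are therefore normalised by the length of each segment.\<close>
    define seg where "seg x = (if x \<in> Z' then sZ x else (the x, n))" for x
    define w where "w x = (if x \<in> Z' then measure \<mu> {x} else w1 x)" for x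
    have IZ: "I \<inter> Z' = {}" using I(2) EZ by blast
    have J: "finite (I \<union> Z')" using I(1) Z'(2) by simp
    have sums: "(\<Sum>j\<in>I \<union> Z'. \<phi> j) = (\<Sum>j\<in>I. \<phi> j) + (\<Sum>j\<in>Z'. \<phi> j)" for \<phi> :: "sphere \<Rightarrow> real"
      by (rule sum.union_disjoint[OF I(1) Z'(2) IZ])
    have nZ: "j \<notin> Z'" if "j \<in> I" for j using that IZ by blast
    have jI: "j = Some (the j)" "the j \<in> K0" "(F ^^ n) j \<in> Some ` K0" if "j \<in> I" for j
      using that I(2) by (auto simp: E_def)
    have "\<forall>j\<in>I \<union> Z'. segment_in K (seg j) \<and> N < snd (seg j) \<and> 0 \<le> w j"
    proof
      fix j assume j: "j \<in> I \<union> Z'"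
      show "segment_in K (seg j) \<and> N < snd (seg j) \<and> 0 \<le> w j"
      proof (cases "j \<in> Z'")
        case True
        then have "segment_in K (sZ j)" using sZ[OF True] by (auto intro: segment_in_mono simp: K_def)
        then show ?thesis using True sZ[OF True] by (simp add: seg_def w_def)
      next
        case False
        then have jj: "j \<in> I" using j by simp
        have "segment_in K0 (the j, n)" using jI[OF jj] by (simp add: segment_in_def)
        then have "segment_in K (the j, n)" by (rule segment_in_mono) (auto simp: K_def)
        then show ?thesis using False n I(3) by (simp add: seg_def w_def)
      qed
    qed
    moreover have "\<bar>(\<Sum>j\<in>I \<union> Z'. w j) - 1\<bar> \<le> \<epsilon>"
    proof -
      have "(\<Sum>j\<in>I. w j) = measure \<mu> E" using I(4) nZ by (simp add: w_def)
      moreover have "(\<Sum>j\<in>Z'. w j) = measure \<mu> Z'" unfolding mZs by (simp add: w_def)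
      ultimately have "(\<Sum>j\<in>I \<union> Z'. w j) - 1 = - measure \<mu> B" unfolding sums using m1 by simp
      then show ?thesis using mB \<eta>C(2) \<epsilon> measure_nonneg[of \<mu> B] by simp
    qed
    moreover have "\<bar>(\<Sum>j\<in>I \<union> Z'. w j * (birkhoff_sum F g (snd (seg j)) (Some (fst (seg j))) / real (snd (seg j))))
         - (\<integral>x. g x \<partial>\<mu>)\<bar> \<le> \<epsilon>" if g: "g \<in> G" for g
    proof -
      define \<phi> where "\<phi> j = w j * (birkhoff_sum F g (snd (seg j)) (Some (fst (seg j))) / real (snd (seg j)))" for j
      have meas: "A g \<in> borel_measurable \<mu>" by (rule Am[OF g])
      have int: "integrable \<mu> (\<lambda>x. A g x * indicator S x)" if "S \<in> sets \<mu>" for S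
        by (rule integrable_const_bound[where B = C])
          (use Ab[OF g] C(1) that meas in \<open>auto simp: indicator_def\<close>)
      have sI: "(\<Sum>j\<in>I. \<phi> j) = (\<Sum>j\<in>I. w1 j * A g j)"
        by (rule sum.cong) (use nZ jI(1) in \<open>auto simp: \<phi>_def w_def seg_def A_def\<close>)
      have AZ: "A g p = birkhoff_sum F g R p / real R" if p: "p \<in> Z'" for p
      proof -
        have per: "(F ^^ (R * j)) p = p" for j
          by (induction j) (use Z'(3)[OF p] in \<open>auto simp: funpow_add\<close>)
        have "\<bar>birkhoff_sum F g (R * Suc N) p - real (Suc N) * birkhoff_sum F g R p\<bar> \<le> real (Suc N) * 0"
          by (rule birkhoff_sum_shadow_periodic) (simp add: per)
        then have e: "birkhoff_sum F g (R * Suc N) p = real (Suc N) * birkhoff_sum F g R p"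
          by (simp del: of_nat_Suc mult_Suc_right)
        show ?thesis unfolding A_def n_def e of_nat_mult using R(1) by (simp add: field_simps del: of_nat_Suc)
      qed
      have iZ: "(\<integral>x. A g x * indicator Z' x \<partial>\<mu>) = (\<Sum>p\<in>Z'. measure \<mu> {p} * A g p)"
      proof -
        have ind: "A g x * indicator Z' x = (\<Sum>p\<in>Z'. A g p * indicator {p} x)" for x
        proof (cases "x \<in> Z'")
          case True
          have "(\<Sum>p\<in>Z'. A g p * indicator {p} x) = (\<Sum>p\<in>Z'. if p = x then A g x else 0)"
            by (rule sum.cong) (auto simp: indicator_def)
          then show ?thesis using True Z'(2) by simp
        next
          case False
          have "(\<Sum>p\<in>Z'. A g p * indicator {p} x) = 0"
            by (rule sum.neutral) (use False in \<open>auto simp: indicator_def\<close>)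
          moreover have "indicator Z' x = (0::real)" using False by simp
          ultimately show ?thesis by (simp only: mult_zero_right)
        qed
        have ip: "integrable \<mu> (\<lambda>x. A g p * indicator {p} x)" for p
          using sfin[of "{p}"] by (intro integrable_mult_right integrable_real_indicator) (auto simp: less_top[symmetric])
        show ?thesis unfolding ind
          by (subst Bochner_Integration.integral_sum[OF ip]) (use sfin in \<open>auto simp: mult.commute intro!: sum.cong\<close>)
      qed
      have eZ: "\<bar>(\<Sum>j\<in>Z'. \<phi> j) - (\<Sum>p\<in>Z'. measure \<mu> {p} * A g p)\<bar> \<le> \<epsilon>1 * measure \<mu> Z'"
      proof -
        have "\<bar>\<phi> p - measure \<mu> {p} * A g p\<bar> \<le> measure \<mu> {p} * \<epsilon>1" if p: "p \<in> Z'" for p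
        proof -
          define m where "m = snd (sZ p)"
          define b where "b = birkhoff_sum F g m (Some (fst (sZ p)))"
          have m: "real m > 0" using sZ[OF p] by (simp add: m_def)
          have "\<bar>b - real m * A g p\<bar> \<le> \<epsilon>1 * real m" using sZ[OF p] g AZ[OF p] by (simp add: b_def m_def)
          then have "\<bar>b - real m * A g p\<bar> / real m \<le> \<epsilon>1" using m by (simp add: divide_le_eq)
          also have "\<bar>b - real m * A g p\<bar> / real m = \<bar>b / real m - A g p\<bar>"
            using m by (simp add: abs_div_pos diff_divide_distrib)
          finally have 1: "\<bar>b / real m - A g p\<bar> \<le> \<epsilon>1" .
          have "\<phi> p - measure \<mu> {p} * A g p = measure \<mu> {p} * (b / real m - A g p)"
            using p by (simp add: \<phi>_def w_def seg_def b_def m_def algebra_simps)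
          then have "\<bar>\<phi> p - measure \<mu> {p} * A g p\<bar> = measure \<mu> {p} * \<bar>b / real m - A g p\<bar>"
            by (simp add: abs_mult)
          then show ?thesis using 1 by (simp add: mult_left_mono)
        qed
        then have "(\<Sum>p\<in>Z'. \<bar>\<phi> p - measure \<mu> {p} * A g p\<bar>) \<le> (\<Sum>p\<in>Z'. measure \<mu> {p} * \<epsilon>1)"
          by (rule sum_mono)
        moreover have "(\<Sum>p\<in>Z'. measure \<mu> {p} * \<epsilon>1) = \<epsilon>1 * measure \<mu> Z'"
          unfolding mZs by (simp add: sum_distrib_left mult.commute)
        moreover have "\<bar>(\<Sum>j\<in>Z'. \<phi> j) - (\<Sum>p\<in>Z'. measure \<mu> {p} * A g p)\<bar> \<le> (\<Sum>p\<in>Z'. \<bar>\<phi> p - measure \<mu> {p} * A g p\<bar>)"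
          unfolding sum_subtractf[symmetric] by (rule sum_abs)
        ultimately show ?thesis by linarith
      qed
      have eB: "\<bar>\<integral>x. A g x * indicator B x \<partial>\<mu>\<bar> \<le> 2 * \<eta> * C"
      proof -
        have "\<bar>\<integral>x. A g x * indicator B x \<partial>\<mu>\<bar> \<le> (\<integral>x. \<bar>A g x * indicator B x\<bar> \<partial>\<mu>)" by (rule integral_abs_bound)
        also have "\<dots> \<le> (\<integral>x. C * indicator B x \<partial>\<mu>)"
        proof (rule integral_mono)
          show "integrable \<mu> (\<lambda>x. C * indicator B x)"
            using sB by (intro integrable_mult_right integrable_real_indicator) (auto simp: less_top[symmetric])
          show "integrable \<mu> (\<lambda>x. \<bar>A g x * indicator B x\<bar>)" by (intro integrable_abs int sB)
        qed (use Ab[OF g] in \<open>auto simp: indicator_def\<close>)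
        also have "\<dots> = C * measure \<mu> B" using sB by simp
        also have "\<dots> \<le> C * (2 * \<eta>)" using mB C(1) by (intro mult_left_mono) auto
        finally show ?thesis by (simp add: algebra_simps)
      qed
      have total: "(\<integral>x. g x \<partial>\<mu>) = (\<integral>x. A g x * indicator E x \<partial>\<mu>) + (\<Sum>p\<in>Z'. measure \<mu> {p} * A g p) + (\<integral>x. A g x * indicator B x \<partial>\<mu>)"
      proof -
        have "A g x = A g x * indicator E x + A g x * indicator Z' x + A g x * indicator B x" for x
          using EZ by (auto simp: B_def indicator_def)
        then have "(\<integral>x. A g x \<partial>\<mu>) = (\<integral>x. A g x * indicator E x + A g x * indicator Z' x + A g x * indicator B x \<partial>\<mu>)"
          by (rule Bochner_Integration.integral_cong[OF refl])
        also have "\<dots> = (\<integral>x. A g x * indicator E x \<partial>\<mu>) + (\<integral>x. A g x * indicator Z' x \<partial>\<mu>) + (\<integral>x. A g x * indicator B x \<partial>\<mu>)"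
          by (simp add: int sE sB sfin[OF Z'(2)])
        finally show ?thesis using Aint[OF g] iZ by simp
      qed
      have mle: "\<epsilon>1 * measure \<mu> E + \<epsilon>1 * measure \<mu> Z' \<le> \<epsilon>1"
      proof -
        have "measure \<mu> E + measure \<mu> Z' \<le> 1" using m1 measure_nonneg[of \<mu> B] by linarith
        then have "\<epsilon>1 * (measure \<mu> E + measure \<mu> Z') \<le> \<epsilon>1 * 1" using \<epsilon>1 by (intro mult_left_mono) auto
        then show ?thesis by (simp add: algebra_simps)
      qed
      have "\<bar>(\<Sum>j\<in>I. \<phi> j) + (\<Sum>j\<in>Z'. \<phi> j) - (\<integral>x. g x \<partial>\<mu>)\<bar> \<le> \<epsilon>1 + \<epsilon> / 2"
        unfolding total sI using I(5)[rule_format, OF g] eZ eB \<eta>C(1) mle by linarith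
      then show ?thesis unfolding \<phi>_def[symmetric] sums using \<epsilon> by (simp add: \<epsilon>1_def)
    qed
    ultimately show "\<exists>J seg w. finite (J :: sphere set) \<and>
      (\<forall>j\<in>J. segment_in K (seg j) \<and> N < snd (seg j) \<and> 0 \<le> w j) \<and> \<bar>(\<Sum>j\<in>J. w j) - 1\<bar> \<le> \<epsilon> \<and>
      (\<forall>g\<in>G. \<bar>(\<Sum>j\<in>J. w j * (birkhoff_sum F g (snd (seg j)) (Some (fst (seg j))) / real (snd (seg j))))
         - (\<integral>x. g x \<partial>\<mu>)\<bar> \<le> \<epsilon>)"
      using J by (intro exI[of _ "I \<union> Z'"] exI[of _ seg] exI[of _ w]) blast
    qed
  qed
qed

end

lemma sum_list_concat_replicate:
  fixes \<phi> :: "'b \<Rightarrow> real"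
  assumes "distinct js"
  shows "(\<Sum>p\<leftarrow>concat (map (\<lambda>j. replicate (m j) (seg j)) js). \<phi> p) = (\<Sum>j\<in>set js. real (m j) * \<phi> (seg j))"
  using assms by (induction js) (auto simp: sum_list_replicate)

context expanding_map
begin

text \<open>The segment of index \<open>j\<close> is repeated about
  \<open>Q * w j / real (n j)\<close> times, so that it fills time \<open>Q * w j\<close> out of a
  total close to \<open>Q\<close>. Closing the chain adds at most \<open>D\<close> per segment,
  which is negligible since segments are longer than \<open>D / \<delta>\<close>; rounding the
  multiplicities costs at most the sum \<open>s\<close> of all lengths, which is negligible for
  large \<open>Q\<close>.\<close>

theorem periodic_orbit_approximation:
  assumes \<mu>: "\<mu> \<in> invariant_measures F"
    and G: "finite G" "\<And>g. g \<in> G \<Longrightarrow> continuous_map sphere_topology euclideanreal g" and \<epsilon>: "\<epsilon> > 0"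
  shows "\<exists>y T. T > 0 \<and> (F ^^ T) y = y \<and>
    (\<forall>g\<in>G. \<bar>birkhoff_sum F g T y / real T - (\<integral>x. g x \<partial>\<mu>)\<bar> < \<epsilon>)"
proof -
  interpret prob_space \<mu> by (rule invariant_measuresD(1)[OF \<mu>])
  obtain C where C: "C > 0" "\<And>g x. g \<in> G \<Longrightarrow> \<bar>g x\<bar> \<le> C" using finite_family_bounded[OF G] by blast
  \<comment> \<open>In units of \<open>\<delta> * Q\<close> the errors are 4 from closing, 1 from
    rounding, 1 from the weighted sum, and \<open>4 * C\<close> from the difference of
    \<open>T\<close> and \<open>Q\<close>. Dividing by \<open>T\<close> costs a factor 2, since
    \<open>Q\<close> is at most twice \<open>T\<close>; the bound 1/4 on \<delta> ensures
    this.\<close>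
  define \<delta> where "\<delta> = min (1/4) (\<epsilon> / (4 * (6 + 4 * C)))"
  have \<delta>: "\<delta> > 0" "\<delta> \<le> 1/4"
  proof -
    show "\<delta> > 0" using \<epsilon> C(1) by (simp add: \<delta>_def)
    show "\<delta> \<le> 1/4" unfolding \<delta>_def by (rule min.cobounded1)
  qed
  have "\<delta> \<le> \<epsilon> / (4 * (6 + 4 * C))" by (simp add: \<delta>_def)
  then have \<delta>\<epsilon>: "2 * ((6 + 4 * C) * \<delta>) \<le> \<epsilon> / 2" using C(1) by (simp add: field_simps)
  obtain K where K: "compact K" "K \<subseteq> Y" and pieces: "\<forall>N. \<exists>J seg w. finite (J :: sphere set) \<and>
      (\<forall>j\<in>J. segment_in K (seg j) \<and> N < snd (seg j) \<and> 0 \<le> w j) \<and> \<bar>(\<Sum>j\<in>J. w j) - 1\<bar> \<le> \<delta> \<and>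
      (\<forall>g\<in>G. \<bar>(\<Sum>j\<in>J. w j * (birkhoff_sum F g (snd (seg j)) (Some (fst (seg j))) / real (snd (seg j))))
         - (\<integral>x. g x \<partial>\<mu>)\<bar> \<le> \<delta>)"
    by (rule weighted_segments[OF \<mu> G \<delta>(1)])
  obtain N D where D: "D \<ge> 0" and close: "\<forall>L. L \<noteq> [] \<and> (\<forall>p\<in>set L. segment_in K p \<and> N \<le> snd p) \<longrightarrow>
      (\<exists>y T. T > 0 \<and> (F ^^ T) y = y \<and> (\<Sum>p\<leftarrow>L. real (snd p)) \<le> real T \<and>
        real T \<le> (\<Sum>p\<leftarrow>L. real (snd p) + D) \<and>
        (\<forall>g\<in>G. \<bar>birkhoff_sum F g T y - (\<Sum>p\<leftarrow>L. birkhoff_sum F g (snd p) (Some (fst p)))\<bar>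
           \<le> (\<Sum>p\<leftarrow>L. \<delta> * real (snd p) + D)))"
    by (rule closing[OF K G \<delta>(1)])
  obtain J seg w where J: "finite (J :: sphere set)"
      "\<And>j. j \<in> J \<Longrightarrow> segment_in K (seg j) \<and> N + nat \<lceil>D / \<delta>\<rceil> < snd (seg j) \<and> 0 \<le> w j"
      "\<bar>(\<Sum>j\<in>J. w j) - 1\<bar> \<le> \<delta>"
      "\<And>g. g \<in> G \<Longrightarrow> \<bar>(\<Sum>j\<in>J. w j * (birkhoff_sum F g (snd (seg j)) (Some (fst (seg j))) / real (snd (seg j))))
         - (\<integral>x. g x \<partial>\<mu>)\<bar> \<le> \<delta>"
    using pieces[rule_format, of "N + nat \<lceil>D / \<delta>\<rceil>"] by blast
  define n where "n j = snd (seg j)" for j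
  have n0: "real (n j) > 0" and nN: "N \<le> n j" and nD: "D \<le> \<delta> * real (n j)" if j: "j \<in> J" for j
  proof -
    have 1: "N + nat \<lceil>D / \<delta>\<rceil> < n j" using J(2)[OF j] by (simp add: n_def)
    then show "real (n j) > 0" "N \<le> n j" by auto
    have "D / \<delta> \<le> real (nat \<lceil>D / \<delta>\<rceil>)" by (rule real_nat_ceiling_ge)
    also have "\<dots> \<le> real (n j)" by (rule of_nat_mono) (use 1 in linarith)
    finally show "D \<le> \<delta> * real (n j)" using \<delta>(1) by (simp add: divide_le_eq mult.commute)
  qed
  define s where "s = (\<Sum>j\<in>J. real (n j))"
  have s0: "s \<ge> 0" unfolding s_def by (rule sum_nonneg) simp
  \<comment> \<open>Large enough to dominate the rounding errors both in time, \<open>s\<close>, and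
    in Birkhoff sums, \<open>C * s\<close>.\<close>
  define Q where "Q = max 1 ((C + 1) * s / \<delta>)"
  have Q: "Q \<ge> 1" "(C + 1) * s \<le> \<delta> * Q"
  proof -
    show "Q \<ge> 1" by (simp add: Q_def)
    have "(C + 1) * s / \<delta> \<le> Q" by (simp add: Q_def)
    then show "(C + 1) * s \<le> \<delta> * Q" using \<delta>(1) by (simp add: divide_le_eq mult.commute)
  qed
  have sQ: "s \<le> \<delta> * Q" "C * s \<le> \<delta> * Q"
  proof -
    have "C * s \<ge> 0" using C(1) s0 by simp
    moreover have "(C + 1) * s = C * s + s" by (simp add: algebra_simps)
    ultimately show "s \<le> \<delta> * Q" "C * s \<le> \<delta> * Q" using Q(2) s0 by linarith+
  qed
  define m where "m j = nat \<lceil>Q * w j / real (n j)\<rceil>" for j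
  have m: "\<bar>real (m j) * real (n j) - Q * w j\<bar> \<le> real (n j)" if j: "j \<in> J" for j
  proof -
    have nn: "Q * w j / real (n j) \<ge> 0" using J(2)[OF j] Q(1) by simp
    then have "real (m j) \<ge> Q * w j / real (n j)" "real (m j) \<le> Q * w j / real (n j) + 1"
      unfolding m_def by linarith+
    then have "Q * w j \<le> real (m j) * real (n j)" "real (m j) * real (n j) \<le> Q * w j + real (n j)"
      using n0[OF j] by (simp_all add: field_simps)
    then show ?thesis using n0[OF j] by linarith
  qed
  obtain js where js: "set js = J" "distinct js" using finite_distinct_list[OF J(1)] by blast
  define L where "L = concat (map (\<lambda>j. replicate (m j) (seg j)) js)"
  have L: "(\<Sum>p\<leftarrow>L. \<phi> p) = (\<Sum>j\<in>J. real (m j) * \<phi> (seg j))" for \<phi> :: "complex \<times> nat \<Rightarrow> real"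
    unfolding L_def using sum_list_concat_replicate[OF js(2)] js(1) by simp
  define S where "S = (\<Sum>j\<in>J. real (m j) * real (n j))"
  have SL: "(\<Sum>p\<leftarrow>L. real (snd p)) = S" by (simp add: L S_def n_def)
  have "\<bar>S - Q * (\<Sum>j\<in>J. w j)\<bar> \<le> s"
  proof -
    have "S - Q * (\<Sum>j\<in>J. w j) = (\<Sum>j\<in>J. real (m j) * real (n j) - Q * w j)"
      by (simp add: S_def sum_subtractf sum_distrib_left)
    also have "\<bar>\<dots>\<bar> \<le> (\<Sum>j\<in>J. \<bar>real (m j) * real (n j) - Q * w j\<bar>)" by (rule sum_abs)
    also have "\<dots> \<le> s" unfolding s_def by (rule sum_mono) (rule m)
    finally show ?thesis .
  qed
  moreover have "\<bar>Q * (\<Sum>j\<in>J. w j) - Q\<bar> \<le> \<delta> * Q"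
  proof -
    have "Q * (\<Sum>j\<in>J. w j) - Q = Q * ((\<Sum>j\<in>J. w j) - 1)" by (simp add: algebra_simps)
    then have "\<bar>Q * (\<Sum>j\<in>J. w j) - Q\<bar> = Q * \<bar>(\<Sum>j\<in>J. w j) - 1\<bar>" using Q(1) by (simp add: abs_mult)
    also have "\<dots> \<le> Q * \<delta>" using J(3) Q(1) by (intro mult_left_mono) auto
    finally show ?thesis by (simp add: mult.commute)
  qed
  ultimately have SQ: "\<bar>S - Q\<bar> \<le> 2 * (\<delta> * Q)" using sQ(1) by linarith
  have dQ: "\<delta> * Q \<le> Q / 4" using \<delta>(2) Q(1) mult_right_mono[of \<delta> "1/4" Q] by simp
  have S2: "S \<ge> Q / 2" "S \<le> 2 * Q" using SQ dQ Q(1) by linarith+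
  have "L \<noteq> []"
  proof
    assume "L = []"
    then have "S = 0" using SL by simp
    then show False using S2 Q(1) by simp
  qed
  moreover have "segment_in K p \<and> N \<le> snd p" if "p \<in> set L" for p
    using that J(2) nN js(1) by (auto simp: L_def n_def)
  ultimately obtain y T where yT: "T > 0" "(F ^^ T) y = y" "S \<le> real T"
     "real T \<le> (\<Sum>p\<leftarrow>L. real (snd p) + D)"
     "\<And>g. g \<in> G \<Longrightarrow> \<bar>birkhoff_sum F g T y - (\<Sum>p\<leftarrow>L. birkhoff_sum F g (snd p) (Some (fst p)))\<bar>
           \<le> (\<Sum>p\<leftarrow>L. \<delta> * real (snd p) + D)"
    using close[rule_format, of L] unfolding SL by blast
  have LD: "(\<Sum>j\<in>J. real (m j) * D) \<le> \<delta> * S"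
  proof -
    have "(\<Sum>j\<in>J. real (m j) * D) \<le> (\<Sum>j\<in>J. real (m j) * (\<delta> * real (n j)))"
      by (intro sum_mono mult_left_mono nD) auto
    also have "\<dots> = \<delta> * S" by (simp add: S_def sum_distrib_left algebra_simps)
    finally show ?thesis .
  qed
  have dS: "\<delta> * S \<le> 2 * (\<delta> * Q)" using mult_left_mono[OF S2(2), of \<delta>] \<delta>(1) by simp
  have TS: "real T \<le> S + \<delta> * S"
  proof -
    have "(\<Sum>p\<leftarrow>L. real (snd p) + D) = S + (\<Sum>j\<in>J. real (m j) * D)"
      by (simp add: L S_def n_def sum.distrib algebra_simps)
    then show ?thesis using yT(4) LD by simp
  qed
  have TQ: "\<bar>real T - Q\<bar> \<le> 4 * (\<delta> * Q)" using TS yT(3) dS SQ by linarith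
  have err: "(\<Sum>p\<leftarrow>L. \<delta> * real (snd p) + D) \<le> 4 * (\<delta> * Q)"
  proof -
    have "(\<Sum>p\<leftarrow>L. \<delta> * real (snd p) + D) = \<delta> * S + (\<Sum>j\<in>J. real (m j) * D)"
      by (simp add: L S_def n_def sum.distrib sum_distrib_left algebra_simps)
    then show ?thesis using LD dS by linarith
  qed
  have "\<bar>birkhoff_sum F g T y / real T - (\<integral>x. g x \<partial>\<mu>)\<bar> < \<epsilon>" if g: "g \<in> G" for g
  proof -
    define I where "I = (\<integral>x. g x \<partial>\<mu>)"
    define b where "b j = birkhoff_sum F g (n j) (Some (fst (seg j)))" for j
    have "\<bar>I\<bar> \<le> C"
    proof -
      have "\<bar>I\<bar> \<le> (\<integral>x. \<bar>g x\<bar> \<partial>\<mu>)" unfolding I_def by (rule integral_abs_bound)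
      also have "\<dots> \<le> (\<integral>x. C \<partial>\<mu>)"
        by (rule integral_mono) (use integrable_continuous[OF \<mu> G(2)[OF g]] C(2)[OF g] in auto)
      finally show ?thesis by (simp add: prob_space)
    qed
    have 1: "\<bar>birkhoff_sum F g T y - (\<Sum>j\<in>J. real (m j) * b j)\<bar> \<le> 4 * (\<delta> * Q)"
      using yT(5)[OF g] err by (simp add: L b_def n_def)
    have 2: "\<bar>(\<Sum>j\<in>J. real (m j) * b j) - Q * (\<Sum>j\<in>J. w j * (b j / real (n j)))\<bar> \<le> \<delta> * Q"
    proof -
      have each: "\<bar>real (m j) * b j - Q * (w j * (b j / real (n j)))\<bar> \<le> C * real (n j)" if j: "j \<in> J" for j
      proof -
        have "\<bar>b j\<bar> \<le> C * real (n j)" unfolding b_def by (rule birkhoff_sum_bound[OF C(2)[OF g]])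
        then have bn: "\<bar>b j / real (n j)\<bar> \<le> C" using n0[OF j] by (simp add: divide_le_eq)
        have "real (m j) * b j - Q * (w j * (b j / real (n j))) =
            (b j / real (n j)) * (real (m j) * real (n j) - Q * w j)"
          using n0[OF j] by (simp add: field_simps)
        then have "\<bar>real (m j) * b j - Q * (w j * (b j / real (n j)))\<bar> =
            \<bar>b j / real (n j)\<bar> * \<bar>real (m j) * real (n j) - Q * w j\<bar>" by (simp only: abs_mult)
        also have "\<dots> \<le> C * real (n j)" using bn m[OF j] C(1) by (intro mult_mono) auto
        finally show ?thesis .
      qed
      have "(\<Sum>j\<in>J. real (m j) * b j) - Q * (\<Sum>j\<in>J. w j * (b j / real (n j))) =
         (\<Sum>j\<in>J. real (m j) * b j - Q * (w j * (b j / real (n j))))"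
        by (simp add: sum_subtractf sum_distrib_left)
      also have "\<bar>\<dots>\<bar> \<le> (\<Sum>j\<in>J. \<bar>real (m j) * b j - Q * (w j * (b j / real (n j)))\<bar>)" by (rule sum_abs)
      also have "\<dots> \<le> (\<Sum>j\<in>J. C * real (n j))" by (rule sum_mono) (rule each)
      also have "\<dots> = C * s" by (simp add: s_def sum_distrib_left)
      finally show ?thesis using sQ(2) by linarith
    qed
    have 3: "\<bar>Q * (\<Sum>j\<in>J. w j * (b j / real (n j))) - Q * I\<bar> \<le> \<delta> * Q"
    proof -
      have "\<bar>(\<Sum>j\<in>J. w j * (b j / real (n j))) - I\<bar> \<le> \<delta>" using J(4)[OF g] by (simp add: b_def n_def I_def)
      then have "Q * \<bar>(\<Sum>j\<in>J. w j * (b j / real (n j))) - I\<bar> \<le> Q * \<delta>" using Q(1) by (intro mult_left_mono) auto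
      moreover have "\<bar>Q * (\<Sum>j\<in>J. w j * (b j / real (n j))) - Q * I\<bar> = Q * \<bar>(\<Sum>j\<in>J. w j * (b j / real (n j))) - I\<bar>"
        using Q(1) by (simp add: abs_mult flip: right_diff_distrib)
      ultimately show ?thesis by (simp add: mult.commute)
    qed
    have 4: "\<bar>Q * I - real T * I\<bar> \<le> 4 * (C * (\<delta> * Q))"
    proof -
      have "\<bar>Q * I - real T * I\<bar> = \<bar>real T - Q\<bar> * \<bar>I\<bar>"
        by (simp add: abs_minus_commute flip: abs_mult left_diff_distrib)
      also have "\<dots> \<le> (4 * (\<delta> * Q)) * C" using TQ \<open>\<bar>I\<bar> \<le> C\<close> by (intro mult_mono) auto
      finally show ?thesis by (simp add: algebra_simps)
    qed
    have tot: "\<bar>birkhoff_sum F g T y - real T * I\<bar> \<le> (6 + 4 * C) * \<delta> * Q"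
    proof -
      have "(6 + 4 * C) * \<delta> * Q = 6 * (\<delta> * Q) + 4 * (C * (\<delta> * Q))" by (simp add: algebra_simps)
      then show ?thesis using 1 2 3 4 by linarith
    qed
    have TQ2: "Q \<le> 2 * real T" using S2(1) yT(3) by simp
    have T0: "real T > 0" using yT(1) by simp
    have "\<bar>birkhoff_sum F g T y / real T - I\<bar> = \<bar>birkhoff_sum F g T y - real T * I\<bar> / real T"
      using T0 by (simp add: abs_div_pos diff_divide_distrib)
    also have "\<dots> \<le> ((6 + 4 * C) * \<delta> * (2 * real T)) / real T"
    proof (rule divide_right_mono)
      have "(6 + 4 * C) * \<delta> * Q \<le> (6 + 4 * C) * \<delta> * (2 * real T)"
        using TQ2 C(1) \<delta>(1) by (intro mult_left_mono) auto
      then show "\<bar>birkhoff_sum F g T y - real T * I\<bar> \<le> (6 + 4 * C) * \<delta> * (2 * real T)" using tot by linarith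
    qed (use T0 in simp)
    also have "\<dots> = 2 * ((6 + 4 * C) * \<delta>)" using T0 by simp
    also have "\<dots> < \<epsilon>" using \<delta>\<epsilon> \<epsilon> by linarith
    finally show ?thesis by (simp add: I_def)
  qed
  then show ?thesis using yT(1,2) by blast
qed

end

section \<open>Derivatives on the sphere\<close>

lemma chart_chart_inv [simp]: "chart x (chart_inv x w) = w"
  by (cases x) (auto simp: chart_def chart_inv_def)

lemma chart_inv_chart_self [simp]: "chart_inv x (chart x x) = x"
  by (cases x) (auto simp: chart_def chart_inv_def)

lemma chart_self [simp]: "chart (Some z) (Some z) = z" "chart None None = 0"
  by (auto simp: chart_def)

text \<open>The neighbourhood filter of \<open>x\<close>, described through the coordinate instead
  of the one-point compactification; \<open>eventually_sphere_nhds_open\<close> shows that both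
  agree. Limits on the sphere thus reduce to limits in the plane.\<close>

definition sphere_nhds :: "sphere \<Rightarrow> sphere filter" where
  "sphere_nhds x = filtermap (chart_inv x) (nhds (chart x x))"

lemma eventually_sphere_nhds:
  "eventually P (sphere_nhds x) \<longleftrightarrow> eventually (\<lambda>w. P (chart_inv x w)) (nhds (chart x x))"
  by (simp add: sphere_nhds_def eventually_filtermap)

lemma eventually_sphere_nhds_open:
  "eventually P (sphere_nhds x) \<longleftrightarrow> (\<exists>U. openin sphere_topology U \<and> x \<in> U \<and> (\<forall>y\<in>U. P y))"
proof
  assume ev: "eventually P (sphere_nhds x)"
  then obtain S where S: "open S" "chart x x \<in> S" "\<And>w. w \<in> S \<Longrightarrow> P (chart_inv x w)"
    by (auto simp: eventually_sphere_nhds eventually_nhds)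
  show "\<exists>U. openin sphere_topology U \<and> x \<in> U \<and> (\<forall>y\<in>U. P y)"
  proof (cases x)
    case (Some z)
    then show ?thesis using S by (intro exI[of _ "Some ` S"]) (auto simp: chart_def chart_inv_def)
  next
    case None
    then have "0 \<in> S" using S(2) by (simp add: chart_def)
    then obtain r where r: "r > 0" "ball 0 r \<subseteq> S" using S(1) open_contains_ball by blast
    define U where "U = insert None (Some ` (UNIV - cball (0::complex) (1 / r)))"
    have "openin sphere_topology U"
      unfolding sphere_topology_def openin_Alexandroff_compactification U_def
      by (intro disjI2 exI[of _ "cball 0 (1 / r)"]) auto
    moreover have "P y" if y: "y \<in> U" for y
    proof (cases y)
      case None
      then show ?thesis using S(3)[OF \<open>0 \<in> S\<close>] \<open>x = None\<close> by (simp add: chart_inv_def)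
    next
      case (Some u)
      then have u: "norm u > 1 / r" using y by (auto simp: U_def)
      then have u0: "norm u > 0" using r(1) by (meson le_less_trans less_imp_le zero_less_divide_1_iff)
      then have "inverse (norm u) < r" using u r(1) by (simp add: field_simps)
      then have "inverse u \<in> S" using r(2) by (auto simp: norm_inverse)
      then have "P (chart_inv x (inverse u))" by (rule S(3))
      then show ?thesis using \<open>x = None\<close> Some u0 by (simp add: chart_inv_def)
    qed
    ultimately show ?thesis using None by (auto simp: U_def)
  qed
next
  assume "\<exists>U. openin sphere_topology U \<and> x \<in> U \<and> (\<forall>y\<in>U. P y)"
  then obtain U where U: "openin sphere_topology U" "x \<in> U" "\<And>y. y \<in> U \<Longrightarrow> P y" by blast
  show "eventually P (sphere_nhds x)"
  proof (cases x)
    case (Some z)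
    then show ?thesis
      unfolding eventually_sphere_nhds eventually_nhds
      using U open_Some_preimage[OF U(1)] by (intro exI[of _ "{u. Some u \<in> U}"]) (auto simp: chart_def chart_inv_def)
  next
    case None
    obtain M where M: "\<And>w. norm w > M \<Longrightarrow> Some w \<in> U"
      using openin_sphere_None[OF U(1)] U(2) None by metis
    have "P (chart_inv x w)" if w: "w \<in> ball 0 (1 / (\<bar>M\<bar> + 1))" for w
    proof (cases "w = 0")
      case True
      then show ?thesis using U None by (simp add: chart_inv_def)
    next
      case False
      then have "norm w > 0" "norm w < 1 / (\<bar>M\<bar> + 1)" using w by auto
      then have "\<bar>M\<bar> + 1 < inverse (norm w)" by (simp add: field_simps)
      then have "norm (inverse w) > \<bar>M\<bar> + 1" by (simp only: norm_inverse)
      then have "Some (inverse w) \<in> U" by (intro M) linarith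
      then show ?thesis using U(3) None False by (simp add: chart_inv_def)
    qed
    then show ?thesis
      unfolding eventually_sphere_nhds eventually_nhds using None
      by (intro exI[of _ "ball 0 (1 / (\<bar>M\<bar> + 1))"]) (auto simp: chart_def)
  qed
qed

lemma eventually_chart_inv_chart: "eventually (\<lambda>y. chart_inv x (chart x y) = y) (sphere_nhds x)"
  by (simp add: eventually_sphere_nhds)

lemma continuous_map_sphereI:
  assumes "\<And>x. filterlim f (sphere_nhds (f x)) (sphere_nhds x)"
  shows "continuous_map sphere_topology sphere_topology f"
  unfolding continuous_map
proof (intro conjI allI impI)
  fix U assume U: "openin sphere_topology U"
  show "openin sphere_topology {x \<in> topspace sphere_topology. f x \<in> U}"
  proof (subst openin_subopen, intro ballI)
    fix x assume "x \<in> {x \<in> topspace sphere_topology. f x \<in> U}"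
    then have "eventually (\<lambda>y. y \<in> U) (sphere_nhds (f x))"
      using U unfolding eventually_sphere_nhds_open by auto
    then have "eventually (\<lambda>y. f y \<in> U) (sphere_nhds x)" using assms[of x] by (rule eventually_compose_filterlim)
    then show "\<exists>T. openin sphere_topology T \<and> x \<in> T \<and> T \<subseteq> {x \<in> topspace sphere_topology. f x \<in> U}"
      unfolding eventually_sphere_nhds_open by auto
  qed
qed auto

text \<open>\<open>sphere_has_deriv f x D\<close>: the germ of \<open>f\<close> at \<open>x\<close> is continuous, and differentiable with
  derivative \<open>D\<close> in the coordinates used by \<open>sphere_deriv\<close>.\<close>

definition sphere_has_deriv :: "(sphere \<Rightarrow> sphere) \<Rightarrow> sphere \<Rightarrow> complex \<Rightarrow> bool" where
  "sphere_has_deriv f x D \<longleftrightarrow> filterlim f (sphere_nhds (f x)) (sphere_nhds x) \<and>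
     ((\<lambda>w. chart (f x) (f (chart_inv x w))) has_field_derivative D) (at (chart x x))"

lemma sphere_has_deriv_imp_deriv: "sphere_has_deriv f x D \<Longrightarrow> sphere_deriv f x = D"
  by (simp add: sphere_has_deriv_def sphere_deriv_def DERIV_imp_deriv)

lemma sphere_has_deriv_id: "sphere_has_deriv (\<lambda>x. x) x 1"
  by (simp add: sphere_has_deriv_def filterlim_ident)

text \<open>A chart sends the point that it does not cover to 0 as a default, so a value of
  \<open>f\<close> can be recovered from its coordinate only when it is near \<open>f x\<close>.
  Continuity of the germ provides this.\<close>

lemma sphere_has_deriv_eventually:
  assumes "sphere_has_deriv f x D"
  shows "eventually (\<lambda>w. f (chart_inv x w) = chart_inv (f x) (chart (f x) (f (chart_inv x w)))) (nhds (chart x x))"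
proof -
  have "eventually (\<lambda>y. chart_inv (f x) (chart (f x) (f y)) = f y) (sphere_nhds x)"
    by (rule eventually_compose_filterlim[OF eventually_chart_inv_chart])
      (use assms in \<open>simp add: sphere_has_deriv_def\<close>)
  then show ?thesis unfolding eventually_sphere_nhds by eventually_elim simp
qed

lemma sphere_has_deriv_compose:
  assumes g: "sphere_has_deriv g x B" and f: "sphere_has_deriv f (g x) A"
  shows "sphere_has_deriv (\<lambda>y. f (g y)) x (A * B)"
  unfolding sphere_has_deriv_def
proof
  show "filterlim (\<lambda>y. f (g y)) (sphere_nhds (f (g x))) (sphere_nhds x)"
    using g f unfolding sphere_has_deriv_def by (auto intro: filterlim_compose)
  let ?\<phi> = "\<lambda>w. chart (g x) (g (chart_inv x w))"
  let ?\<psi> = "\<lambda>w. chart (f (g x)) (f (chart_inv (g x) w))"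
  have "((\<lambda>w. ?\<psi> (?\<phi> w)) has_field_derivative A * B) (at (chart x x))"
    by (rule DERIV_chain2[of ?\<psi>]) (use g f in \<open>simp_all add: sphere_has_deriv_def\<close>)
  then show "((\<lambda>w. chart (f (g x)) (f (g (chart_inv x w)))) has_field_derivative A * B) (at (chart x x))"
  proof (rule DERIV_cong_ev[THEN iffD1, OF refl _ refl, rotated])
    show "eventually (\<lambda>w. ?\<psi> (?\<phi> w) = chart (f (g x)) (f (g (chart_inv x w)))) (nhds (chart x x))"
      using sphere_has_deriv_eventually[OF g] by eventually_elim simp
  qed
qed

lemma sphere_has_deriv_funpow:
  assumes "\<And>x. sphere_has_deriv f x (sphere_deriv f x)"
  shows "sphere_has_deriv (f ^^ n) x (sphere_deriv (f ^^ n) x)"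
proof (induction n)
  case 0
  then show ?case using sphere_has_deriv_id[of x] sphere_has_deriv_imp_deriv[of "\<lambda>x. x"] by (simp add: id_def)
next
  case (Suc n)
  from sphere_has_deriv_compose[OF this assms]
  have "sphere_has_deriv (f ^^ Suc n) x (sphere_deriv f ((f ^^ n) x) * sphere_deriv (f ^^ n) x)"
    by (simp add: o_def)
  then show ?case using sphere_has_deriv_imp_deriv by metis
qed

lemma sphere_deriv_funpow_add:
  assumes "\<And>x. sphere_has_deriv f x (sphere_deriv f x)"
  shows "sphere_deriv (f ^^ (m + n)) x = sphere_deriv (f ^^ m) ((f ^^ n) x) * sphere_deriv (f ^^ n) x"
  using sphere_has_deriv_compose[OF sphere_has_deriv_funpow sphere_has_deriv_funpow, OF assms assms]
  by (simp add: funpow_add o_def sphere_has_deriv_imp_deriv)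

lemma eventually_chart_inv_nbhd:
  assumes "open S" "chart x x \<in> S"
  obtains U where "openin sphere_topology U" "x \<in> U" "U \<subseteq> chart_inv x ` S"
proof -
  have "eventually (\<lambda>y. y \<in> chart_inv x ` S) (sphere_nhds x)"
    unfolding eventually_sphere_nhds eventually_nhds using assms by auto
  then show ?thesis using that unfolding eventually_sphere_nhds_open by blast
qed

text \<open>In the coordinate, the distance from the fixed point grows at each step by at least a
  factor \<open>l\<close>, between 1 and the modulus of the derivative, as long as the orbit stays
  in a small set \<open>S\<close>. A bounded set contains no infinite orbit of this kind except the
  fixed point.\<close>

lemma repelling_expansive:
  assumes h: "sphere_has_deriv h p D" and p: "h p = p" and D: "norm D > 1"
  shows "\<exists>U. openin sphere_topology U \<and> p \<in> U \<and> (\<forall>z. (\<forall>k. (h ^^ k) z \<in> U) \<longrightarrow> z = p)"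
proof -
  define c where "c = chart p p"
  define \<phi> where "\<phi> w = chart p (h (chart_inv p w))" for w
  define l where "l = (1 + norm D) / 2"
  have l: "l > 1" "l < norm D" using D by (auto simp: l_def)
  have \<phi>c: "\<phi> c = c" by (simp add: \<phi>_def c_def p)
  have "(\<phi> has_field_derivative D) (at c)" using h p by (simp add: sphere_has_deriv_def \<phi>_def[abs_def] c_def)
  then have "((\<lambda>w. (\<phi> w - \<phi> c) / (w - c)) \<longlongrightarrow> D) (at c)" by (simp add: has_field_derivative_iff)
  then have "((\<lambda>w. norm ((\<phi> w - c) / (w - c))) \<longlongrightarrow> norm D) (at c)" using tendsto_norm \<phi>c by fastforce
  then have "eventually (\<lambda>w. l < norm ((\<phi> w - c) / (w - c))) (at c)" by (rule order_tendstoD(1)) (rule l)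
  then have "eventually (\<lambda>w. w \<noteq> c \<longrightarrow> l < norm ((\<phi> w - c) / (w - c))) (nhds c)"
    by (simp add: eventually_at_filter)
  then have e1: "eventually (\<lambda>w. l * norm (w - c) \<le> norm (\<phi> w - c)) (nhds c)"
  proof eventually_elim
    case (elim w)
    then show ?case by (cases "w = c") (auto simp: norm_divide divide_simps \<phi>c split: if_splits)
  qed
  have e2: "eventually (\<lambda>w. h (chart_inv p w) = chart_inv p (\<phi> w)) (nhds c)"
    using sphere_has_deriv_eventually[OF h] by (simp add: p \<phi>_def c_def)
  have e3: "eventually (\<lambda>w. w \<in> ball c 1) (nhds c)" by (intro eventually_nhds_in_open) auto
  obtain S where S: "open S" "c \<in> S" "\<And>w. w \<in> S \<Longrightarrow> l * norm (w - c) \<le> norm (\<phi> w - c)"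
     "\<And>w. w \<in> S \<Longrightarrow> h (chart_inv p w) = chart_inv p (\<phi> w)" "\<And>w. w \<in> S \<Longrightarrow> w \<in> ball c 1"
    using eventually_conj[OF e1 eventually_conj[OF e2 e3]] unfolding eventually_nhds by blast
  obtain U where U: "openin sphere_topology U" "p \<in> U" "U \<subseteq> chart_inv p ` S"
    using eventually_chart_inv_nbhd[OF S(1)] S(2) unfolding c_def by metis
  have "z = p" if z: "\<forall>k. (h ^^ k) z \<in> U" for z
  proof -
    define w where "w k = chart p ((h ^^ k) z)" for k
    have w: "w k \<in> S \<and> (h ^^ k) z = chart_inv p (w k)" for k
    proof -
      obtain v where "v \<in> S" "(h ^^ k) z = chart_inv p v" using z U(3) by blast
      then show ?thesis by (simp add: w_def)
    qed
    have ws: "w (Suc k) = \<phi> (w k)" for k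
      using w[of k] by (simp add: \<phi>_def w_def)
    have "l ^ k * norm (w 0 - c) \<le> norm (w k - c)" for k
    proof (induction k)
      case (Suc k)
      have "l ^ Suc k * norm (w 0 - c) \<le> l * norm (w k - c)" using Suc l by (simp add: mult.assoc mult_left_mono)
      also have "\<dots> \<le> norm (w (Suc k) - c)" using S(3) w ws by simp
      finally show ?case .
    qed simp
    moreover have "norm (w k - c) < 1" for k using S(5)[of "w k"] w by (simp add: dist_norm norm_minus_commute)
    ultimately have b: "l ^ k * norm (w 0 - c) < 1" for k using le_less_trans by blast
    have "w 0 = c"
    proof (rule ccontr)
      assume "w 0 \<noteq> c"
      then have n0: "norm (w 0 - c) > 0" by simp
      obtain k where "1 / norm (w 0 - c) < l ^ k" using real_arch_pow[OF l(1)] by blast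
      then have "1 < l ^ k * norm (w 0 - c)" using n0 by (simp add: divide_less_eq)
      then show False using b[of k] by simp
    qed
    then show ?thesis using w[of 0] by (simp add: c_def)
  qed
  then show ?thesis using U by blast
qed

section \<open>Rational maps\<close>

text \<open>The polynomial form of \<open>w ^ d * poly p (inverse w)\<close>. Reversing at a common
  \<open>d\<close>, and not at the degree of each polynomial, makes the quotient of two reversals
  represent the rational map in the coordinate at infinity.\<close>

definition reverse_poly :: "nat \<Rightarrow> complex poly \<Rightarrow> complex poly" where
  "reverse_poly d p = (\<Sum>i\<le>d. monom (coeff p (d - i)) i)"

lemma coeff_reverse_poly: "coeff (reverse_poly d p) k = (if k \<le> d then coeff p (d - k) else 0)"
  by (simp add: reverse_poly_def coeff_sum)

lemma poly_reverse_poly: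
  assumes "degree p \<le> d" "w \<noteq> 0"
  shows "poly (reverse_poly d p) w = w ^ d * poly p (inverse w)"
proof -
  have "poly (reverse_poly d p) w = (\<Sum>i\<le>d. coeff p (d - i) * w ^ i)"
    by (simp add: reverse_poly_def poly_sum poly_monom)
  also have "\<dots> = (\<Sum>i\<le>d. coeff p i * w ^ (d - i))"
    by (rule sum.reindex_bij_witness[of _ "\<lambda>i. d - i" "\<lambda>i. d - i"]) auto
  also have "\<dots> = (\<Sum>i\<le>d. w ^ d * (coeff p i * inverse w ^ i))"
    by (rule sum.cong) (use assms(2) in \<open>auto simp: power_diff field_simps power_inverse\<close>)
  also have "\<dots> = w ^ d * poly p (inverse w)"
  proof -
    have "poly p (inverse w) = (\<Sum>i\<le>d. coeff p i * inverse w ^ i)"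
      unfolding poly_altdef using assms(1)
      by (intro sum.mono_neutral_left) (auto simp: coeff_eq_0)
    then show ?thesis by (simp add: sum_distrib_left)
  qed
  finally show ?thesis .
qed

lemma poly_reverse_poly_0: "poly (reverse_poly d p) 0 = coeff p d"
  by (simp add: poly_0_coeff_0 coeff_reverse_poly)

lemma poly_pderiv_reverse_poly_0: "d > 0 \<Longrightarrow> poly (pderiv (reverse_poly d p)) 0 = coeff p (d - 1)"
  by (simp add: poly_0_coeff_0 coeff_pderiv coeff_reverse_poly)

lemma coprime_no_common_root:
  fixes p q :: "complex poly"
  assumes "coprime p q" "poly p z = 0" "poly q z = 0"
  shows False
proof -
  have "[:- z, 1:] dvd p" "[:- z, 1:] dvd q" using assms(2,3) by (auto simp: poly_eq_0_iff_dvd)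
  then have "is_unit [:- z, 1:]" using coprime_common_divisor[OF assms(1)] by blast
  then show False by (simp add: is_unit_iff_degree)
qed

text \<open>The common source of continuity and differentiability of a rational map: near each point
  it is a quotient of polynomials in the coordinates, with \<open>A\<close> and \<open>B\<close>
  taken from \<open>p\<close> and \<open>q\<close>, interchanged where the value is infinite, and
  reversed at infinity.\<close>

lemma sphere_has_deriv_quotient:
  assumes B: "poly B (chart x x) \<noteq> 0"
    and ev: "eventually (\<lambda>w. f (chart_inv x w) = chart_inv (f x) (poly A w / poly B w)) (nhds (chart x x))"
  shows "sphere_has_deriv f x
    (poly (pderiv A * B - A * pderiv B) (chart x x) / (poly B (chart x x))\<^sup>2)"
  unfolding sphere_has_deriv_def
proof
  let ?c = "chart x x"
  have "f x = chart_inv (f x) (poly A ?c / poly B ?c)" using eventually_nhds_x_imp_x[OF ev] by simp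
  then have c: "chart (f x) (f x) = poly A ?c / poly B ?c" by (metis chart_chart_inv)
  have "((\<lambda>w. poly A w / poly B w) \<longlongrightarrow> poly A ?c / poly B ?c) (nhds ?c)"
  proof -
    have "isCont (\<lambda>w. poly A w / poly B w) ?c" using B by (intro continuous_intros) auto
    then show ?thesis by (simp add: isCont_def tendsto_nhds_iff)
  qed
  then have "filterlim (\<lambda>w. chart_inv (f x) (poly A w / poly B w)) (sphere_nhds (f x)) (nhds ?c)"
    unfolding sphere_nhds_def c
    by (rule filterlim_compose[rotated]) (simp add: filterlim_def)
  then have "filterlim (\<lambda>w. f (chart_inv x w)) (sphere_nhds (f x)) (nhds ?c)"
    by (rule filterlim_cong[THEN iffD2, OF refl refl ev])
  then show "filterlim f (sphere_nhds (f x)) (sphere_nhds x)"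
    unfolding sphere_nhds_def[of x] by (simp add: filterlim_def filtermap_filtermap)
  have "((\<lambda>w. poly A w / poly B w) has_field_derivative
      (poly (pderiv A) ?c * poly B ?c - poly A ?c * poly (pderiv B) ?c) / (poly B ?c * poly B ?c)) (at ?c)"
    by (rule DERIV_divide[OF poly_DERIV poly_DERIV B])
  moreover have "eventually (\<lambda>w. poly A w / poly B w = chart (f x) (f (chart_inv x w))) (nhds ?c)"
    using ev by eventually_elim simp
  ultimately show "((\<lambda>w. chart (f x) (f (chart_inv x w))) has_field_derivative
      poly (pderiv A * B - A * pderiv B) ?c / (poly B ?c)\<^sup>2) (at ?c)"
    using DERIV_cong_ev[OF refl _ refl, of _ _ ?c] by (simp add: power2_eq_square)
qed

lemma complex_poly_root:
  fixes p :: "complex poly"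
  assumes "degree p \<noteq> 0"
  obtains z where "poly p z = 0"
  using Fundamental_Theorem_Algebra.fundamental_theorem_of_algebra[of p] assms
  by (auto simp: constant_degree)

text \<open>Stated for positive degree, so that the Moebius maps of the normalisation are instances
  as well.\<close>

locale ratio =
  fixes p q :: "complex poly" and d :: nat and f :: "sphere \<Rightarrow> sphere"
  assumes q0: "q \<noteq> 0" and cop: "coprime p q" and d_def: "d = max (degree p) (degree q)"
    and f_def: "f = ratio_map p q" and d_pos: "d > 0"
begin

lemma no_common_root: "poly p z = 0 \<Longrightarrow> poly q z = 0 \<Longrightarrow> False"
  by (rule coprime_no_common_root[OF cop])

lemma deg_le: "degree p \<le> d" "degree q \<le> d"
  by (auto simp: d_def)

lemma f_Some: "f (Some z) = (if poly q z = 0 then None else Some (poly p z / poly q z))"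
  by (simp add: f_def)

lemma f_None: "f None = (if coeff q d = 0 then None else Some (coeff p d / coeff q d))"
proof (cases "degree p > degree q")
  case True
  then have "coeff q d = 0" by (simp add: d_def coeff_eq_0)
  then show ?thesis using True by (simp add: f_def)
next
  case False
  then have "d = degree q" by (simp add: d_def)
  then show ?thesis using False q0 by (simp add: f_def)
qed

lemma coeff_d: "coeff q d = 0 \<Longrightarrow> coeff p d \<noteq> 0"
  using q0 d_pos by (cases "degree p \<le> degree q") (auto simp: d_def max_def split: if_splits)

text \<open>The numerator of the derivative of \<open>p / q\<close>. Interchanging \<open>p\<close>
  and \<open>q\<close> only changes its sign, so the same polynomial detects critical points at
  poles.\<close>

definition wronskian :: "complex poly" where "wronskian = pderiv p * q - p * pderiv q"

text \<open>The Wronskian of the reversed polynomials at \<open>0\<close>.\<close>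

definition wronskian_inf :: complex where
  "wronskian_inf = coeff p (d - 1) * coeff q d - coeff p d * coeff q (d - 1)"

lemma local_form_Some:
  "\<exists>A B. poly B (chart (Some z) (Some z)) \<noteq> 0 \<and>
     eventually (\<lambda>w. f (chart_inv (Some z) w) = chart_inv (f (Some z)) (poly A w / poly B w))
       (nhds (chart (Some z) (Some z))) \<and>
     (poly (pderiv A * B - A * pderiv B) (chart (Some z) (Some z)) = 0 \<longleftrightarrow> poly wronskian z = 0)"
proof (cases "poly q z = 0")
  case False
  have "eventually (\<lambda>w. poly q w \<noteq> 0) (nhds z)"
    using False by (intro eventually_nhds_in_open[of "{w. poly q w \<noteq> 0}", simplified])
      (auto intro!: open_Collect_neq continuous_intros)
  then have ev: "eventually (\<lambda>w. f (chart_inv (Some z) w) = chart_inv (f (Some z)) (poly p w / poly q w)) (nhds (chart (Some z) (Some z)))"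
    unfolding chart_self by eventually_elim (use False in \<open>simp add: f_Some chart_inv_def\<close>)
  have nz: "poly q (chart (Some z) (Some z)) \<noteq> 0" using False by (simp add: chart_def)
  show ?thesis
    by (rule exI, rule exI, rule conjI[OF nz], rule conjI[OF ev])
      (use False in \<open>simp add: wronskian_def\<close>)
next
  case True
  then have p: "poly p z \<noteq> 0" using no_common_root by blast
  have "eventually (\<lambda>w. poly p w \<noteq> 0) (nhds z)"
    using p by (intro eventually_nhds_in_open[of "{w. poly p w \<noteq> 0}", simplified])
      (auto intro!: open_Collect_neq continuous_intros)
  then have ev: "eventually (\<lambda>w. f (chart_inv (Some z) w) = chart_inv (f (Some z)) (poly q w / poly p w)) (nhds (chart (Some z) (Some z)))"
    unfolding chart_self by eventually_elim (use True in \<open>simp add: f_Some chart_inv_def\<close>)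
  have nz: "poly p (chart (Some z) (Some z)) \<noteq> 0" using p by (simp add: chart_def)
  show ?thesis
    by (rule exI, rule exI, rule conjI[OF nz], rule conjI[OF ev])
      (use p in \<open>auto simp: wronskian_def algebra_simps\<close>)
qed

lemma poly_quotient_reverse:
  assumes "w \<noteq> 0"
  shows "poly (reverse_poly d p) w / poly (reverse_poly d q) w = poly p (inverse w) / poly q (inverse w)"
    "poly (reverse_poly d p) w = 0 \<longleftrightarrow> poly p (inverse w) = 0"
    "poly (reverse_poly d q) w = 0 \<longleftrightarrow> poly q (inverse w) = 0"
  using poly_reverse_poly[OF deg_le(1) assms] poly_reverse_poly[OF deg_le(2) assms] assms by simp_all

lemma local_form_None:
  "\<exists>A B. poly B (chart None None) \<noteq> 0 \<and>
     eventually (\<lambda>w. f (chart_inv None w) = chart_inv (f None) (poly A w / poly B w))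
       (nhds (chart None None)) \<and>
     (poly (pderiv A * B - A * pderiv B) (chart None None) = 0 \<longleftrightarrow> wronskian_inf = 0)"
proof (cases "coeff q d = 0")
  case False
  let ?P = "reverse_poly d p" and ?Q = "reverse_poly d q"
  have Q: "poly ?Q (chart None None) \<noteq> 0" using False by (simp add: chart_def poly_reverse_poly_0)
  have "eventually (\<lambda>w. poly ?Q w \<noteq> 0) (nhds 0)"
    using Q by (intro eventually_nhds_in_open[of "{w. poly ?Q w \<noteq> 0}", simplified])
      (auto intro!: open_Collect_neq continuous_intros simp: chart_def)
  then have ev: "eventually (\<lambda>w. f (chart_inv None w) = chart_inv (f None) (poly ?P w / poly ?Q w)) (nhds (chart None None))"
    unfolding chart_self
  proof eventually_elim
    case (elim w)
    then show ?case
      using False poly_quotient_reverse[of w]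
      by (cases "w = 0") (auto simp: f_Some f_None chart_inv_def poly_reverse_poly_0)
  qed
  show ?thesis
    by (rule exI, rule exI, rule conjI[OF Q], rule conjI[OF ev])
      (use Q in \<open>simp add: wronskian_inf_def poly_pderiv_reverse_poly_0[OF d_pos] poly_reverse_poly_0\<close>)
next
  case True
  let ?P = "reverse_poly d p" and ?Q = "reverse_poly d q"
  have P: "poly ?P (chart None None) \<noteq> 0" using coeff_d[OF True] by (simp add: chart_def poly_reverse_poly_0)
  have "eventually (\<lambda>w. poly ?P w \<noteq> 0) (nhds 0)"
    using P by (intro eventually_nhds_in_open[of "{w. poly ?P w \<noteq> 0}", simplified])
      (auto intro!: open_Collect_neq continuous_intros simp: chart_def)
  then have ev: "eventually (\<lambda>w. f (chart_inv None w) = chart_inv (f None) (poly ?Q w / poly ?P w)) (nhds (chart None None))"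
    unfolding chart_self
  proof eventually_elim
    case (elim w)
    show ?case
    proof (cases "w = 0")
      case False
      have "poly ?Q w / poly ?P w = inverse (poly ?P w / poly ?Q w)" by simp
      then show ?thesis
        using elim True False poly_quotient_reverse[OF False]
        by (auto simp: f_Some f_None chart_inv_def)
    qed (use True in \<open>simp add: f_None chart_inv_def poly_reverse_poly_0\<close>)
  qed
  show ?thesis
    by (rule exI, rule exI, rule conjI[OF P], rule conjI[OF ev])
      (use P in \<open>auto simp: wronskian_inf_def poly_pderiv_reverse_poly_0[OF d_pos] poly_reverse_poly_0 algebra_simps\<close>)
qed

lemma local_form:
  obtains A B where "poly B (chart x x) \<noteq> 0"
    "eventually (\<lambda>w. f (chart_inv x w) = chart_inv (f x) (poly A w / poly B w)) (nhds (chart x x))"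
    "poly (pderiv A * B - A * pderiv B) (chart x x) = 0 \<longleftrightarrow>
       (case x of None \<Rightarrow> wronskian_inf = 0 | Some z \<Rightarrow> poly wronskian z = 0)"
proof (cases x)
  case None
  with local_form_None obtain A B where "poly B (chart x x) \<noteq> 0"
    "eventually (\<lambda>w. f (chart_inv x w) = chart_inv (f x) (poly A w / poly B w)) (nhds (chart x x))"
    "poly (pderiv A * B - A * pderiv B) (chart x x) = 0 \<longleftrightarrow> wronskian_inf = 0" by blast
  then show ?thesis using None by (intro that[of B A]) auto
next
  case (Some z)
  with local_form_Some[of z] obtain A B where "poly B (chart x x) \<noteq> 0"
    "eventually (\<lambda>w. f (chart_inv x w) = chart_inv (f x) (poly A w / poly B w)) (nhds (chart x x))"
    "poly (pderiv A * B - A * pderiv B) (chart x x) = 0 \<longleftrightarrow> poly wronskian z = 0" by blast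
  then show ?thesis using Some by (intro that[of B A]) auto
qed

lemma critical_point_iff:
  "critical_point f x \<longleftrightarrow> (case x of None \<Rightarrow> wronskian_inf = 0 | Some z \<Rightarrow> poly wronskian z = 0)"
proof (rule local_form[of x])
  fix A B assume B: "poly B (chart x x) \<noteq> 0"
    and ev: "eventually (\<lambda>w. f (chart_inv x w) = chart_inv (f x) (poly A w / poly B w)) (nhds (chart x x))"
    and cr: "poly (pderiv A * B - A * pderiv B) (chart x x) = 0 \<longleftrightarrow>
       (case x of None \<Rightarrow> wronskian_inf = 0 | Some z \<Rightarrow> poly wronskian z = 0)"
  from sphere_has_deriv_imp_deriv[OF sphere_has_deriv_quotient[OF B ev]]
  show ?thesis unfolding critical_point_def cr[symmetric] using B by (simp only: divide_eq_0_iff power_eq_0_iff) simp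
qed

lemma has_deriv: "sphere_has_deriv f x (sphere_deriv f x)"
proof (rule local_form[of x])
  fix A B assume B: "poly B (chart x x) \<noteq> 0"
    and ev: "eventually (\<lambda>w. f (chart_inv x w) = chart_inv (f x) (poly A w / poly B w)) (nhds (chart x x))"
  from sphere_has_deriv_quotient[OF B ev] sphere_has_deriv_imp_deriv
  show ?thesis by metis
qed

lemma continuous: "continuous_map sphere_topology sphere_topology f"
  by (rule continuous_map_sphereI) (use has_deriv in \<open>simp add: sphere_has_deriv_def\<close>)

lemma f_eq_Some_iff: "f (Some z) = Some v \<longleftrightarrow> poly (p - smult v q) z = 0"
proof
  assume "f (Some z) = Some v"
  then have "poly q z \<noteq> 0" "poly p z / poly q z = v" by (auto simp: f_Some split: if_splits)
  then show "poly (p - smult v q) z = 0" by auto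
next
  assume r: "poly (p - smult v q) z = 0"
  then have "poly q z \<noteq> 0" using no_common_root[of z] by auto
  then show "f (Some z) = Some v" using r by (auto simp: f_Some field_simps)
qed

lemma p_smult_nonzero: "p - smult v q \<noteq> 0"
proof
  assume e: "p - smult v q = 0"
  then have pq: "p = smult v q" by simp
  then have "degree p \<le> degree q" using degree_smult_le by metis
  then have "degree q \<noteq> 0" using d_pos by (simp add: d_def)
  then obtain z where "poly q z = 0" by (rule complex_poly_root)
  then show False using no_common_root[of z] pq by simp
qed

lemma finite_fibre_ratio: "finite {x. f x = y}"
proof -
  have "finite {z. f (Some z) = y}"
  proof (cases y)
    case None
    have "{z. f (Some z) = y} \<subseteq> {z. poly q z = 0}" using None by (auto simp: f_Some split: if_splits)
    then show ?thesis using poly_roots_finite[OF q0] finite_subset by blast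
  next
    case (Some v)
    then show ?thesis using poly_roots_finite[OF p_smult_nonzero] by (simp add: f_eq_Some_iff)
  qed
  moreover have "{x. f x = y} \<subseteq> insert None (Some ` {z. f (Some z) = y})"
    by (auto simp: image_iff) (metis not_None_eq)
  ultimately show ?thesis by (meson finite_imageI finite_insert finite_subset)
qed

lemma surj_ratio: "surj f"
  unfolding surj_def
proof
  fix y
  show "\<exists>x. y = f x"
  proof (cases y)
    case None
    show ?thesis
    proof (cases "degree q = 0")
      case True
      then have "coeff q d = 0" using d_pos by (simp add: coeff_eq_0)
      then show ?thesis using None f_None by (intro exI[of _ None]) simp
    next
      case False
      then obtain z where "poly q z = 0" by (rule complex_poly_root)
      then show ?thesis using None f_Some by (intro exI[of _ "Some z"]) simp
    qed
  next
    case (Some v)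
    show ?thesis
    proof (cases "degree (p - smult v q) = 0")
      case True
      then have "coeff (p - smult v q) d = 0" by (intro coeff_eq_0) (use d_pos in linarith)
      then have "coeff p d = v * coeff q d" by simp
      then show ?thesis using Some f_None coeff_d by (intro exI[of _ None]) auto
    next
      case False
      then obtain z where "poly (p - smult v q) z = 0" by (rule complex_poly_root)
      then have "f (Some z) = y" using Some f_eq_Some_iff by blast
      then show ?thesis by blast
    qed
  qed
qed

lemma locally_injective:
  assumes "\<not> critical_point f x"
  obtains U where "openin sphere_topology U" "x \<in> U" "inj_on f U"
proof (rule local_form[of x])
  fix A B assume B: "poly B (chart x x) \<noteq> 0"
    and ev: "eventually (\<lambda>w. f (chart_inv x w) = chart_inv (f x) (poly A w / poly B w)) (nhds (chart x x))"
    and cr: "poly (pderiv A * B - A * pderiv B) (chart x x) = 0 \<longleftrightarrow>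
       (case x of None \<Rightarrow> wronskian_inf = 0 | Some z \<Rightarrow> poly wronskian z = 0)"
  let ?c = "chart x x" and ?\<phi> = "\<lambda>w. poly A w / poly B w"
  have "(?\<phi> has_field_derivative
      (poly (pderiv A) ?c * poly B ?c - poly A ?c * poly (pderiv B) ?c) / (poly B ?c * poly B ?c)) (at ?c)"
    by (rule DERIV_divide[OF poly_DERIV poly_DERIV B])
  then have "deriv ?\<phi> ?c = poly (pderiv A * B - A * pderiv B) ?c / (poly B ?c * poly B ?c)"
    by (simp add: DERIV_imp_deriv)
  moreover have "poly (pderiv A * B - A * pderiv B) ?c \<noteq> 0" using cr assms critical_point_iff by metis
  ultimately have d: "deriv ?\<phi> ?c \<noteq> 0" using B by simp
  obtain S where S: "open S" "?c \<in> S" "\<And>w. w \<in> S \<Longrightarrow> f (chart_inv x w) = chart_inv (f x) (?\<phi> w)"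
    using ev unfolding eventually_nhds by blast
  define T where "T = S \<inter> {w. poly B w \<noteq> 0}"
  have "open {w. poly B w \<noteq> 0}" by (intro open_Collect_neq continuous_intros)
  then have T: "open T" "?c \<in> T" using S B by (auto simp: T_def)
  have "?\<phi> holomorphic_on T" by (intro holomorphic_intros) (auto simp: T_def)
  then obtain r where r: "r > 0" "ball ?c r \<subseteq> T" "inj_on ?\<phi> (ball ?c r)"
    by (rule has_complex_derivative_locally_injective[OF _ T(2,1) d])
  obtain U where U: "openin sphere_topology U" "x \<in> U" "U \<subseteq> chart_inv x ` ball ?c r"
    by (rule eventually_chart_inv_nbhd[of "ball ?c r" x]) (use r in auto)
  have "inj_on f U"
  proof (rule inj_onI)
    fix a b assume ab: "a \<in> U" "b \<in> U" "f a = f b"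
    obtain u v where uv: "u \<in> ball ?c r" "a = chart_inv x u" "v \<in> ball ?c r" "b = chart_inv x v"
      using U(3) ab by blast
    then have "u \<in> S" "v \<in> S" using r(2) by (auto simp: T_def)
    then have "chart_inv (f x) (?\<phi> u) = chart_inv (f x) (?\<phi> v)" using S(3) ab(3) uv by metis
    then have "?\<phi> u = ?\<phi> v" by (metis chart_chart_inv)
    then have "u = v" using inj_onD[OF r(3)] uv by metis
    then show "a = b" using uv by simp
  qed
  then show ?thesis using that U by blast
qed

text \<open>At a root of \<open>q\<close> the two sides of
  \<open>pderiv p * q = p * pderiv q\<close> would vanish to different orders, since
  \<open>p\<close> is nonzero there. So \<open>q\<close> is constant, then \<open>p\<close> is,
  against positive degree.\<close>

lemma wronskian_nonzero: "wronskian \<noteq> 0"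
proof
  assume "wronskian = 0"
  then have e: "pderiv p * q = p * pderiv q" by (simp add: wronskian_def)
  have dq: "degree q = 0"
  proof (rule ccontr)
    assume dq: "degree q \<noteq> 0"
    then obtain z where z: "poly q z = 0" by (rule complex_poly_root)
    have q': "pderiv q \<noteq> 0" using dq by (simp add: pderiv_eq_0_iff)
    have p0: "poly p z \<noteq> 0" using no_common_root[of z] z by blast
    then have pq': "p * pderiv q \<noteq> 0" using q' by auto
    have "order z q = Suc (order z (pderiv q))"
      by (rule order_pderiv[OF q0 z])
    moreover have "order z (p * pderiv q) = order z p + order z (pderiv q)" by (rule order_mult[OF pq'])
    moreover have "order z (pderiv p * q) = order z (pderiv p) + order z q"
      by (rule order_mult) (use pq' e in simp)
    moreover have "order z p = 0" using p0 by (rule order_0I)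
    ultimately show False using e by simp
  qed
  then have "pderiv q = 0" by (simp add: pderiv_eq_0_iff)
  then have "pderiv p = 0" using e q0 by simp
  then have "degree p = 0" by (simp add: pderiv_eq_0_iff)
  then show False using d_pos dq by (simp add: d_def)
qed

lemma finite_critical: "finite {x. critical_point f x}"
proof (rule finite_subset)
  show "{x. critical_point f x} \<subseteq> insert None (Some ` {z. poly wronskian z = 0})"
  proof
    fix x assume "x \<in> {x. critical_point f x}"
    then show "x \<in> insert None (Some ` {z. poly wronskian z = 0})"
      by (cases x) (auto simp: critical_point_iff)
  qed
  show "finite (insert None (Some ` {z. poly wronskian z = 0}))"
    using poly_roots_finite[OF wronskian_nonzero] by simp
qed

text \<open>The coefficient of degree \<open>2 * d - 2\<close> in the Wronskian is the negative of
  \<open>wronskian_inf\<close>. Either it vanishes and infinity is critical, or the Wronskian has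
  positive degree and hence a root.\<close>

lemma critical_exists:
  assumes "d \<ge> 2"
  shows "\<exists>x. critical_point f x"
proof (cases "wronskian_inf = 0")
  case True
  then show ?thesis by (intro exI[of _ None]) (simp add: critical_point_iff)
next
  case False
  have *: "coeff (pderiv a * b) (2 * d - 2) =
     of_nat (d - 1) * coeff a (d - 1) * coeff b d + of_nat d * coeff a d * coeff b (d - 1)"
    if ab: "degree a \<le> d" "degree b \<le> d" for a b :: "complex poly"
  proof -
    have "coeff (pderiv a * b) (2 * d - 2) = (\<Sum>i\<le>2 * d - 2. coeff (pderiv a) i * coeff b (2 * d - 2 - i))"
      by (simp add: coeff_mult)
    also have "\<dots> = (\<Sum>i\<in>{d - 2, d - 1}. coeff (pderiv a) i * coeff b (2 * d - 2 - i))"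
    proof (rule sum.mono_neutral_right)
      show "\<forall>i\<in>{..2 * d - 2} - {d - 2, d - 1}. coeff (pderiv a) i * coeff b (2 * d - 2 - i) = 0"
      proof
        fix i assume i: "i \<in> {..2 * d - 2} - {d - 2, d - 1}"
        then have "i < d - 2 \<or> i \<ge> d" using assms by auto
        then show "coeff (pderiv a) i * coeff b (2 * d - 2 - i) = 0"
        proof
          assume "i < d - 2"
          then have "2 * d - 2 - i > degree b" using ab(2) by linarith
          then show ?thesis by (simp add: coeff_eq_0)
        next
          assume "i \<ge> d"
          then have "Suc i > degree a" using ab(1) by linarith
          then show ?thesis by (simp add: coeff_pderiv coeff_eq_0)
        qed
      qed
    qed (use assms in auto)
    also have "\<dots> = coeff (pderiv a) (d - 2) * coeff b d + coeff (pderiv a) (d - 1) * coeff b (d - 1)"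
    proof -
      have "2 * d - 2 - (d - 2) = d" "2 * d - 2 - (d - 1) = d - 1" "d - 2 \<noteq> d - 1" using assms by auto
      then show ?thesis by simp
    qed
    also have "\<dots> = of_nat (d - 1) * coeff a (d - 1) * coeff b d + of_nat d * coeff a d * coeff b (d - 1)"
    proof -
      have "Suc (d - 2) = d - 1" "Suc (d - 1) = d" using assms by auto
      then show ?thesis unfolding coeff_pderiv by metis
    qed
    finally show ?thesis .
  qed
  have "coeff wronskian (2 * d - 2) = coeff (pderiv p * q) (2 * d - 2) - coeff (pderiv q * p) (2 * d - 2)"
    by (simp add: wronskian_def mult.commute)
  also have "\<dots> = (of_nat (d - 1) - of_nat d) * wronskian_inf"
    unfolding *[OF deg_le] *[OF deg_le(2,1)] wronskian_inf_def by (simp add: algebra_simps)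
  also have "of_nat (d - 1) - of_nat d = (-1 :: complex)" using assms by (simp add: of_nat_diff)
  finally have "coeff wronskian (2 * d - 2) \<noteq> 0" using False by simp
  then have "2 * d - 2 \<le> degree wronskian" by (rule le_degree)
  then have "degree wronskian \<noteq> 0" using assms by auto
  then obtain z where "poly wronskian z = 0" by (rule complex_poly_root)
  then show ?thesis by (intro exI[of _ "Some z"]) (simp add: critical_point_iff)
qed

text \<open>The preimages of a finite value \<open>v\<close> other than the value at infinity are
  the roots of \<open>p - smult v q\<close>, which has degree at least 2. If there is only one, it
  is a multiple root, so the Wronskian vanishes there and \<open>v\<close> is a critical
  value.\<close>

lemma finite_few_preimages:
  assumes "d \<ge> 2"
  shows "finite {y. \<forall>a b. f a = y \<longrightarrow> f b = y \<longrightarrow> a = b}"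
proof (rule finite_subset)
  show "{y. \<forall>a b. f a = y \<longrightarrow> f b = y \<longrightarrow> a = b} \<subseteq>
    {None, f None} \<union> (\<lambda>z. f (Some z)) ` {z. poly wronskian z = 0}"
  proof
    fix y assume y: "y \<in> {y. \<forall>a b. f a = y \<longrightarrow> f b = y \<longrightarrow> a = b}"
    show "y \<in> {None, f None} \<union> (\<lambda>z. f (Some z)) ` {z. poly wronskian z = 0}"
    proof (rule ccontr)
      assume n: "y \<notin> {None, f None} \<union> (\<lambda>z. f (Some z)) ` {z. poly wronskian z = 0}"
      then obtain v where v: "y = Some v" by (cases y) auto
      let ?r = "p - smult v q"
      have "coeff ?r d \<noteq> 0"
      proof
        assume "coeff ?r d = 0"
        then have "coeff p d = v * coeff q d" by simp
        then have "f None = Some v" using coeff_d f_None by auto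
        then show False using n v by simp
      qed
      then have dr: "degree ?r \<ge> 2" using assms le_degree le_trans by blast
      obtain c where c: "poly ?r c = 0" by (rule complex_poly_root[of ?r]) (use dr in auto)
      then obtain h where h: "?r = [:- c, 1:] * h" using poly_eq_0_iff_dvd[of ?r c] by (auto elim: dvdE)
      have h0: "h \<noteq> 0" using h p_smult_nonzero by auto
      then have "degree ?r = Suc (degree h)" unfolding h by (simp add: degree_mult_eq del: mult_pCons_left)
      then have "degree h \<noteq> 0" using dr by simp
      then obtain b where b: "poly h b = 0" by (rule complex_poly_root)
      then have "poly ?r b = 0" unfolding h by simp
      then have "f (Some b) = y" "f (Some c) = y" using c v f_eq_Some_iff by auto
      then have bc: "b = c" using y by auto
      have "poly (pderiv ?r) c = 0" unfolding h pderiv_mult using b bc by (simp add: pderiv_pCons)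
      then have d1: "poly (pderiv p) c = v * poly (pderiv q) c" by (simp add: pderiv_diff pderiv_smult)
      have "poly p c = v * poly q c" using c by simp
      then have "poly wronskian c = 0" using d1 by (simp add: wronskian_def)
      then show False using n \<open>f (Some c) = y\<close> by auto
    qed
  qed
  show "finite ({None, f None} \<union> (\<lambda>z. f (Some z)) ` {z. poly wronskian z = 0})"
    using poly_roots_finite[OF wronskian_nonzero] by simp
qed

end

section \<open>Strictly postcritically finite maps\<close>

lemma funpow_fixed_mult: "(f ^^ r) x = x \<Longrightarrow> (f ^^ (r * k)) x = x"
  by (induction k) (auto simp: funpow_add)

lemma period_properties:
  assumes "periodic_point f x"
  shows "period f x > 0" "(f ^^ period f x) x = x"
  using LeastI_ex[of "\<lambda>n. n > 0 \<and> (f ^^ n) x = x"] assms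
  by (auto simp: periodic_point_def period_def)

lemma period_dvd:
  assumes "n > 0" "(f ^^ n) x = x"
  shows "period f x dvd n"
proof -
  have per: "periodic_point f x" using assms by (auto simp: periodic_point_def)
  note P = period_properties[OF per]
  have "(f ^^ (n mod period f x)) x = x" using funpow_mod_eq[OF P(2), of n] assms(2) by simp
  then have "n mod period f x = 0"
    using not_less_Least[of "n mod period f x" "\<lambda>n. n > 0 \<and> (f ^^ n) x = x"] P(1)
      mod_less_divisor[of "period f x" n]
    by (auto simp: period_def)
  then show ?thesis by auto
qed

locale pcf_ratio = ratio +
  assumes d2: "d \<ge> 2" and pcf: "strictly_postcritically_finite f"
begin

abbreviation deriv_iter :: "nat \<Rightarrow> sphere \<Rightarrow> complex" where
  "deriv_iter n x \<equiv> sphere_deriv (f ^^ n) x"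

lemma deriv_iter_add: "deriv_iter (m + n) x = deriv_iter m ((f ^^ n) x) * deriv_iter n x"
  by (rule sphere_deriv_funpow_add) (rule has_deriv)

lemma has_deriv_iter: "sphere_has_deriv (f ^^ n) x (deriv_iter n x)"
  by (rule sphere_has_deriv_funpow) (rule has_deriv)

lemma deriv_iter_0: "deriv_iter 0 x = 1"
proof -
  have "(\<lambda>x. x) = f ^^ 0" by auto
  from sphere_has_deriv_id[of x, unfolded this] show ?thesis by (rule sphere_has_deriv_imp_deriv)
qed

lemma deriv_iter_power:
  assumes "(f ^^ r) x = x"
  shows "deriv_iter (r * k) x = deriv_iter r x ^ k"
proof (induction k)
  case 0
  show ?case by (simp only: mult_0_right power_0 deriv_iter_0)
next
  case (Suc k)
  have "deriv_iter (r + r * k) x = deriv_iter r x * deriv_iter (r * k) x"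
    unfolding deriv_iter_add funpow_fixed_mult[OF assms] ..
  then show ?case using Suc by simp
qed

lemma repelling_iter:
  assumes "repelling_periodic_point f x" "n > 0" "(f ^^ n) x = x"
  shows "norm (deriv_iter n x) > 1"
proof -
  have per: "periodic_point f x" and mult: "norm (deriv_iter (period f x) x) > 1"
    using assms(1) by (auto simp: repelling_periodic_point_def multiplier_def)
  obtain k where k: "n = period f x * k" using period_dvd[OF assms(2,3)] by (auto elim: dvdE)
  have "k > 0" using k assms(2) by (cases k) auto
  have "norm (deriv_iter n x) = norm (deriv_iter (period f x) x) ^ k"
    unfolding k deriv_iter_power[OF period_properties(2)[OF per]] by (simp add: norm_power)
  then show ?thesis using one_less_power[OF mult \<open>k > 0\<close>] by simp
qed

text \<open>A critical point on a cycle makes derivatives around this cycle vanish. By assumption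
  its orbit also reaches a repelling point, which must then lie on the same cycle.\<close>

lemma critical_not_periodic:
  assumes c: "critical_point f c" and r: "r > 0" "(f ^^ r) c = c"
  shows False
proof -
  obtain N where N: "repelling_periodic_point f ((f ^^ N) c)"
    using pcf c by (auto simp: strictly_postcritically_finite_def)
  define x where "x = (f ^^ N) c"
  have per: "periodic_point f x" using N by (simp add: x_def repelling_periodic_point_def)
  define n where "n = period f x * r"
  have n: "n > 0" "(f ^^ n) x = x"
    using period_properties[OF per] r(1) funpow_fixed_mult by (auto simp: n_def)
  have nr: "n \<ge> r" using period_properties(1)[OF per] by (simp add: n_def)
  \<comment> \<open>The number of steps from \<open>x\<close> to the next visit at \<open>c\<close>;
    the outer \<open>mod\<close> covers the case that \<open>r\<close> divides
    \<open>N\<close>.\<close>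
  define i where "i = (r - N mod r) mod r"
  have i: "i < r" using r(1) by (simp add: i_def)
  have "(i + N) mod r = 0"
  proof -
    have "(i + N) mod r = ((r - N mod r) + N mod r) mod r" unfolding i_def by (metis mod_add_eq mod_mod_trivial)
    also have "(r - N mod r) + N mod r = r" using r(1) mod_less_divisor[of r N] by simp
    finally show ?thesis by simp
  qed
  then have "(f ^^ (i + N)) c = c" using funpow_mod_eq[OF r(2), of "i + N"] by simp
  then have ci: "(f ^^ i) x = c" by (simp add: x_def funpow_add)
  have "n = (n - i - 1) + (1 + i)" using i nr by simp
  then have "deriv_iter n x = deriv_iter (n - i - 1) ((f ^^ (1 + i)) x) * deriv_iter (1 + i) x"
    using deriv_iter_add by metis
  moreover have "deriv_iter (1 + i) x = 0"
    unfolding deriv_iter_add ci using c by (simp add: critical_point_def)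
  ultimately have "deriv_iter n x = 0" by simp
  moreover have "norm (deriv_iter n x) > 1" using repelling_iter[OF N[folded x_def] n] .
  ultimately show False by simp
qed

text \<open>Such a set would be permuted by \<open>f\<close>, and each of its points would have
  exactly one preimage, which is periodic. Periodic points are not critical, so \<open>f\<close> is
  injective near this preimage and all values in a nonempty open set have a single preimage, against
  \<open>finite_few_preimages\<close>.\<close>

lemma no_finite_backward_invariant:
  assumes E: "finite E" "E \<noteq> {}" and bk: "\<And>x. f x \<in> E \<Longrightarrow> x \<in> E"
  shows False
proof -
  define E' where "E' = {x. f x \<in> E}"
  have E'E: "E' \<subseteq> E" using bk by (auto simp: E'_def)
  then have fE': "finite E'" using E(1) finite_subset by blast
  have img: "f ` E' = E" using surj_ratio by (force simp: E'_def)
  have "card E \<le> card E'" using card_image_le[OF fE', of f] img by simp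
  then have EE: "E' = E" using E'E E(1) card_seteq by blast
  then have inj: "inj_on f E" using img E(1) by (intro eq_card_imp_inj_on) auto
  have fE: "f ` E = E" using img EE by simp
  obtain e where e: "e \<in> E" using E(2) by blast
  then obtain c where c: "c \<in> E" "f c = e" using fE by (metis imageE)
  have uniq: "x = c" if x: "f x = e" for x
    using inj_onD[OF inj, of x c] bk[of x] x c e by simp
  have "\<exists>r>0. (f ^^ r) c = c"
  proof -
    have it: "(f ^^ n) c \<in> E" for n by (induction n) (use c(1) fE in auto)
    have "\<not> inj_on (\<lambda>n. (f ^^ n) c) {0..card E}"
    proof
      assume "inj_on (\<lambda>n. (f ^^ n) c) {0..card E}"
      then have "card {0..card E} \<le> card E" by (rule card_inj_on_le) (use it E(1) in auto)
      then show False by simp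
    qed
    then obtain a b where ab: "a < b" "(f ^^ a) c = (f ^^ b) c"
      by (auto simp: inj_on_def) (metis linorder_neqE_nat)
    have inj_it: "inj_on (f ^^ n) E" for n
    proof (induction n)
      case (Suc n)
      have "(f ^^ n) ` E = E"
      proof (induction n)
        case (Suc n)
        have "(f ^^ Suc n) ` E = f ` (f ^^ n) ` E" by (simp only: funpow.simps image_comp)
        then show ?case using Suc fE by simp
      qed simp
      then show ?case using comp_inj_on[OF Suc, of f] inj by (simp add: o_def)
    qed simp
    have "(f ^^ a) ((f ^^ (b - a)) c) = (f ^^ a) c" using ab by (simp flip: funpow_add o_apply[of "f ^^ a"])
    then have "(f ^^ (b - a)) c = c" using inj_onD[OF inj_it] it c(1) by blast
    then show ?thesis using ab(1) by (intro exI[of _ "b - a"]) simp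
  qed
  then have nc: "\<not> critical_point f c" using critical_not_periodic by blast
  obtain U where U: "openin sphere_topology U" "c \<in> U" "inj_on f U" by (rule locally_injective[OF nc])
  have "closedin sphere_topology (- U)" using U(1) by (simp add: closedin_def Compl_eq_Diff_UNIV Diff_Diff_Int)
  then have "compactin sphere_topology (- U)" using closedin_compact_space compact_space_sphere by blast
  then have "closedin sphere_topology (f ` (- U))"
    using image_compactin[OF _ continuous] Hausdorff_space_sphere compactin_imp_closedin by blast
  \<comment> \<open>These are the values all of whose preimages lie in \<open>U\<close>. The set is
    open because the complement of \<open>U\<close> is compact, and it contains \<open>e\<close>
    because \<open>c\<close> is the only preimage of \<open>e\<close>.\<close>
  then have op: "openin sphere_topology (- f ` (- U))" by (simp add: closedin_def Compl_eq_Diff_UNIV)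
  have "e \<in> - f ` (- U)" using uniq U(2) by auto
  have sub: "- f ` (- U) \<subseteq> {y. \<forall>a b. f a = y \<longrightarrow> f b = y \<longrightarrow> a = b}"
  proof
    fix y assume y: "y \<in> - f ` (- U)"
    have "a = b" if "f a = y" "f b = y" for a b
    proof -
      have "a \<in> U" by (rule ccontr) (use y that(1) in blast)
      moreover have "b \<in> U" by (rule ccontr) (use y that(2) in blast)
      ultimately show ?thesis using inj_onD[OF U(3)] that by metis
    qed
    then show "y \<in> {y. \<forall>a b. f a = y \<longrightarrow> f b = y \<longrightarrow> a = b}" by blast
  qed
  then have "finite (- f ` (- U))" using finite_few_preimages[OF d2] finite_subset by blast
  moreover have "infinite (- f ` (- U))"
  proof -
    have "eventually (\<lambda>y. y \<in> - f ` (- U)) (sphere_nhds e)"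
      unfolding eventually_sphere_nhds_open using op \<open>e \<in> - f ` (- U)\<close> by blast
    then obtain S where S: "open S" "chart e e \<in> S" "\<forall>w\<in>S. chart_inv e w \<in> - f ` (- U)"
      unfolding eventually_sphere_nhds eventually_nhds by blast
    have "infinite S"
    proof
      assume "finite S"
      then have "open S \<longrightarrow> S = {}" using finite_imp_not_open by blast
      then show False using S by blast
    qed
    moreover have "inj_on (chart_inv e) S" by (rule inj_on_inverseI[of _ "chart e"]) simp
    ultimately have "infinite (chart_inv e ` S)" using finite_imageD by blast
    moreover have "chart_inv e ` S \<subseteq> - f ` (- U)"
    proof (rule image_subsetI)
      fix w assume "w \<in> S"
      then show "chart_inv e w \<in> - f ` (- U)" by (rule S(3)[rule_format])
    qed
    ultimately show ?thesis using finite_subset by blast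
  qed
  ultimately show False by blast
qed

section \<open>The postcritical set and its iterated preimages\<close>

definition postcritical :: "sphere set" where
  "postcritical = {y. \<exists>c n. critical_point f c \<and> n > 0 \<and> y = (f ^^ n) c}"

lemma finite_postcritical: "finite postcritical"
proof -
  have orb: "finite {y. \<exists>n. y = (f ^^ n) c}" if c: "critical_point f c" for c
  proof -
    obtain N where N: "repelling_periodic_point f ((f ^^ N) c)"
      using pcf c by (auto simp: strictly_postcritically_finite_def)
    then have per: "periodic_point f ((f ^^ N) c)" by (simp add: repelling_periodic_point_def)
    define r where "r = period f ((f ^^ N) c)"
    have r: "r > 0" "(f ^^ r) ((f ^^ N) c) = (f ^^ N) c" using period_properties[OF per] by (auto simp: r_def)
    have "{y. \<exists>n. y = (f ^^ n) c} \<subseteq> (\<lambda>n. (f ^^ n) c) ` {..N + r}"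
    proof
      fix y assume "y \<in> {y. \<exists>n. y = (f ^^ n) c}"
      then obtain n where n: "y = (f ^^ n) c" by blast
      show "y \<in> (\<lambda>n. (f ^^ n) c) ` {..N + r}"
      proof (cases "n \<le> N")
        case True
        then show ?thesis using n by auto
      next
        case False
        then have "n = (n - N) + N" by simp
        then have "y = (f ^^ (n - N)) ((f ^^ N) c)" using n by (metis comp_apply funpow_add)
        also have "\<dots> = (f ^^ ((n - N) mod r)) ((f ^^ N) c)" using funpow_mod_eq[OF r(2)] by simp
        also have "\<dots> = (f ^^ ((n - N) mod r + N)) c" by (simp add: funpow_add)
        finally show ?thesis using mod_less_divisor[OF r(1), of "n - N"] by auto
      qed
    qed
    then show ?thesis using finite_subset by blast
  qed
  have "postcritical \<subseteq> (\<Union>c\<in>{c. critical_point f c}. {y. \<exists>n. y = (f ^^ n) c})"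
    unfolding postcritical_def by blast
  moreover have "finite (\<Union>c\<in>{c. critical_point f c}. {y. \<exists>n. y = (f ^^ n) c})"
    by (rule finite_UN_I[OF finite_critical]) (rule orb, simp)
  ultimately show ?thesis by (rule finite_subset)
qed

lemma f_postcritical: "x \<in> postcritical \<Longrightarrow> f x \<in> postcritical"
proof -
  assume "x \<in> postcritical"
  then obtain c n where "critical_point f c" "n > 0" "x = (f ^^ n) c" by (auto simp: postcritical_def)
  then have "critical_point f c \<and> Suc n > 0 \<and> f x = (f ^^ Suc n) c" by simp
  then show ?thesis unfolding postcritical_def by blast
qed

lemma funpow_postcritical: "x \<in> postcritical \<Longrightarrow> (f ^^ n) x \<in> postcritical"
  by (induction n) (auto intro: f_postcritical)

text \<open>The postcritical set itself may have only two points; its iterated preimages grow without bound.\<close>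

definition pre_postcritical :: "nat \<Rightarrow> sphere set" where
  "pre_postcritical m = {x. (f ^^ m) x \<in> postcritical}"

lemma finite_pre_postcritical: "finite (pre_postcritical m)"
proof (induction m)
  case 0
  then show ?case using finite_postcritical by (simp add: pre_postcritical_def)
next
  case (Suc m)
  have "pre_postcritical (Suc m) = (\<Union>y\<in>pre_postcritical m. {x. f x = y})"
    by (auto simp: pre_postcritical_def funpow_swap1)
  then show ?case using Suc finite_fibre_ratio by simp
qed

lemma f_pre_postcritical: "x \<in> pre_postcritical m \<Longrightarrow> f x \<in> pre_postcritical m"
  using f_postcritical by (auto simp: pre_postcritical_def funpow_swap1[symmetric])

lemma postcritical_subset: "postcritical \<subseteq> pre_postcritical m"
  using funpow_postcritical by (auto simp: pre_postcritical_def)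

text \<open>The sets increase strictly with \<open>m\<close>: equality of two consecutive ones would
  make them finite and backward invariant.\<close>

lemma card_pre_postcritical: "m \<le> card (pre_postcritical m)"
proof (induction m)
  case (Suc m)
  have sub: "pre_postcritical m \<subseteq> pre_postcritical (Suc m)"
    using f_postcritical by (auto simp: pre_postcritical_def)
  have "pre_postcritical m \<noteq> pre_postcritical (Suc m)"
  proof
    assume eq: "pre_postcritical m = pre_postcritical (Suc m)"
    obtain c where "critical_point f c" using critical_exists[OF d2] by blast
    then have "f c \<in> postcritical" unfolding postcritical_def by (intro CollectI exI[of _ c] exI[of _ 1]) simp
    then have ne: "pre_postcritical m \<noteq> {}" using postcritical_subset by blast
    show False
    proof (rule no_finite_backward_invariant[OF finite_pre_postcritical ne])
      fix x assume "f x \<in> pre_postcritical m"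
      then have "x \<in> pre_postcritical (Suc m)" by (simp add: pre_postcritical_def funpow_swap1)
      then show "x \<in> pre_postcritical m" using eq by simp
    qed
  qed
  then have "card (pre_postcritical m) < card (pre_postcritical (Suc m))"
    using sub finite_pre_postcritical by (intro psubset_card_mono) auto
  then show ?case using Suc by simp
qed simp

lemma critical_value_in: "critical_point f x \<Longrightarrow> f x \<in> pre_postcritical m"
  using postcritical_subset unfolding postcritical_def by (force intro: exI[of _ 1])

text \<open>The point \<open>x\<close> lies on the repelling cycle on which a critical orbit ends,
  at a point \<open>pt\<close>. The derivatives of \<open>f ^^ n\<close> at \<open>x\<close> and at
  \<open>pt\<close> agree: compare them along \<open>f ^^ i\<close>, which takes \<open>x\<close> to
  \<open>pt\<close>, and cancel its derivative. This is nonzero as a factor of a derivative of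
  modulus above 1.\<close>

lemma periodic_expanding:
  assumes x: "x \<in> pre_postcritical m" and n: "n > 0" "(f ^^ n) x = x"
  shows "norm (deriv_iter n x) > 1"
proof -
  have "(f ^^ m) x \<in> postcritical" using x by (simp add: pre_postcritical_def)
  then obtain c l where c: "critical_point f c" "(f ^^ m) x = (f ^^ l) c" by (auto simp: postcritical_def)
  obtain N where N: "repelling_periodic_point f ((f ^^ N) c)"
    using pcf c(1) by (auto simp: strictly_postcritically_finite_def)
  define pt where "pt = (f ^^ N) c"
  \<comment> \<open>A multiple of the return time \<open>n\<close> that is at least
    \<open>m + N\<close>, so that the subtractions in \<open>j\<close> do not truncate;
    \<open>j\<close> counts the steps from \<open>pt\<close> to \<open>x\<close>.\<close>
  define t where "t = n * Suc (m + N)"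
  have tx: "(f ^^ t) x = x" unfolding t_def by (rule funpow_fixed_mult[OF n(2)])
  have tm: "t \<ge> m + N"
  proof -
    have "1 * Suc (m + N) \<le> n * Suc (m + N)" by (rule mult_le_mono1) (use n(1) in simp)
    then show ?thesis by (simp add: t_def)
  qed
  define j where "j = t - m + l - N"
  have xj: "(f ^^ j) pt = x"
  proof -
    have "(f ^^ (t - m)) ((f ^^ m) x) = x" using tx tm by (simp flip: funpow_add o_apply[of "f ^^ (t - m)"])
    then have "(f ^^ (t - m + l)) c = x" using c(2) by (simp add: funpow_add)
    moreover have "t - m + l = j + N" using tm by (simp add: j_def)
    ultimately show ?thesis by (simp add: pt_def funpow_add)
  qed
  have per: "periodic_point f pt" using N by (simp add: pt_def repelling_periodic_point_def)
  define s where "s = period f pt * Suc j"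
  have s: "s > j" "(f ^^ s) pt = pt"
  proof -
    have "j < 1 * Suc j" by simp
    also have "\<dots> \<le> period f pt * Suc j"
      by (rule mult_le_mono1) (use period_properties(1)[OF per] in simp)
    finally show "s > j" unfolding s_def .
    show "(f ^^ s) pt = pt" unfolding s_def by (rule funpow_fixed_mult[OF period_properties(2)[OF per]])
  qed
  define i where "i = s - j"
  have si: "s = i + j" using s(1) by (simp add: i_def)
  have ix: "(f ^^ i) x = pt" using s(2) xj by (simp add: si funpow_add)
  have ds: "deriv_iter s pt = deriv_iter i x * deriv_iter j pt" unfolding si deriv_iter_add xj ..
  have "norm (deriv_iter s pt) > 1" using N s by (intro repelling_iter) (auto simp: pt_def)
  then have i0: "deriv_iter i x \<noteq> 0" using ds by auto
  have np: "(f ^^ n) pt = pt"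
  proof -
    have "(f ^^ n) ((f ^^ i) x) = (f ^^ i) ((f ^^ n) x)"
      by (simp add: add.commute flip: funpow_add o_apply[of "f ^^ n"] o_apply[of "f ^^ i"])
    then show ?thesis using ix n(2) by simp
  qed
  have "deriv_iter i x * deriv_iter n x = deriv_iter (i + n) x" unfolding deriv_iter_add n(2) ..
  also have "\<dots> = deriv_iter (n + i) x" by (simp add: add.commute)
  also have "\<dots> = deriv_iter n pt * deriv_iter i x" unfolding deriv_iter_add ix ..
  finally have "deriv_iter n x = deriv_iter n pt" using i0 by simp
  then show ?thesis using repelling_iter[OF N] n(1) np by (simp add: pt_def)
qed

text \<open>Otherwise all iterated preimages of \<open>x\<close> would form a finite backward
  invariant set.\<close>

lemma backward_escape:
  assumes "x \<in> pre_postcritical m"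
  shows "\<exists>k y. y \<notin> pre_postcritical m \<and> (f ^^ k) y = x"
proof (rule ccontr)
  assume n: "\<not> ?thesis"
  define E where "E = {y. \<exists>k. (f ^^ k) y = x}"
  have "E \<subseteq> pre_postcritical m" using n by (auto simp: E_def)
  then have "finite E" using finite_pre_postcritical finite_subset by blast
  moreover have "x \<in> E" unfolding E_def by (intro CollectI exI[of _ 0]) simp
  then have "E \<noteq> {}" by blast
  ultimately show False
  proof (rule no_finite_backward_invariant)
    fix y assume "f y \<in> E"
    then obtain k where "(f ^^ k) (f y) = x" by (auto simp: E_def)
    then have "(f ^^ Suc k) y = x" by (simp add: funpow_swap1)
    then show "y \<in> E" unfolding E_def by blast
  qed
qed

end

section \<open>Normalisation of three points\<close>

lemma ratio_moebius:
  fixes \<alpha> \<beta> \<gamma> \<delta> :: complex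
  assumes "\<alpha> * \<delta> - \<beta> * \<gamma> \<noteq> 0"
  shows "ratio [:\<beta>, \<alpha>:] [:\<delta>, \<gamma>:] 1 (ratio_map [:\<beta>, \<alpha>:] [:\<delta>, \<gamma>:])"
proof
  show "[:\<delta>, \<gamma>:] \<noteq> 0" using assms by auto
  show "coprime [:\<beta>, \<alpha>:] [:\<delta>, \<gamma>:]"
  proof (rule coprimeI)
    fix e assume "e dvd [:\<beta>, \<alpha>:]" "e dvd [:\<delta>, \<gamma>:]"
    then have "e dvd smult \<alpha> [:\<delta>, \<gamma>:] - smult \<gamma> [:\<beta>, \<alpha>:]" by (intro dvd_diff dvd_smult)
    also have "smult \<alpha> [:\<delta>, \<gamma>:] - smult \<gamma> [:\<beta>, \<alpha>:] = [:\<alpha> * \<delta> - \<beta> * \<gamma>:]" by (simp add: mult.commute)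
    finally have e: "e dvd [:\<alpha> * \<delta> - \<beta> * \<gamma>:]" .
    have "is_unit [:\<alpha> * \<delta> - \<beta> * \<gamma>:]" using assms by (simp add: is_unit_const_poly_iff dvd_field_iff)
    then show "is_unit e" by (rule dvd_trans[OF e])
  qed
  show "1 = max (degree [:\<beta>, \<alpha>:]) (degree [:\<delta>, \<gamma>:])" using assms by auto
qed auto

text \<open>\<open>M\<close> is the cross-ratio map \<open>k * (z - a) / (z - c)\<close>, with
  \<open>k\<close> chosen for the value 1 at \<open>b\<close>, and \<open>N\<close> is its inverse.
  Both are instances of \<open>ratio\<close>, which yields their derivatives.\<close>

lemma moebius_exists:
  fixes a b c :: complex
  assumes "a \<noteq> b" "b \<noteq> c" "a \<noteq> c"
  obtains M N where "\<forall>x. sphere_has_deriv M x (sphere_deriv M x)" "\<forall>x. sphere_has_deriv N x (sphere_deriv N x)"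
    "\<forall>x. N (M x) = x" "\<forall>x. M (N x) = x"
    "M (Some a) = Some 0" "M (Some b) = Some 1" "M (Some c) = None"
proof -
  define k where "k = (b - c) / (b - a)"
  have k: "k \<noteq> 0" using assms by (simp add: k_def)
  define M where "M = ratio_map [:- (k * a), k:] [:- c, 1:]"
  define N where "N = ratio_map [:- (k * a), c:] [:- k, 1:]"
  interpret M: ratio "[:- (k * a), k:]" "[:- c, 1:]" 1 M
    unfolding M_def by (rule ratio_moebius) (use k assms in \<open>auto simp: algebra_simps\<close>)
  interpret N: ratio "[:- (k * a), c:]" "[:- k, 1:]" 1 N
    unfolding N_def by (rule ratio_moebius) (use k assms in \<open>auto simp: algebra_simps\<close>)
  have M_Some: "M (Some z) = (if z = c then None else Some (k * (z - a) / (z - c)))" for z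
    by (simp add: M_def algebra_simps)
  have N_Some: "N (Some w) = (if w = k then None else Some ((c * w - k * a) / (w - k)))" for w
    by (simp add: N_def algebra_simps)
  have M_None: "M None = Some k" using k by (simp add: M_def)
  have N_None: "N None = Some c" by (simp add: N_def)
  have NM: "N (M x) = x" for x
  proof (cases x)
    case (Some z)
    show ?thesis
    proof (cases "z = c")
      case False
      define w where "w = k * (z - a) / (z - c)"
      have w: "w * (z - c) = k * (z - a)" using False by (simp add: w_def)
      have wk: "w \<noteq> k"
      proof
        assume "w = k"
        then have "k * (c - a) = 0" using w by (auto simp: algebra_simps)
        then show False using k assms by auto
      qed
      have "c * w - k * a = z * (w - k)" using w by (simp add: algebra_simps)
      then show ?thesis using False wk by (simp add: Some M_Some w_def[symmetric] N_Some)
    qed (simp add: Some M_Some N_None)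
  qed (simp add: M_None N_Some)
  have MN: "M (N x) = x" for x
  proof -
    \<comment> \<open>Surjectivity of \<open>M\<close> turns its left inverse into a two-sided
      one.\<close>
    obtain z where "x = M z" using surjD[OF M.surj_ratio] by blast
    then show ?thesis by (simp add: NM)
  qed
  show thesis
  proof (rule that[of M N])
    show "M (Some b) = Some 1" using assms k by (simp add: M_Some k_def)
  qed (use M.has_deriv N.has_deriv NM MN assms in \<open>auto simp: M_Some\<close>)
qed

lemma sphere_has_deriv_finite:
  assumes F: "sphere_has_deriv F (Some u) D" and n: "F (Some u) \<noteq> None"
  shows "((\<lambda>u. the (F (Some u))) has_field_derivative D) (at u)"
proof -
  have op: "openin sphere_topology (range Some)" by (subst openin_sphere_Some_image) simp
  have "eventually (\<lambda>y. y \<in> range Some) (sphere_nhds (F (Some u)))"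
    unfolding eventually_sphere_nhds_open by (rule exI[of _ "range Some"]) (use op n in \<open>simp add: image_iff\<close>)
  then have "eventually (\<lambda>y. F y \<in> range Some) (sphere_nhds (Some u))"
    by (rule eventually_compose_filterlim) (use F in \<open>simp add: sphere_has_deriv_def\<close>)
  then have "eventually (\<lambda>w. F (Some w) \<in> range Some) (nhds u)"
    unfolding eventually_sphere_nhds by (simp add: chart_inv_def)
  then have ev: "eventually (\<lambda>w. chart (F (Some u)) (F (chart_inv (Some u) w)) = the (F (Some w))) (nhds u)"
  proof eventually_elim
    case (elim w)
    then obtain v where "F (Some w) = Some v" by blast
    then show ?case using n by (simp add: chart_def chart_inv_def del: not_None_eq)
  qed
  have "((\<lambda>w. chart (F (Some u)) (F (chart_inv (Some u) w))) has_field_derivative D) (at u)"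
    using F by (simp add: sphere_has_deriv_def)
  then show ?thesis using DERIV_cong_ev[OF refl ev refl] by simp
qed

lemma conjugate_funpow:
  assumes "\<forall>x. N (M x) = x" "\<forall>x. M (N x) = x"
  shows "((\<lambda>x. M (f (N x))) ^^ n) x = M ((f ^^ n) (N x))"
  using assms by (induction n) auto

lemma sphere_has_deriv_continuous:
  "\<forall>x. sphere_has_deriv M x (sphere_deriv M x) \<Longrightarrow> continuous_map sphere_topology sphere_topology M"
  by (rule continuous_map_sphereI) (simp add: sphere_has_deriv_def)

text \<open>One of the four points may be infinity, while \<open>moebius_exists\<close> asks for
  three finite ones.\<close>

lemma three_finite_points:
  assumes "card S \<ge> 4"
  obtains a b c where "a \<noteq> b" "b \<noteq> c" "a \<noteq> c" "Some a \<in> S" "Some b \<in> S" "Some c \<in> S"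
proof -
  have f: "finite S" using assms by (intro card_ge_0_finite) simp
  have "card (S - {None}) \<ge> 3" using assms f by (cases "None \<in> S") (auto simp: card_Diff_singleton)
  then obtain T where T: "T \<subseteq> S - {None}" "card T = 3" by (meson obtain_subset_with_card_n)
  then obtain x y z where xyz: "T = {x, y, z}" "x \<noteq> y" "y \<noteq> z" "x \<noteq> z" by (auto simp: card_3_iff)
  then show thesis using that[of "the x" "the y" "the z"] T(1) by auto
qed

context pcf_ratio
begin

text \<open>Local injectivity off the preimage of \<open>Z\<close> holds because critical values lie
  in \<open>pre_postcritical m\<close>. Repulsion comes from \<open>periodic_expanding\<close> and
  \<open>repelling_expansive\<close>, applied to \<open>f\<close> and carried over by the
  homeomorphism \<open>M\<close>; preimages outside \<open>Z\<close> come from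
  \<open>backward_escape\<close>.\<close>

lemma expanding_conjugate:
  fixes M N m
  defines "F \<equiv> \<lambda>x. M (f (N x))" and "Z \<equiv> M ` pre_postcritical m"
  assumes M: "\<forall>x. sphere_has_deriv M x (sphere_deriv M x)" and N: "\<forall>x. sphere_has_deriv N x (sphere_deriv N x)"
    and NM: "\<forall>x. N (M x) = x" and MN: "\<forall>x. M (N x) = x"
    and Z: "None \<in> Z" "Some 0 \<in> Z" "Some 1 \<in> Z"
  shows "expanding_map F Z"
proof
  have cM: "continuous_map sphere_topology sphere_topology M" by (rule sphere_has_deriv_continuous[OF M])
  have cN: "continuous_map sphere_topology sphere_topology N" by (rule sphere_has_deriv_continuous[OF N])
  have Z_iff: "x \<in> Z \<longleftrightarrow> N x \<in> pre_postcritical m" for x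
  proof
    assume "N x \<in> pre_postcritical m"
    then have "M (N x) \<in> Z" unfolding Z_def by (rule imageI)
    then show "x \<in> Z" by (simp add: MN)
  qed (use NM in \<open>auto simp: Z_def\<close>)
  have Fn: "(F ^^ n) x = M ((f ^^ n) (N x))" for n x
    unfolding F_def by (rule conjugate_funpow[OF NM MN])
  have op: "openin sphere_topology {x. N x \<in> U}" if "openin sphere_topology U" for U
    using openin_continuous_map_preimage[OF cN that] by simp
  show "finite Z" unfolding Z_def using finite_pre_postcritical by simp
  show "None \<in> Z" "Some 0 \<in> Z" "Some 1 \<in> Z" by (fact Z)+
  show "F ` Z \<subseteq> Z"
    using f_pre_postcritical NM by (auto simp: F_def Z_def)
  show "continuous_map sphere_topology sphere_topology F"
    using continuous_map_compose[OF continuous_map_compose[OF cN continuous] cM] by (simp add: F_def o_def)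
  show "surj F"
    unfolding surj_def
  proof
    fix y
    obtain x where x: "N y = f x" using surjD[OF surj_ratio] by blast
    have "F (M x) = M (N y)" by (simp add: F_def NM x)
    then have "y = F (M x)" by (simp add: MN)
    then show "\<exists>x. y = F x" by blast
  qed
  show "finite {x. F x = y}" for y
  proof -
    have "{x. F x = y} \<subseteq> M ` {x. f x = N y}"
    proof
      fix x assume "x \<in> {x. F x = y}"
      then have "f (N x) = N y" using NM by (auto simp: F_def)
      moreover have "x = M (N x)" by (simp add: MN)
      ultimately show "x \<in> M ` {x. f x = N y}" by blast
    qed
    then show ?thesis using finite_fibre_ratio finite_surj by blast
  qed
  show "(\<lambda>u. the (F (Some u))) holomorphic_on {u. F (Some u) \<notin> Z}"
    unfolding holomorphic_on_def
  proof
    fix u assume u: "u \<in> {u. F (Some u) \<notin> Z}"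
    have "F (Some u) \<noteq> None"
    proof
      assume "F (Some u) = None"
      then show False using u Z(1) by simp
    qed
    moreover have "\<exists>D. sphere_has_deriv F (Some u) D"
      unfolding F_def
      using sphere_has_deriv_compose[OF sphere_has_deriv_compose[OF N[rule_format] has_deriv] M[rule_format]] by blast
    ultimately show "(\<lambda>u. the (F (Some u))) field_differentiable at u within {u. F (Some u) \<notin> Z}"
      using sphere_has_deriv_finite field_differentiable_at_within field_differentiable_def by blast
  qed
  show "\<exists>U. open U \<and> u \<in> U \<and> inj_on (\<lambda>u. F (Some u)) U" if u: "F (Some u) \<notin> Z" for u
  proof -
    have "\<not> critical_point f (N (Some u))"
      using u critical_value_in NM by (auto simp: F_def Z_iff)
    then obtain U where U: "openin sphere_topology U" "N (Some u) \<in> U" "inj_on f U"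
      by (rule locally_injective)
    have "inj_on (\<lambda>u. F (Some u)) {u. N (Some u) \<in> U}"
    proof (rule inj_onI)
      fix v w assume vw: "v \<in> {u. N (Some u) \<in> U}" "w \<in> {u. N (Some u) \<in> U}" "F (Some v) = F (Some w)"
      then have "N (F (Some v)) = N (F (Some w))" by simp
      then have "f (N (Some v)) = f (N (Some w))" by (simp add: F_def NM)
      then have "N (Some v) = N (Some w)" by (rule inj_onD[OF U(3)]) (use vw in auto)
      then have "M (N (Some v)) = M (N (Some w))" by simp
      then show "v = w" by (simp add: MN)
    qed
    moreover have "open {u. N (Some u) \<in> U}" using open_Some_preimage[OF op[OF U(1)]] by simp
    ultimately show ?thesis using U(2) by blast
  qed
  show "\<exists>U. openin sphere_topology U \<and> p \<in> U \<and> (\<forall>z. (\<forall>k. (F ^^ (n * k)) z \<in> U) \<longrightarrow> z = p)"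
    if p: "p \<in> Z" "n > 0" "(F ^^ n) p = p" for p n
  proof -
    have "N ((F ^^ n) p) = (f ^^ n) (N p)" by (simp add: Fn NM)
    then have fx: "(f ^^ n) (N p) = N p" by (simp add: p(3))
    have "norm (deriv_iter n (N p)) > 1"
      by (rule periodic_expanding) (use p fx in \<open>auto simp: Z_iff\<close>)
    from repelling_expansive[OF has_deriv_iter fx this] obtain U where
      U: "openin sphere_topology U" "N p \<in> U" "\<forall>z. (\<forall>k. ((f ^^ n) ^^ k) z \<in> U) \<longrightarrow> z = N p" by blast
    have "z = p" if z: "\<forall>k. (F ^^ (n * k)) z \<in> {x. N x \<in> U}" for z
    proof -
      have "\<forall>k. ((f ^^ n) ^^ k) (N z) \<in> U" using z NM by (simp add: Fn funpow_mult)
      then have "M (N z) = M (N p)" using U(3) by simp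
      then show ?thesis by (simp add: MN)
    qed
    then show ?thesis using op[OF U(1)] U(2) by blast
  qed
  show "\<exists>k y. y \<notin> Z \<and> (F ^^ k) y = p" if "p \<in> Z" for p
  proof -
    obtain k y where ky: "y \<notin> pre_postcritical m" "(f ^^ k) y = N p"
      using backward_escape \<open>p \<in> Z\<close> unfolding Z_iff by blast
    then have "M y \<notin> Z" "(F ^^ k) (M y) = p" using NM MN by (simp_all add: Z_iff Fn)
    then show ?thesis by blast
  qed
qed

text \<open>The measure is pushed forward by \<open>M\<close> and the test functions are composed
  with \<open>N\<close>, so that integrals and Birkhoff sums agree on both sides of the
  conjugacy.\<close>

theorem periodic_approximation:
  assumes \<mu>: "\<mu> \<in> invariant_measures f"
    and G: "finite G" "\<And>g. g \<in> G \<Longrightarrow> continuous_map sphere_topology euclideanreal g" and \<epsilon>: "\<epsilon> > 0"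
  shows "\<exists>x T. T > 0 \<and> (f ^^ T) x = x \<and>
    (\<forall>g\<in>G. \<bar>birkhoff_sum f g T x / real T - (\<integral>x. g x \<partial>\<mu>)\<bar> < \<epsilon>)"
proof -
  \<comment> \<open>By \<open>card_pre_postcritical\<close> the level 4 has at least four points,
    enough for three finite ones.\<close>
  obtain a b c where abc: "a \<noteq> b" "b \<noteq> c" "a \<noteq> c"
    and S: "Some a \<in> pre_postcritical 4" "Some b \<in> pre_postcritical 4" "Some c \<in> pre_postcritical 4"
    by (rule three_finite_points[OF card_pre_postcritical])
  obtain M N where M: "\<forall>x. sphere_has_deriv M x (sphere_deriv M x)"
    and N: "\<forall>x. sphere_has_deriv N x (sphere_deriv N x)"
    and NM: "\<forall>x. N (M x) = x" and MN: "\<forall>x. M (N x) = x"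
    and v: "M (Some a) = Some 0" "M (Some b) = Some 1" "M (Some c) = None"
    by (rule moebius_exists[OF abc])
  define F where "F x = M (f (N x))" for x
  have Fn: "(F ^^ n) x = M ((f ^^ n) (N x))" for n x
    unfolding F_def[abs_def] by (rule conjugate_funpow[OF NM MN])
  interpret expanding_map F "M ` pre_postcritical 4"
    unfolding F_def[abs_def]
    by (rule expanding_conjugate[OF M N NM MN])
      (use imageI[OF S(1), of M] imageI[OF S(2), of M] imageI[OF S(3), of M] v in simp_all)
  have mM: "M \<in> measurable sphere_borel sphere_borel" and mN: "N \<in> measurable sphere_borel sphere_borel"
    and mf: "f \<in> measurable sphere_borel sphere_borel"
    by (intro measurable_sphere_continuous sphere_has_deriv_continuous M N continuous)+
  have mF: "F \<in> measurable sphere_borel sphere_borel"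
    by (rule measurable_sphere_continuous[OF cont_F])
  have P: "prob_space \<mu>" and s: "sets \<mu> = sets sphere_borel" and inv: "distr \<mu> sphere_borel f = \<mu>"
    using \<mu> by (auto simp: invariant_measures_def sphere_prob_measures_def)
  have mc: "measurable \<mu> sphere_borel = measurable sphere_borel sphere_borel"
    by (rule measurable_cong_sets[OF s refl])
  define \<nu> where "\<nu> = distr \<mu> sphere_borel M"
  have "distr \<nu> sphere_borel F = distr \<mu> sphere_borel (F \<circ> M)"
    unfolding \<nu>_def by (rule distr_distr) (use mF mM mc in auto)
  also have "F \<circ> M = M \<circ> f" using NM by (auto simp: F_def)
  also have "distr \<mu> sphere_borel (M \<circ> f) = distr (distr \<mu> sphere_borel f) sphere_borel M"
    by (rule distr_distr[symmetric]) (use mf mM mc in auto)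
  finally have "distr \<nu> sphere_borel F = \<nu>" by (simp add: inv \<nu>_def)
  moreover have "prob_space \<nu>"
    unfolding \<nu>_def by (rule prob_space.prob_space_distr[OF P]) (use mM mc in auto)
  ultimately have \<nu>: "\<nu> \<in> invariant_measures F"
    by (simp add: invariant_measures_def sphere_prob_measures_def \<nu>_def)
  have cG: "continuous_map sphere_topology euclideanreal h" if h: "h \<in> (\<lambda>g. g \<circ> N) ` G" for h
  proof -
    obtain g where g: "g \<in> G" "h = g \<circ> N" by (rule imageE[OF h])
    show ?thesis unfolding g(2) by (rule continuous_map_compose[OF sphere_has_deriv_continuous[OF N] G(2)[OF g(1)]])
  qed
  have "\<exists>y T. T > 0 \<and> (F ^^ T) y = y \<and>
      (\<forall>h\<in>(\<lambda>g. g \<circ> N) ` G. \<bar>birkhoff_sum F h T y / real T - (\<integral>x. h x \<partial>\<nu>)\<bar> < \<epsilon>)"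
    by (rule periodic_orbit_approximation[OF \<nu> finite_imageI[OF G(1)] _ \<epsilon>]) (rule cG)
  then obtain y T where T: "T > 0" "(F ^^ T) y = y"
    and ap: "\<forall>h\<in>(\<lambda>g. g \<circ> N) ` G. \<bar>birkhoff_sum F h T y / real T - (\<integral>x. h x \<partial>\<nu>)\<bar> < \<epsilon>"
    by blast
  have "N ((F ^^ T) y) = (f ^^ T) (N y)" by (simp add: Fn NM)
  then have "(f ^^ T) (N y) = N y" by (simp add: T(2))
  moreover have "\<bar>birkhoff_sum f g T (N y) / real T - (\<integral>x. g x \<partial>\<mu>)\<bar> < \<epsilon>" if g: "g \<in> G" for g
  proof -
    have "(\<integral>x. (g \<circ> N) x \<partial>\<nu>) = (\<integral>x. (g \<circ> N) (M x) \<partial>\<mu>)"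
      unfolding \<nu>_def
    proof (rule integral_distr)
      show "M \<in> measurable \<mu> sphere_borel" unfolding mc by (rule mM)
      show "g \<circ> N \<in> borel_measurable sphere_borel"
        by (rule borel_measurable_sphere_continuous, rule cG, rule imageI, rule g)
    qed
    then have "(\<integral>x. (g \<circ> N) x \<partial>\<nu>) = (\<integral>x. g x \<partial>\<mu>)" using NM by simp
    moreover have "birkhoff_sum F (g \<circ> N) T y = birkhoff_sum f g T (N y)"
      using NM by (simp add: birkhoff_sum_def Fn)
    ultimately show ?thesis using bspec[OF ap imageI[OF g]] by simp
  qed
  ultimately show ?thesis using T(1) by blast
qed

end

section \<open>Density of the periodic orbit measures\<close>

lemma topspace_weak_star: "topspace weak_star_topology = sphere_prob_measures"
proof
  show "topspace weak_star_topology \<subseteq> sphere_prob_measures"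
    by (auto simp: weak_star_topology_def)
  have "{\<mu> \<in> sphere_prob_measures. integral\<^sup>L \<mu> (\<lambda>x. 0) \<in> UNIV} \<in>
    {{\<mu> \<in> sphere_prob_measures. integral\<^sup>L \<mu> g \<in> U} | g U.
      continuous_map sphere_topology euclideanreal g \<and> open U}"
    by (intro CollectI exI[of _ "\<lambda>x. 0"] exI[of _ UNIV]) simp
  then show "sphere_prob_measures \<subseteq> topspace weak_star_topology"
    unfolding weak_star_topology_def topology_generated_by_topspace by blast
qed

text \<open>Induction over the generated topology; for an intersection the sets of test functions
  are united and the smaller \<epsilon> is taken.\<close>

lemma weak_star_basic_neighbourhood:
  assumes "openin weak_star_topology W" "\<mu> \<in> W"
  shows "\<exists>G \<epsilon>. finite G \<and> (\<forall>g\<in>G. continuous_map sphere_topology euclideanreal g) \<and> \<epsilon> > 0 \<and>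
    {\<nu> \<in> sphere_prob_measures. \<forall>g\<in>G. \<bar>integral\<^sup>L \<nu> g - integral\<^sup>L \<mu> g\<bar> < \<epsilon>} \<subseteq> W"
proof -
  have "generate_topology_on {{\<mu> \<in> sphere_prob_measures. integral\<^sup>L \<mu> g \<in> U} | g U.
      continuous_map sphere_topology euclideanreal g \<and> open U} W"
    using assms(1) by (simp add: weak_star_topology_def openin_topology_generated_by_iff)
  then show ?thesis using assms(2)
  proof (induction rule: generate_topology_on.induct)
    case Empty
    then show ?case by simp
  next
    case (Int A B)
    obtain G \<epsilon> where G: "finite G" "\<forall>g\<in>G. continuous_map sphere_topology euclideanreal g" "\<epsilon> > 0"
      "{\<nu> \<in> sphere_prob_measures. \<forall>g\<in>G. \<bar>integral\<^sup>L \<nu> g - integral\<^sup>L \<mu> g\<bar> < \<epsilon>} \<subseteq> A"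
      using Int by blast
    obtain H \<delta> where H: "finite H" "\<forall>g\<in>H. continuous_map sphere_topology euclideanreal g" "\<delta> > 0"
      "{\<nu> \<in> sphere_prob_measures. \<forall>g\<in>H. \<bar>integral\<^sup>L \<nu> g - integral\<^sup>L \<mu> g\<bar> < \<delta>} \<subseteq> B"
      using Int by blast
    have "{\<nu> \<in> sphere_prob_measures. \<forall>g\<in>G \<union> H. \<bar>integral\<^sup>L \<nu> g - integral\<^sup>L \<mu> g\<bar> < min \<epsilon> \<delta>} \<subseteq> A \<inter> B"
    proof
      fix \<nu> assume \<nu>: "\<nu> \<in> {\<nu> \<in> sphere_prob_measures. \<forall>g\<in>G \<union> H. \<bar>integral\<^sup>L \<nu> g - integral\<^sup>L \<mu> g\<bar> < min \<epsilon> \<delta>}"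
      then have "\<nu> \<in> A" by (intro subsetD[OF G(4)]) simp
      moreover have "\<nu> \<in> B" using \<nu> by (intro subsetD[OF H(4)]) simp
      ultimately show "\<nu> \<in> A \<inter> B" by blast
    qed
    then show ?case
      by (intro exI[of _ "G \<union> H"] exI[of _ "min \<epsilon> \<delta>"]) (use G(1-3) H(1-3) in auto)
  next
    case (UN K)
    then obtain A where A: "A \<in> K" "\<mu> \<in> A" by blast
    from UN.IH[OF this] obtain G \<epsilon> where
      "finite G" "\<forall>g\<in>G. continuous_map sphere_topology euclideanreal g" "\<epsilon> > 0"
      "{\<nu> \<in> sphere_prob_measures. \<forall>g\<in>G. \<bar>integral\<^sup>L \<nu> g - integral\<^sup>L \<mu> g\<bar> < \<epsilon>} \<subseteq> A" by blast
    then show ?case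
      by (intro exI[of _ G] exI[of _ \<epsilon>] conjI) (use A(1) in auto)
  next
    case (Basis A)
    then obtain g U where g: "continuous_map sphere_topology euclideanreal g" "open U"
      and A: "A = {\<mu> \<in> sphere_prob_measures. integral\<^sup>L \<mu> g \<in> U}" by blast
    have "integral\<^sup>L \<mu> g \<in> U" using Basis(2) A by simp
    then obtain \<epsilon> where e: "\<epsilon> > 0" "\<forall>y. dist y (integral\<^sup>L \<mu> g) < \<epsilon> \<longrightarrow> y \<in> U"
      using g(2) unfolding open_dist by blast
    then show ?case
      by (intro exI[of _ "{g}"] exI[of _ \<epsilon>]) (use g(1) in \<open>auto simp: A dist_real_def\<close>)
  qed
qed

text \<open>Pushing forward the uniform distribution on the indices counts repeated points with
  multiplicity, so for a periodic orbit \<open>T\<close> may be any return time and need not be the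
  least period.\<close>

definition orbit_measure :: "(sphere \<Rightarrow> sphere) \<Rightarrow> sphere \<Rightarrow> nat \<Rightarrow> sphere measure" where
  "orbit_measure f x T = distr (measure_pmf (pmf_of_set {..<T})) sphere_borel (\<lambda>i. (f ^^ i) x)"

lemma integral_orbit_measure:
  assumes "T > 0" "g \<in> borel_measurable sphere_borel"
  shows "(\<integral>x. g x \<partial>orbit_measure f x T) = birkhoff_sum f g T x / real T"
proof -
  have "(\<integral>x. g x \<partial>orbit_measure f x T) = (\<integral>i. g ((f ^^ i) x) \<partial>measure_pmf (pmf_of_set {..<T}))"
    unfolding orbit_measure_def by (rule integral_distr) (use assms in auto)
  also have "\<dots> = birkhoff_sum f g T x / real T"
    using assms(1) by (subst integral_pmf_of_set) (auto simp: birkhoff_sum_def)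
  finally show ?thesis .
qed

lemma orbit_measure_prob: "orbit_measure f x T \<in> sphere_prob_measures"
  unfolding sphere_prob_measures_def orbit_measure_def
  by (auto intro!: prob_space.prob_space_distr measure_pmf.prob_space_axioms)

text \<open>Applying \<open>f\<close> corresponds to the shift of indices modulo \<open>T\<close>, a
  bijection that preserves the uniform distribution.\<close>

lemma orbit_measure_invariant:
  assumes f: "f \<in> measurable sphere_borel sphere_borel" and T: "T > 0" "(f ^^ T) x = x"
  shows "orbit_measure f x T \<in> invariant_measures f"
proof -
  let ?p = "pmf_of_set {..<T}"
  have bij: "bij_betw (\<lambda>i. Suc i mod T) {..<T} {..<T}"
  proof (rule bij_betwI[where g = "\<lambda>i. (i + (T - 1)) mod T"])
    show "(Suc i mod T + (T - 1)) mod T = i" if "i \<in> {..<T}" for i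
      using that T(1) by (cases "Suc i = T") (auto simp: mod_if)
    show "Suc ((i + (T - 1)) mod T) mod T = i" if "i \<in> {..<T}" for i
      using that T(1) by (cases "i = 0") (auto simp: mod_if)
  qed (use T(1) in auto)
  have "distr (orbit_measure f x T) sphere_borel f =
      distr (measure_pmf ?p) sphere_borel (f \<circ> (\<lambda>i. (f ^^ i) x))"
    unfolding orbit_measure_def by (rule distr_distr[OF f]) simp
  also have "f \<circ> (\<lambda>i. (f ^^ i) x) = (\<lambda>i. (f ^^ i) x) \<circ> (\<lambda>i. Suc i mod T)"
  proof
    fix i
    have "(f ^^ (Suc i mod T)) x = (f ^^ Suc i) x" by (rule funpow_mod_eq[OF T(2)])
    then show "(f \<circ> (\<lambda>i. (f ^^ i) x)) i = ((\<lambda>i. (f ^^ i) x) \<circ> (\<lambda>i. Suc i mod T)) i" by simp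
  qed
  also have "distr (measure_pmf ?p) sphere_borel ((\<lambda>i. (f ^^ i) x) \<circ> (\<lambda>i. Suc i mod T)) =
      distr (distr (measure_pmf ?p) (count_space UNIV) (\<lambda>i. Suc i mod T)) sphere_borel (\<lambda>i. (f ^^ i) x)"
    by (rule distr_distr[symmetric]) auto
  also have "distr (measure_pmf ?p) (count_space UNIV) (\<lambda>i. Suc i mod T) = measure_pmf ?p"
    unfolding map_pmf_rep_eq[symmetric]
    by (subst map_pmf_of_set_bij_betw[OF bij]) (use T(1) in auto)
  finally show ?thesis
    using orbit_measure_prob by (simp add: invariant_measures_def orbit_measure_def[symmetric])
qed

lemma orbit_measure_periodic:
  assumes f: "f \<in> measurable sphere_borel sphere_borel" and T: "T > 0" "(f ^^ T) x = x"
  shows "orbit_measure f x T \<in> periodic_orbit_measures f"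
proof -
  interpret prob_space "orbit_measure f x T" using orbit_measure_prob by (simp add: sphere_prob_measures_def)
  have "forward_orbit f x \<subseteq> (\<lambda>i. (f ^^ i) x) ` {..<T}"
    unfolding forward_orbit_def using T(1) funpow_mod_eq[OF T(2)] by (auto intro!: image_eqI[of _ _ "_ mod T"])
  then have "finite (forward_orbit f x)" using finite_surj by blast
  then have m: "forward_orbit f x \<in> sets sphere_borel"
    by (intro closedin_sphere_borel closedin_sphere_finite)
  have "emeasure (orbit_measure f x T) (forward_orbit f x) =
      emeasure (measure_pmf (pmf_of_set {..<T})) ((\<lambda>i. (f ^^ i) x) -` forward_orbit f x \<inter> UNIV)"
    unfolding orbit_measure_def by (subst emeasure_distr) (use m in auto)
  also have "(\<lambda>i. (f ^^ i) x) -` forward_orbit f x \<inter> UNIV = UNIV" by (auto simp: forward_orbit_def)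
  also have "emeasure (measure_pmf (pmf_of_set {..<T})) UNIV = 1"
    using measure_pmf.emeasure_space_1[of "pmf_of_set {..<T}"] by simp
  finally show ?thesis
    using orbit_measure_invariant[OF assms] T
    by (auto simp: periodic_orbit_measures_def periodic_point_def)
qed

theorem proposition2p3:
  fixes f :: "sphere \<Rightarrow> sphere" and d :: nat
  assumes "d \<ge> 2"
    and "rational_map f d"
    and "strictly_postcritically_finite f"
  shows "subtopology weak_star_topology (invariant_measures f) closure_of
           periodic_orbit_measures f = invariant_measures f"
proof
  have top: "topspace (subtopology weak_star_topology (invariant_measures f)) = invariant_measures f"
    by (auto simp: topspace_weak_star invariant_measures_def)
  show "subtopology weak_star_topology (invariant_measures f) closure_of
      periodic_orbit_measures f \<subseteq> invariant_measures f"
    using closure_of_subset_topspace[of "subtopology weak_star_topology (invariant_measures f)"] top by blast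
  obtain p q where "q \<noteq> 0" "coprime p q" "d = max (degree p) (degree q)" "f = ratio_map p q"
    using assms(2) unfolding rational_map_def by blast
  then interpret pcf_ratio p q d f
    by unfold_locales (use assms in auto)
  show "invariant_measures f \<subseteq> subtopology weak_star_topology (invariant_measures f) closure_of
      periodic_orbit_measures f"
  proof
    fix \<mu> assume \<mu>: "\<mu> \<in> invariant_measures f"
    have "\<exists>\<nu>. \<nu> \<in> periodic_orbit_measures f \<and> \<nu> \<in> V"
      if V: "\<mu> \<in> V" "openin (subtopology weak_star_topology (invariant_measures f)) V" for V
    proof -
      obtain W where W: "openin weak_star_topology W" "V = W \<inter> invariant_measures f"
        using V(2) unfolding openin_subtopology by blast
      have "\<mu> \<in> W" using V(1) W(2) by blast
      from weak_star_basic_neighbourhood[OF W(1) this] obtain G \<epsilon> where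
        G: "finite G" "\<forall>g\<in>G. continuous_map sphere_topology euclideanreal g" "\<epsilon> > 0"
        "{\<nu> \<in> sphere_prob_measures. \<forall>g\<in>G. \<bar>integral\<^sup>L \<nu> g - integral\<^sup>L \<mu> g\<bar> < \<epsilon>} \<subseteq> W"
        by blast
      have "\<exists>x T. T > 0 \<and> (f ^^ T) x = x \<and>
          (\<forall>g\<in>G. \<bar>birkhoff_sum f g T x / real T - (\<integral>x. g x \<partial>\<mu>)\<bar> < \<epsilon>)"
        by (rule periodic_approximation[OF \<mu> G(1) _ G(3)]) (rule bspec[OF G(2)])
      then obtain x T where T: "T > 0" "(f ^^ T) x = x"
        and ap: "\<forall>g\<in>G. \<bar>birkhoff_sum f g T x / real T - (\<integral>x. g x \<partial>\<mu>)\<bar> < \<epsilon>"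
        by blast
      have \<nu>: "orbit_measure f x T \<in> periodic_orbit_measures f"
        by (rule orbit_measure_periodic[OF measurable_sphere_continuous[OF continuous] T])
      have "\<forall>g\<in>G. \<bar>integral\<^sup>L (orbit_measure f x T) g - integral\<^sup>L \<mu> g\<bar> < \<epsilon>"
      proof
        fix g assume g: "g \<in> G"
        have "integral\<^sup>L (orbit_measure f x T) g = birkhoff_sum f g T x / real T"
          by (rule integral_orbit_measure[OF T(1) borel_measurable_sphere_continuous[OF bspec[OF G(2) g]]])
        then show "\<bar>integral\<^sup>L (orbit_measure f x T) g - integral\<^sup>L \<mu> g\<bar> < \<epsilon>" using bspec[OF ap g] by simp
      qed
      then have "orbit_measure f x T \<in> W" using orbit_measure_prob by (intro subsetD[OF G(4)]) simp
      moreover have "orbit_measure f x T \<in> invariant_measures f"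
        using \<nu> by (simp add: periodic_orbit_measures_def)
      ultimately show ?thesis using \<nu> W(2) by blast
    qed
    then show "\<mu> \<in> subtopology weak_star_topology (invariant_measures f) closure_of periodic_orbit_measures f"
      unfolding in_closure_of top using \<mu> by blast
  qed
qed

end
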